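(* Let $1\le p,u\le\infty$ and put $\bar p=\min(p,2)$, $\bar u=\min(u,2)$. Then there exist constants $0<c_0<1$ and $c_1,\dots,c_{13}>0$ (not depending on $n,N_1,N_2$) such that for all $n,N_1,N_2\in\mathbb{N}$ with $n<c_0N_1N_2$ the following hold, where we write $I=I^{N_1,N_2}$ and $B=B_{L_p^{N_1}(L_u^{N_2})}$. If $p\ge u$, then $$c_1\min\big(N_2^{1/\bar u-1/\bar p}n^{-1+1/\bar p},\,n^{-1+1/\bar u}\big)\le e_n^{\mathrm{ran}}(I,B)\le e_n^{\mathrm{ran-non}}(I,B)\le c_2\min\big(N_2^{1/\bar u-1/\bar p}n^{-1+1/\bar p},\,n^{-1+1/\bar u}\big).$$ If $p<u\le 2$, then $$c_3\min\big(N_1^{1/p-1/u}n^{-1+1/u},\,n^{-1+1/p}\big)\le e_n^{\mathrm{ran}}(I,B)\le e_n^{\mathrm{ran-non}}(I,B)\le c_4\min\big(N_1^{1/p-1/u}n^{-1+1/u},\,n^{-1+1/p}\big).$$ If $2\le p<u$, then $$c_5n^{-1/2}\le e_n^{\mathrm{ran}}(I,B)\le e_n^{\mathrm{ran-non}}(I,B)\le c_6n^{-1/2}.$$ If $p<2<u$ and $n\ge N_1$, then $$c_7N_1^{1/p-1/u}n^{-1+1/u}+c_7n^{-1/2}\le e_n^{\mathrm{ran}}(I,B)\le c_8N_1^{1/p-1/u}n^{-1+1/u}(\log(N_1+1))^{1-1/u}+c_8n^{-1/2}(\log(N_1+1))^{1/2}$$ and $$c_9N_1^{1/p-1/2}n^{-1/2}\le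 e_n^{\mathrm{ran-non}}(I,B)\le c_{10}N_1^{1/p-1/2}n^{-1/2}.$$ If $p<2<u$ and $n<N_1$, then $$c_{11}n^{-1+1/p}\le e_n^{\mathrm{ran}}(I,B)\le e_n^{\mathrm{ran-non}}(I,B)\le c_{12}n^{-1+1/p}.$$ In the deterministic setting, for all $1\le p,u\le\infty$, $$c_{13}\le e_n^{\mathrm{det}}(I,B)\le e_n^{\mathrm{det-non}}(I,B)\le 1.$$
   Context: $\mathbb{N}=\{1,2,\dots\}$, $\mathbb{N}_0=\mathbb{N}\cup\{0\}$, $\mathbb{K}\in\{\mathbb{R},\mathbb{C}\}$, $\log=\log_2$, $1/\infty=0$, $B_X$ is the closed unit ball of a normed space $X$. Spaces and problem. For $N\in\mathbb{N}$, $1\le p\le\infty$, $L_p^N$ is the space of functions $f:\{1,\dots,N\}\to\mathbb{K}$ with norm $\big(\frac1N\sum_{i=1}^N|f(i)|^p\big)^{1/p}$ if $p<\infty$ and $\max_i|f(i)|$ if $p=\infty$. $L_p^{N_1}(L_u^{N_2})$ is the space of all $f:\{1,\dots,N_1\}\times\{1,\dots,N_2\}\to\mathbb{K}$ with norm $\big\|(\|f_i\|_{L_u^{N_2}})_{i=1}^{N_1}\big\|_{L_p^{N_1}}$, where $f_i=(f(i,j))_{j=1}^{N_2}$. The mean operator is $I^{N_1,N_2}f=\frac1{N_1N_2}\sum_{i=1}^{N_1}\sum_{j=1}^{N_2}f(i,j)\in\mathbb{K}$. The numerical problem considered is $(F,G,S,K,\Lambda)$ with $F=B_{L_p^{N_1}(L_u^{N_2})}$,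 $G=K=\mathbb{K}$, $S=I^{N_1,N_2}$, $\Lambda=\Lambda^{N_1,N_2}=\{\delta_{ij}:1\le i\le N_1,1\le j\le N_2\}$, $\delta_{ij}(f)=f(i,j)$ (standard information). Algorithms and minimal errors. A numerical problem is a tuple $(F,G,S,K,\Lambda)$: $F$ a nonempty set, $G$ a Banach space, $S:F\to G$ a map, $K$ a nonempty set, $\Lambda$ a nonempty set of maps $F\to K$. A deterministic algorithm is a tuple $A=((L_i)_{i\ge1},(\tau_i)_{i\ge0},(\varphi_i)_{i\ge0})$ with $L_1\in\Lambda$, $\tau_0\in\{0,1\}$, $\varphi_0\in G$ and arbitrary maps $L_{i+1}:K^i\to\Lambda$, $\tau_i:K^i\to\{0,1\}$, $\varphi_i:K^i\to G$ $(i\ge1)$. For $f\in F$ let $\lambda_1=L_1$, $\lambda_i=L_i(\lambda_1(f),\dots,\lambda_{i-1}(f))$ $(i\ge2)$. $\mathrm{card}(A,f)$ is the smallest $n\ge0$ with $\tau_n(\lambda_1(f),\dots,\lambda_n(f))=1$ (for $n=0$: $\tau_0=1$), and $\infty$ if there is none. The output is $A(f)=\varphi_n(\lambda_1(f),\dots,\lambda_n(f))$ if $n=\mathrm{card}(A,f)<\infty$ (with $A(f)=\varphi_0$ for $n=0$) and $A(f)=\varphi_0$ if $\mathrm{card}(A,f)=\infty$. $A$ is non-adaptive if all $L_i$ and all $\tau_i$ are constant. For $n\in\mathbb{N}_0$, $e_n^{\mathrm{det}}(S,F,G)$ (resp. $e_n^{\mathrm{det-non}}(S,F,G)$) is the infimum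 of $\sup_{f\in F}\|S(f)-A(f)\|_G$ over all (resp. all non-adaptive) deterministic algorithms with $\sup_{f\in F}\mathrm{card}(A,f)\le n$. A randomized algorithm is $A=((\Omega,\Sigma,\mathbb{P}),(A_\omega)_{\omega\in\Omega})$ with $(\Omega,\Sigma,\mathbb{P})$ a probability space and each $A_\omega$ a deterministic algorithm, such that for every $f\in F$ the map $\omega\mapsto\mathrm{card}(A_\omega,f)$ is measurable and $\omega\mapsto A_\omega(f)$ is Borel measurable and almost surely separably valued; it is non-adaptive if every $A_\omega$ is. $e_n^{\mathrm{ran}}(S,F,G)$ (resp. $e_n^{\mathrm{ran-non}}(S,F,G)$) is the infimum of $\sup_{f\in F}\mathbb{E}\|S(f)-A_\omega(f)\|_G$ over all (resp. all non-adaptive) randomized algorithms with $\sup_{f\in F}\mathbb{E}\,\mathrm{card}(A_\omega,f)\le n$. If $G=\mathbb{K}$, $G$ is omitted from the notation. *)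

theory Defs
  imports "HOL-Probability.Probability"
begin

section \<open>Deterministic algorithms\<close>

text \<open>
  An algorithm has three families of maps on \<open>K\<^sup>i\<close>, \<open>i \<ge> 0\<close>. Each family is one function on
  lists over \<open>'k\<close> (the type \<open>'k\<close> is the nonempty set \<open>K\<close>); its restriction to the lists of
  length \<open>i\<close> is the member with domain \<open>K\<^sup>i\<close>. So \<open>query A []\<close> is \<open>L\<^sub>1\<close>, \<open>query A\<close> on lists of
  length \<open>i\<close> is the map with index \<open>i + 1\<close> of the family \<open>L\<close>, and \<open>stop A\<close>, \<open>result A\<close> on lists
  of length \<open>i\<close> are the \<open>i\<close>-th maps of the families \<open>\<tau>\<close>, \<open>\<phi>\<close>.
\<close>

record ('f, 'k, 'g) det_alg =
  query :: "'k list \<Rightarrow> 'f \<Rightarrow> 'k"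
  stop :: "'k list \<Rightarrow> bool"
  result :: "'k list \<Rightarrow> 'g"

definition det_algs :: "('f \<Rightarrow> 'k) set \<Rightarrow> ('f, 'k, 'g) det_alg set" where
  "det_algs \<Lambda> = {A. \<forall>xs. query A xs \<in> \<Lambda>}"

definition nonadaptive :: "('f, 'k, 'g) det_alg \<Rightarrow> bool" where
  "nonadaptive A \<longleftrightarrow>
     (\<forall>xs ys. length xs = length ys \<longrightarrow> query A xs = query A ys \<and> stop A xs = stop A ys)"

text \<open>\<open>info A f n\<close> is the list of the first \<open>n\<close> values \<open>\<lambda>\<^sub>1(f), \<dots>, \<lambda>\<^sub>n(f)\<close>.\<close>

primrec info :: "('f, 'k, 'g) det_alg \<Rightarrow> 'f \<Rightarrow> nat \<Rightarrow> 'k list" where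
  "info A f 0 = []"
| "info A f (Suc n) = info A f n @ [query A (info A f n) f]"

definition alg_card :: "('f, 'k, 'g) det_alg \<Rightarrow> 'f \<Rightarrow> enat" where
  "alg_card A f =
     (if \<exists>n. stop A (info A f n) then enat (LEAST n. stop A (info A f n)) else \<infinity>)"

definition alg_out :: "('f, 'k, 'g) det_alg \<Rightarrow> 'f \<Rightarrow> 'g" where
  "alg_out A f = (case alg_card A f of enat n \<Rightarrow> result A (info A f n) | \<infinity> \<Rightarrow> result A [])"

definition det_error ::
  "('f \<Rightarrow> 'g::banach) \<Rightarrow> 'f set \<Rightarrow> ('f, 'k, 'g) det_alg \<Rightarrow> ennreal" where
  "det_error S F A = (SUP f\<in>F. ennreal (norm (S f - alg_out A f)))"

definition e_det :: "nat \<Rightarrow> ('f \<Rightarrow> 'g::banach) \<Rightarrow> 'f set \<Rightarrow> ('f \<Rightarrow> 'k) set \<Rightarrow> ennreal" where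
  "e_det n S F \<Lambda> =
     (INF A\<in>{A \<in> det_algs \<Lambda>. (SUP f\<in>F. alg_card A f) \<le> enat n}. det_error S F A)"

definition e_det_non :: "nat \<Rightarrow> ('f \<Rightarrow> 'g::banach) \<Rightarrow> 'f set \<Rightarrow> ('f \<Rightarrow> 'k) set \<Rightarrow> ennreal" where
  "e_det_non n S F \<Lambda> =
     (INF A\<in>{A \<in> det_algs \<Lambda>. nonadaptive A \<and> (SUP f\<in>F. alg_card A f) \<le> enat n}.
        det_error S F A)"


section \<open>Randomized algorithms\<close>

definition ran_alg ::
  "'f set \<Rightarrow> ('f \<Rightarrow> 'k) set \<Rightarrow> 'w measure \<Rightarrow> ('w \<Rightarrow> ('f, 'k, 'g::banach) det_alg) \<Rightarrow> bool" where
  "ran_alg F \<Lambda> M A \<longleftrightarrow>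
     prob_space M \<and> (\<forall>\<omega>\<in>space M. A \<omega> \<in> det_algs \<Lambda>) \<and>
     (\<forall>f\<in>F. (\<lambda>\<omega>. alg_card (A \<omega>) f) \<in> M \<rightarrow>\<^sub>M count_space UNIV \<and>
            (\<lambda>\<omega>. alg_out (A \<omega>) f) \<in> borel_measurable M \<and>
            (\<exists>D. countable D \<and> (AE \<omega> in M. alg_out (A \<omega>) f \<in> closure D)))"

definition ran_nonadaptive :: "'w measure \<Rightarrow> ('w \<Rightarrow> ('f, 'k, 'g) det_alg) \<Rightarrow> bool" where
  "ran_nonadaptive M A \<longleftrightarrow> (\<forall>\<omega>\<in>space M. nonadaptive (A \<omega>))"

definition ran_card :: "'f set \<Rightarrow> 'w measure \<Rightarrow> ('w \<Rightarrow> ('f, 'k, 'g) det_alg) \<Rightarrow> ennreal" where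
  "ran_card F M A = (SUP f\<in>F. \<integral>\<^sup>+\<omega>. ennreal_of_enat (alg_card (A \<omega>) f) \<partial>M)"

definition ran_error ::
  "('f \<Rightarrow> 'g::banach) \<Rightarrow> 'f set \<Rightarrow> 'w measure \<Rightarrow> ('w \<Rightarrow> ('f, 'k, 'g) det_alg) \<Rightarrow> ennreal" where
  "ran_error S F M A = (SUP f\<in>F. \<integral>\<^sup>+\<omega>. ennreal (norm (S f - alg_out (A \<omega>) f)) \<partial>M)"

text \<open>
  In \<open>ran_alg\<close>, separability of the range is membership in the closure of a countable set, since
  a subset of a metric space is separable iff such a closure contains it.

  HOL cannot quantify over all types of sample points inside a term, so in the two infima below
  \<open>\<Omega>\<close> ranges over the probability spaces whose points lie in the type of deterministic algorithms.
  This loses nothing: pushing \<open>\<P>\<close> forward along \<open>\<omega> \<mapsto> A\<^sub>\<omega>\<close> gives an algorithm with the same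
  cardinality and error. The lemmas \<open>e_ran_le\<close> and \<open>e_ran_non_le\<close> below prove this for
  probability spaces over an arbitrary type.
\<close>

definition e_ran :: "nat \<Rightarrow> ('f \<Rightarrow> 'g::banach) \<Rightarrow> 'f set \<Rightarrow> ('f \<Rightarrow> 'k) set \<Rightarrow> ennreal" where
  "e_ran n S F \<Lambda> =
     (INF (M :: ('f, 'k, 'g) det_alg measure, A)
        \<in>{(M, A). ran_alg F \<Lambda> M A \<and> ran_card F M A \<le> of_nat n}. ran_error S F M A)"

definition e_ran_non :: "nat \<Rightarrow> ('f \<Rightarrow> 'g::banach) \<Rightarrow> 'f set \<Rightarrow> ('f \<Rightarrow> 'k) set \<Rightarrow> ennreal" where
  "e_ran_non n S F \<Lambda> =
     (INF (M :: ('f, 'k, 'g) det_alg measure, A)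
        \<in>{(M, A). ran_alg F \<Lambda> M A \<and> ran_nonadaptive M A \<and> ran_card F M A \<le> of_nat n}.
        ran_error S F M A)"

lemma ran_alg_pushforward:
  fixes M :: "'w measure" and A :: "'w \<Rightarrow> ('f, 'k, 'g::banach) det_alg"
  assumes "ran_alg F \<Lambda> M A"
  obtains N :: "('f, 'k, 'g) det_alg measure"
  where "ran_alg F \<Lambda> N (\<lambda>B. B)" "space N = A ` space M"
    "ran_card F N (\<lambda>B. B) = ran_card F M A"
    "ran_error S F N (\<lambda>B. B) = ran_error S F M A"
proof -
  interpret prob_space M using assms by (simp add: ran_alg_def)
  define G where "G = {B. B \<subseteq> A ` space M \<and> A -` B \<inter> space M \<in> sets M}"
  define N0 where "N0 = sigma (A ` space M) G"
  define N where "N = distr M N0 A"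
  have GP: "G \<subseteq> Pow (A ` space M)" by (auto simp: G_def)
  have sp0: "space N0 = A ` space M" unfolding N0_def using GP by (rule space_measure_of)
  have A0: "A \<in> M \<rightarrow>\<^sub>M N0"
    unfolding N0_def using GP by (intro measurable_measure_of) (auto simp: G_def)
  have G0: "B \<in> sets N0" if "B \<in> G" for B
    using that GP by (simp add: N0_def)
  have lift: "h \<in> N0 \<rightarrow>\<^sub>M K" if h: "(\<lambda>\<omega>. h (A \<omega>)) \<in> M \<rightarrow>\<^sub>M K"
    for h :: "('f, 'k, 'g) det_alg \<Rightarrow> 'z" and K
  proof (rule measurableI)
    fix x assume "x \<in> space N0"
    then show "h x \<in> space K" using measurable_space[OF h] by (auto simp: sp0)
  next
    fix E assume "E \<in> sets K"
    have "A -` (h -` E \<inter> space N0) \<inter> space M = (\<lambda>\<omega>. h (A \<omega>)) -` E \<inter> space M"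
      by (auto simp: sp0)
    then have "h -` E \<inter> space N0 \<in> G"
      using measurable_sets[OF h \<open>E \<in> sets K\<close>] by (auto simp: G_def sp0)
    then show "h -` E \<inter> space N0 \<in> sets N0" by (rule G0)
  qed
  have mcard: "(\<lambda>B. alg_card B f) \<in> N0 \<rightarrow>\<^sub>M count_space UNIV"
    and mout: "(\<lambda>B. alg_out B f) \<in> borel_measurable N0"
    and sep: "\<exists>D. countable D \<and> (AE \<omega> in M. alg_out (A \<omega>) f \<in> closure D)" if "f \<in> F" for f
    using assms that by (auto simp: ran_alg_def intro!: lift)
  have "ran_alg F \<Lambda> N (\<lambda>B. B)"
    unfolding ran_alg_def
  proof (intro conjI ballI)
    show "prob_space N" unfolding N_def using A0 by (rule prob_space_distr)
    show "B \<in> det_algs \<Lambda>" if "B \<in> space N" for B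
      using that assms by (auto simp: N_def sp0 ran_alg_def)
    fix f assume f: "f \<in> F"
    show "(\<lambda>B. alg_card B f) \<in> N \<rightarrow>\<^sub>M count_space UNIV" using mcard[OF f] by (simp add: N_def)
    show "(\<lambda>B. alg_out B f) \<in> borel_measurable N" using mout[OF f] by (simp add: N_def)
    obtain D where D: "countable D" "AE \<omega> in M. alg_out (A \<omega>) f \<in> closure D"
      using sep[OF f] by blast
    have "{B \<in> space N0. alg_out B f \<in> closure D} = (\<lambda>B. alg_out B f) -` closure D \<inter> space N0"
      by auto
    then have "{B \<in> space N0. alg_out B f \<in> closure D} \<in> sets N0"
      using measurable_sets[OF mout[OF f], of "closure D"] by simp
    then have "AE B in N. alg_out B f \<in> closure D"
      unfolding N_def using D(2) A0 by (subst AE_distr_iff) auto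
    then show "\<exists>D. countable D \<and> (AE B in N. alg_out B f \<in> closure D)" using D(1) by blast
  qed
  moreover have "space N = A ` space M" by (simp add: N_def sp0)
  moreover have "ran_card F N (\<lambda>B. B) = ran_card F M A"
    unfolding ran_card_def
  proof (rule SUP_cong)
    fix f assume f: "f \<in> F"
    have "(\<lambda>B. ennreal_of_enat (alg_card B f)) \<in> borel_measurable N0"
      by (rule measurable_compose[OF mcard[OF f]]) simp
    then show "(\<integral>\<^sup>+B. ennreal_of_enat (alg_card B f) \<partial>N)
        = (\<integral>\<^sup>+\<omega>. ennreal_of_enat (alg_card (A \<omega>) f) \<partial>M)"
      unfolding N_def using A0 by (subst nn_integral_distr) auto
  qed simp
  moreover have "ran_error S F N (\<lambda>B. B) = ran_error S F M A"
    unfolding ran_error_def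
  proof (rule SUP_cong)
    fix f assume f: "f \<in> F"
    have "(\<lambda>B. ennreal (norm (S f - alg_out B f))) \<in> borel_measurable N0"
      by (rule measurable_compose[OF mout[OF f]], rule measurable_compose[of _ _ borel],
          rule borel_measurable_continuous_onI) (auto intro!: continuous_intros)
    then show "(\<integral>\<^sup>+B. ennreal (norm (S f - alg_out B f)) \<partial>N)
        = (\<integral>\<^sup>+\<omega>. ennreal (norm (S f - alg_out (A \<omega>) f)) \<partial>M)"
      unfolding N_def using A0 by (subst nn_integral_distr) auto
  qed simp
  ultimately show thesis by (rule that)
qed

lemma e_ran_le:
  fixes M :: "'w measure" and A :: "'w \<Rightarrow> ('f, 'k, 'g::banach) det_alg"
  assumes "ran_alg F \<Lambda> M A" "ran_card F M A \<le> of_nat n"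
  shows "e_ran n S F \<Lambda> \<le> ran_error S F M A"
proof -
  obtain N :: "('f, 'k, 'g) det_alg measure"
    where N: "ran_alg F \<Lambda> N (\<lambda>B. B)" "ran_card F N (\<lambda>B. B) = ran_card F M A"
      "ran_error S F N (\<lambda>B. B) = ran_error S F M A"
    using ran_alg_pushforward[OF assms(1), of S] by metis
  have "e_ran n S F \<Lambda> \<le> ran_error S F N (\<lambda>B. B)"
    unfolding e_ran_def using N assms(2) by (intro INF_lower2[of "(N, \<lambda>B. B)"]) auto
  then show ?thesis by (simp add: N)
qed

lemma e_ran_non_le:
  fixes M :: "'w measure" and A :: "'w \<Rightarrow> ('f, 'k, 'g::banach) det_alg"
  assumes "ran_alg F \<Lambda> M A" "ran_nonadaptive M A" "ran_card F M A \<le> of_nat n"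
  shows "e_ran_non n S F \<Lambda> \<le> ran_error S F M A"
proof -
  obtain N :: "('f, 'k, 'g) det_alg measure"
    where N: "ran_alg F \<Lambda> N (\<lambda>B. B)" "space N = A ` space M"
      "ran_card F N (\<lambda>B. B) = ran_card F M A" "ran_error S F N (\<lambda>B. B) = ran_error S F M A"
    using ran_alg_pushforward[OF assms(1), of S] by metis
  have "ran_nonadaptive N (\<lambda>B. B)" using assms(2) N(2) by (auto simp: ran_nonadaptive_def)
  then have "e_ran_non n S F \<Lambda> \<le> ran_error S F N (\<lambda>B. B)"
    unfolding e_ran_non_def using N assms(3) by (intro INF_lower2[of "(N, \<lambda>B. B)"]) auto
  then show ?thesis by (simp add: N)
qed


section \<open>The scalar field\<close>

text \<open>
  The scalar field \<open>\<real>\<close> or \<open>\<complex>\<close> is a type of class \<open>real_normed_field\<close> and \<open>euclidean_space\<close>. Both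
  \<^typ>\<open>real\<close> and \<^typ>\<open>complex\<close> are in these classes, and by the following lemma every
  such type is isometrically isomorphic to one of the two.
\<close>

lemma scalar_field_real_or_complex:
  "(\<forall>z :: 'k::{real_normed_field, euclidean_space}. \<exists>a. z = of_real a) \<or>
   (\<exists>j :: 'k. j * j = -1 \<and> (\<forall>z. \<exists>a b. z = of_real a + of_real b * j) \<and>
      (\<forall>a b. norm (of_real a + of_real b * j) = cmod (Complex a b)))"
proof -
  have n1: "inner (1::'k) 1 = 1" by (simp add: dot_square_norm)
  have sq: "w * w = -1" if w: "norm w = 1" "inner 1 w = 0" for w :: 'k
  proof -
    have ww: "inner w w = 1" using w(1) by (simp add: dot_square_norm)
    have "(norm (1 + w))\<^sup>2 = 2" "(norm (1 - w))\<^sup>2 = 2"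
      using ww n1 w(2)
      by (simp_all add: power2_norm_eq_inner inner_add_left inner_add_right inner_diff_left
          inner_diff_right inner_commute)
    then have "(norm ((1 + w) * (1 - w)))\<^sup>2 = 4" by (simp add: norm_mult power_mult_distrib)
    moreover have "(1 + w) * (1 - w) = 1 - w * w" by (simp add: algebra_simps)
    ultimately have "inner (1 - w * w) (1 - w * w) = 4" by (simp add: power2_norm_eq_inner)
    moreover have "inner (w * w) (w * w) = 1"
      using w(1) by (simp add: dot_square_norm norm_mult)
    ultimately have "inner (1 + w * w) (1 + w * w) = 0"
      using n1 by (simp add: inner_add_left inner_add_right inner_diff_left inner_diff_right)
    then have "1 + w * w = 0" by simp
    then show ?thesis by (simp add: eq_neg_iff_add_eq_0 add.commute)
  qed
  have dec: "inner 1 (z - of_real (inner 1 z)) = 0" for z :: 'k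
    using n1 by (simp add: inner_diff_right of_real_def)
  show ?thesis
  proof (cases "\<forall>z :: 'k. \<exists>a. z = of_real a")
    case False
    then obtain z0 :: 'k where z0: "\<And>a. z0 \<noteq> of_real a" by blast
    define v where "v = z0 - of_real (inner 1 z0)"
    define j where "j = v /\<^sub>R norm v"
    have "v \<noteq> 0" using z0 by (simp add: v_def)
    then have nj: "norm j = 1" by (simp add: j_def)
    have oj: "inner 1 j = 0" using dec[of z0] by (simp add: j_def v_def)
    have jj: "j * j = -1" using sq[OF nj oj] .
    have "\<exists>a b. z = of_real a + of_real b * j" for z :: 'k
    proof -
      define y where "y = z - of_real (inner 1 z)"
      have z: "z = of_real (inner 1 z) + y" by (simp add: y_def)
      show ?thesis
      proof (cases "y = 0")
        case True
        then show ?thesis using z by (intro exI[of _ "inner 1 z"] exI[of _ 0]) simp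
      next
        case False
        define k where "k = y /\<^sub>R norm y"
        have "norm k = 1" using False by (simp add: k_def)
        moreover have "inner 1 k = 0" using dec[of z] by (simp add: k_def y_def)
        ultimately have "k * k = -1" by (rule sq)
        then have "(k - j) * (k + j) = 0" using jj by (simp add: algebra_simps)
        then have "k = j \<or> k = - j" by (auto simp: eq_neg_iff_add_eq_0)
        moreover have y: "y = of_real (norm y) * k"
          using False by (simp add: k_def scaleR_conv_of_real)
        ultimately have "y = of_real (norm y) * j \<or> y = of_real (- norm y) * j" by auto
        then show ?thesis using z by metis
      qed
    qed
    moreover have "norm (of_real a + of_real b * j) = cmod (Complex a b)" for a b
    proof -
      have "inner j j = 1" using nj by (simp add: dot_square_norm)
      moreover have "of_real a + of_real b * j = a *\<^sub>R 1 + b *\<^sub>R j"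
        by (simp add: scaleR_conv_of_real)
      ultimately show ?thesis using n1 oj
        unfolding complex_norm
        by (simp add: norm_eq_sqrt_inner inner_add_left inner_add_right inner_commute
            power2_eq_square)
    qed
    ultimately show ?thesis using jj by blast
  qed simp
qed


section \<open>Mean computation in mixed norm spaces\<close>

text \<open>The exponent \<open>1/p\<close>; for \<open>p = \<infinity>\<close> it is \<open>0\<close>.\<close>

definition recip :: "ereal \<Rightarrow> real" where
  "recip p = real_of_ereal (1 / p)"

definition Lp_norm :: "ereal \<Rightarrow> nat \<Rightarrow> (nat \<Rightarrow> 'k::real_normed_vector) \<Rightarrow> real" where
  "Lp_norm p N f =
     (if p = \<infinity> then (MAX i\<in>{1..N}. norm (f i))
      else (1 / real N * (\<Sum>i=1..N. norm (f i) powr real_of_ereal p)) powr recip p)"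

definition mixed_norm ::
  "ereal \<Rightarrow> nat \<Rightarrow> ereal \<Rightarrow> nat \<Rightarrow> (nat \<times> nat \<Rightarrow> 'k::real_normed_vector) \<Rightarrow> real" where
  "mixed_norm p N1 u N2 f = Lp_norm p N1 (\<lambda>i. Lp_norm u N2 (\<lambda>j. f (i, j)))"

text \<open>Functions on the index grid are total functions that are \<^const>\<open>undefined\<close> off the grid.\<close>

definition mixed_ball ::
  "ereal \<Rightarrow> nat \<Rightarrow> ereal \<Rightarrow> nat \<Rightarrow> (nat \<times> nat \<Rightarrow> 'k::real_normed_vector) set" where
  "mixed_ball p N1 u N2 =
     {f \<in> extensional ({1..N1} \<times> {1..N2}). mixed_norm p N1 u N2 f \<le> 1}"

definition mean_op :: "nat \<Rightarrow> nat \<Rightarrow> (nat \<times> nat \<Rightarrow> 'k::real_normed_field) \<Rightarrow> 'k" where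
  "mean_op N1 N2 f = 1 / (of_nat N1 * of_nat N2) * (\<Sum>i=1..N1. \<Sum>j=1..N2. f (i, j))"

definition std_info :: "nat \<Rightarrow> nat \<Rightarrow> ((nat \<times> nat \<Rightarrow> 'k) \<Rightarrow> 'k) set" where
  "std_info N1 N2 = {\<lambda>f. f (i, j) |i j. i \<in> {1..N1} \<and> j \<in> {1..N2}}"

end

theory Submission
  imports Defs
begin

text \<open>
  The randomized upper bounds, except the adaptive one, come from plain Monte Carlo with \<open>n\<close>
  uniform grid points. On functions with normalized \<open>q\<close>-th moment at most \<open>c\<^sup>q\<close>, \<open>1 \<le> q \<le> 2\<close>,
  its error is of order \<open>c * n powr (-1 + 1/q)\<close>: cut \<open>f\<close> at height \<open>c * n powr (1/q)\<close>, bound the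
  variance of the small part and the mean of the large part (\<open>monte_carlo_error\<close>). A function
  of the mixed ball has such moments with
  \<open>c = N1 powr max 0 (1/p - 1/q) * N2 powr max 0 (1/u - 1/q)\<close> (\<open>mixed_ball_moment\<close>), and each
  rate is the one for a suitable \<open>q\<close> among \<open>p\<close>, \<open>u\<close>, \<open>2\<close>, or the smaller of two such rates.

  For \<open>p < 2 < u\<close> and \<open>n \<ge> N1\<close> adaption pays, because the rows of \<open>f\<close> may have very different
  sizes. A pilot stage draws \<open>k\<close> values, \<open>k\<close> of order \<open>n / N1\<close>, from each row \<open>i\<close> and computes the
  empirical second moment \<open>\<theta>\<^sub>i\<^sup>2\<close> as an estimate of the true one,
  \<open>\<sigma>\<^sub>i\<^sup>2\<close>. A second stage spends fresh samples on the rows, at least \<open>k\<close> on each and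
  otherwise proportionally to \<open>\<theta>\<^sub>i\<close>. Rows with \<open>\<theta>\<^sub>i \<ge> \<sigma>\<^sub>i / 2\<close> contribute an
  error of order \<open>n powr (-1/2)\<close>, just as if the \<open>\<sigma>\<^sub>i\<close> were known. The others are rare
  where it matters: if \<open>a\<^sub>i\<close> is the \<open>u\<close>-norm of the row, then \<open>\<sigma>\<^sub>i\<^sup>2\<close> times the
  probability of underestimation is at most of order \<open>a\<^sub>i\<^sup>2 * k powr (-1 + 2/u)\<close>
  (\<open>underestimation_bound\<close>), which leads to the other term of the rate (\<open>two_stage_error\<close>).

  For the lower bounds the grid is divided into \<open>r1 * r2\<close> rectangular cells, with \<open>r1 * r2\<close>
  between \<open>4 * n\<close> and \<open>8 * n\<close>. A random test function is supported on one cell from each of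
  several disjoint groups of equally many cells; each of these cells is chosen at random and
  carries a random sign. Two things keep an algorithm from computing the mean. The signs in
  groups whose active cell was not sampled can be flipped without changing the run, so by
  Khinchine's inequality the error is at least of the order of the contribution of one active
  cell to the mean times the square root of the number of such groups (\<open>sign_error\<close>). And at
  least half of the groups stay unhit on average, since the expected number of hits is at
  most \<open>2 / q\<close> times the number of samples if a group has \<open>q\<close> cells (\<open>transversal_hits\<close>). One group
  containing all cells, one group per row block, and one group per cell give the three kinds
  of rates. A non-adaptive algorithm cannot react to where it finds something, and therefore
  already fails on random signs that fill a single row block in an unknown place
  (\<open>nonadaptive_hits\<close>).

  Changing the zero function to \<open>1\<close>, or to \<open>-1\<close>, off the at most \<open>n\<close> points at which a
  deterministic algorithm samples it does not change the run, but it changes the mean by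
  almost \<open>1\<close> if \<open>n\<close> is small compared with \<open>N1 * N2\<close> (\<open>e_det_lower\<close>).
\<close>

section \<open>Normalized norms and their comparison\<close>

lemma recip_ereal: "recip (ereal q) = 1 / q"
  by (cases "q = 0") (auto simp: recip_def one_ereal_def divide_ereal_def inverse_eq_divide)

lemma recip_infty [simp]: "recip \<infinity> = 0"
  by (simp add: recip_def)

lemma recip_two [simp]: "recip 2 = 1 / 2" "recip (ereal 2) = 1 / 2"
  using recip_ereal[of 2] by simp_all

lemma exponent_cases:
  fixes p :: ereal
  assumes "1 \<le> p"
  obtains "p = \<infinity>" | q where "p = ereal q" "1 \<le> q"
  using assms by (cases p) (auto simp: one_ereal_def)

lemma two_less_imp_ge_one: "2 < p \<Longrightarrow> 1 \<le> (p :: ereal)"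
  by (cases p) (auto simp: one_ereal_def)

lemma recip_antimono:
  assumes "1 \<le> p" "p \<le> q"
  shows "recip q \<le> recip p"
proof -
  have q: "1 \<le> q" using assms by order
  show ?thesis
    by (rule exponent_cases[OF assms(1)]; rule exponent_cases[OF q])
       (use assms in \<open>auto simp: recip_ereal divide_simps\<close>)
qed

lemma recip_bounds:
  assumes "1 \<le> p"
  shows "0 \<le> recip p" "recip p \<le> 1"
  using recip_antimono[OF order_refl assms] recip_ereal[of 1] recip_antimono[OF assms, of \<infinity>]
  by (auto simp: one_ereal_def)

lemma Lp_norm_ereal:
  "Lp_norm (ereal q) N f = ((\<Sum>i=1..N. norm (f i) powr q) / N) powr (1 / q)"
  by (simp add: Lp_norm_def recip_ereal)

lemma Lp_norm_ereal_le_iff: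
  assumes "0 < q" "0 \<le> c" "1 \<le> N"
  shows "Lp_norm (ereal q) N f \<le> c \<longleftrightarrow> (\<Sum>i=1..N. norm (f i) powr q) \<le> N * c powr q"
proof -
  define S where "S = (\<Sum>i=1..N. norm (f i) powr q) / N"
  have S: "0 \<le> S" by (auto simp: S_def intro!: divide_nonneg_nonneg sum_nonneg)
  have "S powr (1/q) \<le> c \<longleftrightarrow> S \<le> c powr q"
  proof
    assume "S powr (1/q) \<le> c"
    then have "(S powr (1/q)) powr q \<le> c powr q" using assms by (intro powr_mono2) auto
    then show "S \<le> c powr q" using assms S by (simp add: powr_powr)
  next
    assume "S \<le> c powr q"
    then have "S powr (1/q) \<le> (c powr q) powr (1/q)" using S assms by (intro powr_mono2) auto
    then show "S powr (1/q) \<le> c" using assms by (simp add: powr_powr)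
  qed
  then show ?thesis using assms by (simp add: S_def Lp_norm_ereal divide_simps mult.commute)
qed

lemma Lp_norm_nonneg: "1 \<le> N \<Longrightarrow> 0 \<le> Lp_norm p N f"
proof (cases "p = \<infinity>")
  case True
  assume N: "1 \<le> N"
  have "norm (f 1) \<le> (MAX i\<in>{1..N}. norm (f i))" using N by (intro Max_ge) auto
  then have "0 \<le> (MAX i\<in>{1..N}. norm (f i))" by (rule order_trans[OF norm_ge_zero])
  then show ?thesis using True by (simp add: Lp_norm_def)
qed (simp add: Lp_norm_def)

lemma Lp_norm_infty_le_iff:
  "1 \<le> N \<Longrightarrow> Lp_norm \<infinity> N f \<le> c \<longleftrightarrow> (\<forall>i\<in>{1..N}. norm (f i) \<le> c)"
  by (simp add: Lp_norm_def)

lemma Lp_norm_ereal_power: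
  assumes "1 \<le> q" "1 \<le> N"
  shows "(\<Sum>i=1..N. norm (f i) powr q) \<le> N * Lp_norm (ereal q) N f powr q"
  using Lp_norm_ereal_le_iff[of q "Lp_norm (ereal q) N f" N f] assms Lp_norm_nonneg[of N] by auto

text \<open>
  The tangent inequality for the concave power function; summed over the entries it is the
  monotonicity of power means.
\<close>

lemma powr_le_affine:
  fixes x :: real
  assumes "0 \<le> x" "0 \<le> a" "a \<le> 1"
  shows "x powr a \<le> a * x + (1 - a)"
proof (cases "x = 0")
  case False
  have "x powr a * 1 powr (1 - a) \<le> a * x + (1 - a) * 1"
    using False assms by (intro Youngs_inequality_0) auto
  then show ?thesis by simp
qed (use assms in auto)

text \<open>
  Both directions of the comparison of power means in one estimate: by convexity the
  normalized norms increase with the exponent, and in the other direction no single value can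
  exceed \<open>N powr (1/P)\<close> times the \<open>P\<close>-norm, which costs a power of the dimension.
\<close>

lemma Lp_norm_embed:
  fixes f :: "nat \<Rightarrow> 'k::real_normed_vector"
  assumes P: "1 \<le> P" and q: "1 \<le> q" and N: "1 \<le> N"
  shows "Lp_norm (ereal q) N f \<le> N powr (max 0 (recip P - 1 / q)) * Lp_norm P N f"
  using P
proof (cases rule: exponent_cases)
  case 1
  define M where "M = Lp_norm \<infinity> N f"
  have "\<forall>i\<in>{1..N}. norm (f i) \<le> M" using Lp_norm_infty_le_iff[OF N, of f M] by (simp add: M_def)
  then have "(\<Sum>i=1..N. norm (f i) powr q) \<le> (\<Sum>i=1..N. M powr q)"
    using q by (intro sum_mono powr_mono2) auto
  then have "Lp_norm (ereal q) N f \<le> M"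
    using q N Lp_norm_nonneg[OF N, of \<infinity> f] by (subst Lp_norm_ereal_le_iff) (auto simp: M_def)
  then show ?thesis using 1 N q by (simp add: M_def max_def)
next
  case (2 p)
  define M where "M = Lp_norm (ereal p) N f"
  have M0: "0 \<le> M" using N by (simp add: M_def Lp_norm_nonneg)
  have SM: "(\<Sum>i=1..N. norm (f i) powr p) \<le> N * M powr p"
    unfolding M_def using 2 N by (intro Lp_norm_ereal_power) auto
  have le: "norm (f i) \<le> N powr (1/p) * M" if "i \<in> {1..N}" for i
  proof -
    have "norm (f i) powr p \<le> (\<Sum>i=1..N. norm (f i) powr p)"
      using that by (intro member_le_sum) auto
    also note SM
    finally have "(norm (f i) powr p) powr (1/p) \<le> (N * M powr p) powr (1/p)"
      using 2 by (intro powr_mono2) auto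
    then show ?thesis using 2 M0 by (simp add: powr_powr powr_mult)
  qed
  show ?thesis
  proof (cases "M = 0")
    case True
    then have "Lp_norm (ereal q) N f \<le> 0"
      using le q N by (subst Lp_norm_ereal_le_iff) auto
    then show ?thesis using True 2 by (simp add: M_def)
  next
    case False
    with M0 have M: "M > 0" by simp
    show ?thesis
    proof (cases "q \<le> p")
      case True
      have "(\<Sum>i=1..N. norm (f i) powr q)
          \<le> (\<Sum>i=1..N. M powr q * ((q/p) * (norm (f i) / M) powr p + (1 - q/p)))"
      proof (rule sum_mono)
        fix i
        have "((norm (f i) / M) powr p) powr (q/p)
            \<le> (q/p) * (norm (f i) / M) powr p + (1 - q/p)"
          using True q 2 by (intro powr_le_affine) auto
        also have "((norm (f i) / M) powr p) powr (q/p) = norm (f i) powr q / M powr q"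
          using True q 2 M by (simp add: powr_powr powr_divide)
        finally show "norm (f i) powr q
            \<le> M powr q * ((q/p) * (norm (f i) / M) powr p + (1 - q/p))"
          using M by (simp add: divide_simps mult.commute)
      qed
      also have "\<dots> = M powr q * ((q/p) * ((\<Sum>i=1..N. norm (f i) powr p) / M powr p)
          + N * (1 - q/p))"
        using M by (simp add: powr_divide sum.distrib flip: sum_distrib_left sum_divide_distrib)
      also have "\<dots> \<le> M powr q * ((q/p) * N + N * (1 - q/p))"
        using SM M True q 2 by (intro mult_left_mono add_right_mono) (auto simp: divide_simps mult.commute)
      also have "\<dots> = N * M powr q" by (simp add: algebra_simps)
      finally have "Lp_norm (ereal q) N f \<le> M"
        using q N M by (subst Lp_norm_ereal_le_iff) auto
      moreover have "max 0 (recip P - 1 / q) = 0"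
        using True 2 q by (auto simp: recip_ereal divide_simps)
      ultimately show ?thesis using N by (simp add: M_def 2)
    next
      case False
      define K where "K = N powr (1/p) * M"
      have K: "K > 0" using M N by (simp add: K_def)
      have "(\<Sum>i=1..N. norm (f i) powr q) \<le> (\<Sum>i=1..N. K powr (q - p) * norm (f i) powr p)"
      proof (rule sum_mono)
        fix i assume i: "i \<in> {1..N}"
        have "norm (f i) powr q = norm (f i) powr (q - p) * norm (f i) powr p"
          by (simp flip: powr_add)
        also have "\<dots> \<le> K powr (q - p) * norm (f i) powr p"
          using le[OF i] False by (intro mult_right_mono powr_mono2) (auto simp: K_def)
        finally show "norm (f i) powr q \<le> K powr (q - p) * norm (f i) powr p" .
      qed
      also have "\<dots> \<le> K powr (q - p) * (N * M powr p)"
        using SM by (simp flip: sum_distrib_left add: mult_left_mono)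
      also have "N * M powr p = K powr p"
        using 2 M N by (simp add: K_def powr_mult powr_powr)
      also have "K powr (q - p) * K powr p = K powr q" by (simp flip: powr_add)
      also have "K powr q = N * (N powr (1/p - 1/q) * M) powr q"
        using q M N 2 by (simp add: K_def powr_mult powr_powr powr_add [symmetric] algebra_simps
            flip: powr_one_gt_zero_iff) (simp add: powr_diff)
      finally have "Lp_norm (ereal q) N f \<le> N powr (1/p - 1/q) * M"
        using q N M by (subst Lp_norm_ereal_le_iff) auto
      moreover have "max 0 (recip P - 1 / q) = 1/p - 1/q"
        using False 2 q by (auto simp: recip_ereal divide_simps)
      ultimately show ?thesis by (simp add: M_def 2)
    qed
  qed
qed

section \<open>Averages over finite sets and independent samples\<close>

definition avg :: "'a set \<Rightarrow> ('a \<Rightarrow> real) \<Rightarrow> real" where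
  "avg A f = (\<Sum>x\<in>A. f x) / card A"

lemma avg_mono: "(\<And>x. x \<in> A \<Longrightarrow> f x \<le> g x) \<Longrightarrow> avg A f \<le> avg A g"
  by (auto simp: avg_def intro!: divide_right_mono sum_mono)

lemma avg_cong: "(\<And>x. x \<in> A \<Longrightarrow> f x = g x) \<Longrightarrow> avg A f = avg A g"
  by (simp add: avg_def)

lemma avg_nonneg: "(\<And>x. x \<in> A \<Longrightarrow> 0 \<le> f x) \<Longrightarrow> 0 \<le> avg A f"
  by (auto simp: avg_def intro!: divide_nonneg_nonneg sum_nonneg)

lemma avg_const: "finite A \<Longrightarrow> A \<noteq> {} \<Longrightarrow> avg A (\<lambda>_. c) = c"
  by (simp add: avg_def)

lemma avg_add: "avg A (\<lambda>x. f x + g x) = avg A f + avg A g"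
  by (simp add: avg_def sum.distrib add_divide_distrib)

lemma avg_cmult: "avg A (\<lambda>x. c * f x) = c * avg A f"
  by (simp add: avg_def sum_distrib_left)

lemma avg_sum: "avg A (\<lambda>x. \<Sum>i\<in>I. f i x) = (\<Sum>i\<in>I. avg A (f i))"
  unfolding avg_def sum_divide_distrib [symmetric] by (subst sum.swap) simp

lemma avg_swap: "avg A (\<lambda>x. avg B (f x)) = avg B (\<lambda>y. avg A (\<lambda>x. f x y))"
  unfolding avg_def sum_divide_distrib [symmetric] by (subst sum.swap) simp

lemma avg_le_sqrt: "avg A f \<le> sqrt (avg A (\<lambda>x. (f x)\<^sup>2))"
proof (cases "card A = 0")
  case False
  have "(avg A f)\<^sup>2 = (\<Sum>x\<in>A. f x)\<^sup>2 / (card A)\<^sup>2" by (simp add: avg_def power_divide)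
  also have "\<dots> \<le> ((\<Sum>x\<in>A. (f x)\<^sup>2) * card A) / (card A)\<^sup>2"
    by (intro divide_right_mono sum_squared_le_sum_of_squares) auto
  also have "\<dots> = avg A (\<lambda>x. (f x)\<^sup>2)" using False by (simp add: avg_def power2_eq_square)
  finally show ?thesis by (rule real_le_rsqrt)
qed (simp add: avg_def)

text \<open>
  Fubini for one coordinate: a uniform tuple is a uniform shorter tuple together with an
  independent uniform entry.
\<close>

lemma avg_PiE_insert:
  assumes "finite T" "t \<notin> T" "finite E"
  shows "avg (PiE (insert t T) (\<lambda>_. E)) F = avg (PiE T (\<lambda>_. E)) (\<lambda>\<xi>. avg E (\<lambda>y. F (\<xi>(t := y))))"
proof -
  have "(\<Sum>\<xi>\<in>PiE (insert t T) (\<lambda>_. E). F \<xi>) = (\<Sum>(y, \<xi>)\<in>E \<times> PiE T (\<lambda>_. E). F (\<xi>(t := y)))"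
    unfolding PiE_insert_eq
    by (subst sum.reindex[OF inj_combinator[OF assms(2)]]) (auto simp: case_prod_unfold)
  also have "\<dots> = (\<Sum>\<xi>\<in>PiE T (\<lambda>_. E). \<Sum>y\<in>E. F (\<xi>(t := y)))"
    by (subst sum.swap) (simp add: sum.cartesian_product)
  finally show ?thesis
    using assms by (simp add: avg_def card_PiE flip: sum_divide_distrib)
qed

lemma avg_PiE_marginal:
  assumes "finite T" "t \<in> T" "finite E" "E \<noteq> {}"
  shows "avg (PiE T (\<lambda>_. E)) (\<lambda>\<xi>. h (\<xi> t)) = avg E h"
proof -
  have "T = insert t (T - {t})" using assms by auto
  moreover have "avg (PiE (insert t (T - {t})) (\<lambda>_. E)) (\<lambda>\<xi>. h (\<xi> t)) = avg E h"
    using assms by (subst avg_PiE_insert) (auto simp: avg_const finite_PiE PiE_eq_empty_iff)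
  ultimately show ?thesis by simp
qed

text \<open>
  The mixed terms vanish because the newly added coordinate is independent of the others and
  its summand is centred.
\<close>

lemma avg_norm_sum_squared:
  fixes g :: "'t \<Rightarrow> 'e \<Rightarrow> 'a::real_inner"
  assumes "finite T" "finite E" "E \<noteq> {}" and cen: "\<And>t. t \<in> T \<Longrightarrow> (\<Sum>y\<in>E. g t y) = 0"
  shows "avg (PiE T (\<lambda>_. E)) (\<lambda>\<xi>. (norm (\<Sum>t\<in>T. g t (\<xi> t)))\<^sup>2)
    = (\<Sum>t\<in>T. avg E (\<lambda>y. (norm (g t y))\<^sup>2))"
  using assms(1) cen
proof (induction T rule: finite_induct)
  case empty
  then show ?case by (simp add: avg_def)
next
  case (insert t T)
  have "avg (PiE (insert t T) (\<lambda>_. E)) (\<lambda>\<xi>. (norm (\<Sum>t\<in>insert t T. g t (\<xi> t)))\<^sup>2)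
    = avg (PiE T (\<lambda>_. E)) (\<lambda>\<xi>. avg E (\<lambda>y. (norm (g t y + (\<Sum>t\<in>T. g t (\<xi> t))))\<^sup>2))"
    using insert.hyps assms(2)
    by (auto simp: avg_PiE_insert intro!: avg_cong arg_cong[where f = "\<lambda>x. (norm x)\<^sup>2"] sum.cong)
  also have "\<dots> = avg (PiE T (\<lambda>_. E)) (\<lambda>\<xi>. avg E (\<lambda>y. (norm (g t y))\<^sup>2)
      + (norm (\<Sum>t\<in>T. g t (\<xi> t)))\<^sup>2)"
  proof (rule avg_cong)
    fix \<xi>
    define s where "s = (\<Sum>t\<in>T. g t (\<xi> t))"
    have "(\<Sum>y\<in>E. 2 * inner (g t y) s) = 2 * inner (\<Sum>y\<in>E. g t y) s"
      by (simp add: inner_sum_left sum_distrib_left)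
    also have "\<dots> = 0" using insert.prems by simp
    finally have "avg E (\<lambda>y. 2 * inner (g t y) s) = 0" by (simp add: avg_def)
    moreover have "avg E (\<lambda>y. (norm (g t y + s))\<^sup>2)
      = avg E (\<lambda>y. (norm (g t y))\<^sup>2 + 2 * inner (g t y) s + (norm s)\<^sup>2)"
      by (intro avg_cong) (simp add: power2_norm_eq_inner inner_add inner_commute)
    ultimately show "avg E (\<lambda>y. (norm (g t y + s))\<^sup>2) = avg E (\<lambda>y. (norm (g t y))\<^sup>2) + (norm s)\<^sup>2"
      using assms by (simp add: avg_add avg_const)
  qed
  also have "\<dots> = (\<Sum>t\<in>insert t T. avg E (\<lambda>y. (norm (g t y))\<^sup>2))"
    using insert assms by (simp add: avg_add avg_const finite_PiE PiE_eq_empty_iff)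
  finally show ?case .
qed

definition mean :: "'e set \<Rightarrow> ('e \<Rightarrow> 'a::real_vector) \<Rightarrow> 'a" where
  "mean E g = (\<Sum>y\<in>E. g y) /\<^sub>R card E"

lemma avg_eq_mean: "avg A f = mean A f"
  by (simp add: avg_def mean_def divide_inverse mult.commute)

lemma norm_mean_le: "norm (mean E g) \<le> avg E (\<lambda>y. norm (g y))"
  by (simp add: mean_def avg_def divide_inverse mult.commute mult_left_mono norm_sum)

lemma avg_deviation_le:
  fixes g :: "'e \<Rightarrow> 'a::real_inner"
  assumes "finite E" "E \<noteq> {}"
  shows "avg E (\<lambda>y. (norm (g y - mean E g))\<^sup>2) \<le> avg E (\<lambda>y. (norm (g y))\<^sup>2)"
proof -
  have "avg E (\<lambda>y. 2 * inner (g y) (mean E g)) = 2 * inner (mean E g) (mean E g)"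
    by (simp add: avg_def mean_def inner_sum_left sum_distrib_left divide_inverse mult_ac)
  moreover have "avg E (\<lambda>y. (norm (g y - mean E g))\<^sup>2)
    = avg E (\<lambda>y. (norm (g y))\<^sup>2 + (-1) * (2 * inner (g y) (mean E g)) + (norm (mean E g))\<^sup>2)"
    by (intro avg_cong) (simp add: power2_norm_eq_inner inner_diff inner_commute)
  ultimately show ?thesis
    unfolding avg_add avg_const[OF assms] avg_cmult by (simp add: power2_norm_eq_inner)
qed

text \<open>
  The variance bound in the form in which it is used: for plain Monte Carlo all weights are
  equal, for the pilot stage they select one row, for stratified sampling they are inverse to
  the row counts.
\<close>

lemma avg_weighted_deviation_le:
  fixes g :: "'t \<Rightarrow> 'e \<Rightarrow> 'a::real_inner"
  assumes "finite T" "finite E" "E \<noteq> {}"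
  shows "avg (PiE T (\<lambda>_. E)) (\<lambda>\<xi>. (norm (\<Sum>t\<in>T. w t *\<^sub>R (g t (\<xi> t) - mean E (g t))))\<^sup>2)
    \<le> (\<Sum>t\<in>T. (w t)\<^sup>2 * avg E (\<lambda>y. (norm (g t y))\<^sup>2))"
proof -
  have "(\<Sum>y\<in>E. w t *\<^sub>R (g t y - mean E (g t))) = w t *\<^sub>R (\<Sum>y\<in>E. g t y - mean E (g t))" for t
    by (rule scaleR_sum_right [symmetric])
  moreover have "(\<Sum>y\<in>E. g t y - mean E (g t)) = 0" for t
    using assms by (simp add: sum_subtractf mean_def sum_constant_scaleR del: sum_constant)
  ultimately have "(\<Sum>y\<in>E. w t *\<^sub>R (g t y - mean E (g t))) = 0" for t by simp
  then have "avg (PiE T (\<lambda>_. E)) (\<lambda>\<xi>. (norm (\<Sum>t\<in>T. w t *\<^sub>R (g t (\<xi> t) - mean E (g t))))\<^sup>2)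
    = (\<Sum>t\<in>T. avg E (\<lambda>y. (norm (w t *\<^sub>R (g t y - mean E (g t))))\<^sup>2))"
    using assms by (intro avg_norm_sum_squared) auto
  also have "\<dots> = (\<Sum>t\<in>T. (w t)\<^sup>2 * avg E (\<lambda>y. (norm (g t y - mean E (g t)))\<^sup>2))"
    by (simp add: power_mult_distrib avg_cmult)
  also have "\<dots> \<le> (\<Sum>t\<in>T. (w t)\<^sup>2 * avg E (\<lambda>y. (norm (g t y))\<^sup>2))"
    using assms by (intro sum_mono mult_left_mono avg_deviation_le) auto
  finally show ?thesis .
qed

text \<open>
  For \<open>q < 2\<close> the variance may be too large, so \<open>f\<close> is cut at the height \<open>h = c * n powr (1/q)\<close>.
  This height balances the two errors: the part below \<open>h\<close> has second moment at most
  \<open>h powr (2 - q) * c powr q\<close>, the part above has mean at most \<open>h powr (1 - q) * c powr q\<close>.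
\<close>

lemma monte_carlo_error:
  fixes f :: "'e \<Rightarrow> 'a::real_inner"
  assumes G: "finite G" "G \<noteq> {}" and q: "1 \<le> q" "q \<le> 2" and n: "1 \<le> n" and c: "0 \<le> c"
    and mom: "avg G (\<lambda>x. norm (f x) powr q) \<le> c powr q"
  shows "avg (PiE {..<n} (\<lambda>_. G)) (\<lambda>\<xi>. norm (mean G f - mean {..<n} (\<lambda>t. f (\<xi> t))))
    \<le> 3 * c * real n powr (-1 + 1 / q)"
proof (cases "c = 0")
  case True
  have "avg G (\<lambda>x. norm (f x) powr q) = 0"
    using mom True q by (intro antisym avg_nonneg) auto
  then have "f x = 0" if "x \<in> G" for x
    using that G by (auto simp: avg_def sum_nonneg_eq_0_iff)
  then have "mean G f = 0" "\<And>\<xi>. \<xi> \<in> PiE {..<n} (\<lambda>_. G) \<Longrightarrow> mean {..<n} (\<lambda>t. f (\<xi> t)) = 0"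
    by (auto simp: mean_def PiE_iff)
  then show ?thesis using True by (simp add: avg_def)
next
  case False
  let ?\<Omega> = "PiE {..<n} (\<lambda>_. G)"
  have fin: "finite ?\<Omega>" "?\<Omega> \<noteq> {}" using G by (auto simp: finite_PiE PiE_eq_empty_iff)
  have c: "c > 0" using False c by simp
  define h where "h = c * real n powr (1 / q)"
  have h: "h > 0" using c n by (simp add: h_def)
  define r where "r = c * real n powr (-1 + 1 / q)"
  define a where "a x = (if norm (f x) \<le> h then f x else 0)" for x
  define b where "b x = (if norm (f x) \<le> h then 0 else f x)" for x
  have ab: "f x = a x + b x" for x by (simp add: a_def b_def)
  \<comment> \<open>the large values are so few that their mean is negligible\<close>
  have "avg G (\<lambda>x. norm (b x)) \<le> avg G (\<lambda>x. h powr (1 - q) * norm (f x) powr q)"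
  proof (rule avg_mono)
    fix x
    show "norm (b x) \<le> h powr (1 - q) * norm (f x) powr q"
    proof (cases "norm (f x) \<le> h")
      case False
      then have "norm (f x) powr (1 - q) \<le> h powr (1 - q)"
        using h q by (intro powr_mono2') auto
      then have "norm (f x) powr (1 - q) * norm (f x) powr q \<le> h powr (1 - q) * norm (f x) powr q"
        by (rule mult_right_mono) auto
      then show ?thesis using False h by (simp add: b_def flip: powr_add)
    qed (simp add: b_def)
  qed
  also have "\<dots> \<le> h powr (1 - q) * c powr q"
    using mom by (simp add: avg_cmult mult_left_mono)
  also have "\<dots> = r"
  proof -
    have "h powr (1 - q) * c powr q = (c powr (1-q) * c powr q) * real n powr ((1 / q) * (1 - q))"
      using c by (simp add: h_def powr_mult powr_powr)
    also have "c powr (1-q) * c powr q = c" using c by (simp flip: powr_add)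
    also have "(1 / q) * (1 - q) = -1 + 1 / q" using q by (simp add: field_simps)
    finally show ?thesis by (simp add: r_def)
  qed
  finally have b: "avg G (\<lambda>x. norm (b x)) \<le> r" .
  \<comment> \<open>below the height the second moment is controlled by the moment of order \<open>q\<close>\<close>
  have "avg G (\<lambda>x. (norm (a x))\<^sup>2) \<le> avg G (\<lambda>x. h powr (2 - q) * norm (f x) powr q)"
  proof (rule avg_mono)
    fix x
    show "(norm (a x))\<^sup>2 \<le> h powr (2 - q) * norm (f x) powr q"
    proof (cases "norm (f x) \<le> h \<and> f x \<noteq> 0")
      case True
      then have "norm (f x) powr (2 - q) \<le> h powr (2 - q)"
        using h q by (intro powr_mono2) auto
      then have "norm (f x) powr (2 - q) * norm (f x) powr q \<le> h powr (2 - q) * norm (f x) powr q"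
        by (rule mult_right_mono) auto
      then show ?thesis using True h by (simp add: a_def flip: powr_add)
    qed (auto simp: a_def)
  qed
  also have "\<dots> \<le> h powr (2 - q) * c powr q"
    using mom by (simp add: avg_cmult mult_left_mono)
  also have "\<dots> = real n * r\<^sup>2"
  proof -
    have "h powr (2 - q) * c powr q = (c powr (2-q) * c powr q) * real n powr ((1 / q) * (2 - q))"
      using c by (simp add: h_def powr_mult powr_powr)
    also have "c powr (2-q) * c powr q = c\<^sup>2" using c by (simp flip: powr_add)
    also have "(1 / q) * (2 - q) = 1 + ((-1 + 1 / q) + (-1 + 1 / q))" using q by (simp add: field_simps)
    also have "real n powr (1 + (z + z)) = real n * (real n powr z)\<^sup>2" for z
      by (simp only: powr_add power2_eq_square powr_one of_nat_0_le_iff)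
    finally show ?thesis by (simp add: r_def power_mult_distrib)
  qed
  finally have a: "avg G (\<lambda>x. (norm (a x))\<^sup>2) \<le> real n * r\<^sup>2" .
  let ?dev = "\<lambda>\<xi>. \<Sum>t<n. (1 / real n) *\<^sub>R (a (\<xi> t) - mean G a)"
  have "avg ?\<Omega> (\<lambda>\<xi>. (norm (?dev \<xi>))\<^sup>2) \<le> (\<Sum>t<n. (1 / real n)\<^sup>2 * avg G (\<lambda>x. (norm (a x))\<^sup>2))"
    using G by (intro avg_weighted_deviation_le[where g = "\<lambda>_. a"]) auto
  also have "\<dots> \<le> (\<Sum>t<n. (1 / real n)\<^sup>2 * (real n * r\<^sup>2))"
    by (intro sum_mono mult_left_mono a) auto
  also have "\<dots> = r\<^sup>2" using n by (simp add: power2_eq_square)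
  finally have "sqrt (avg ?\<Omega> (\<lambda>\<xi>. (norm (?dev \<xi>))\<^sup>2)) \<le> r"
    using c by (simp add: r_def real_le_lsqrt)
  then have dev: "avg ?\<Omega> (\<lambda>\<xi>. norm (?dev \<xi>)) \<le> r" by (rule order_trans[OF avg_le_sqrt])
  have "avg ?\<Omega> (\<lambda>\<xi>. norm (mean G f - mean {..<n} (\<lambda>t. f (\<xi> t))))
    \<le> avg ?\<Omega> (\<lambda>\<xi>. norm (?dev \<xi>) + norm (mean G b) + (1 / n) * (\<Sum>t<n. norm (b (\<xi> t))))"
  proof (rule avg_mono)
    fix \<xi>
    have "mean {..<n} (\<lambda>t. f (\<xi> t)) - mean G f
        = ?dev \<xi> - mean G b + (1 / n) *\<^sub>R (\<Sum>t<n. b (\<xi> t))"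
    proof -
      have "mean G f = mean G a + mean G b" by (simp add: mean_def ab sum.distrib scaleR_add_right)
      moreover have "?dev \<xi> = (1 / n) *\<^sub>R (\<Sum>t<n. a (\<xi> t) - mean G a)"
        by (rule scaleR_sum_right [symmetric])
      moreover have "\<dots> = (1 / n) *\<^sub>R (\<Sum>t<n. a (\<xi> t)) - mean G a"
        using n by (simp add: scaleR_diff_right sum_subtractf sum_constant_scaleR del: sum_constant)
      ultimately show ?thesis
        by (simp add: mean_def ab sum.distrib scaleR_add_right divide_inverse)
    qed
    then have "norm (mean G f - mean {..<n} (\<lambda>t. f (\<xi> t)))
        = norm (?dev \<xi> - mean G b + (1 / n) *\<^sub>R (\<Sum>t<n. b (\<xi> t)))"
      by (metis norm_minus_commute)
    also have "\<dots> \<le> norm (?dev \<xi>) + norm (mean G b) + norm ((1 / n) *\<^sub>R (\<Sum>t<n. b (\<xi> t)))"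
      by (meson add_mono norm_triangle_ineq norm_triangle_ineq4 order_refl order_trans)
    also have "norm ((1 / n) *\<^sub>R (\<Sum>t<n. b (\<xi> t))) \<le> (1 / n) * (\<Sum>t<n. norm (b (\<xi> t)))"
      by (simp add: divide_right_mono norm_sum)
    finally show "norm (mean G f - mean {..<n} (\<lambda>t. f (\<xi> t)))
        \<le> norm (?dev \<xi>) + norm (mean G b) + (1 / n) * (\<Sum>t<n. norm (b (\<xi> t)))" by simp
  qed
  also have "\<dots> = avg ?\<Omega> (\<lambda>\<xi>. norm (?dev \<xi>)) + norm (mean G b)
      + (1 / n) * (\<Sum>t<n. avg ?\<Omega> (\<lambda>\<xi>. norm (b (\<xi> t))))"
    by (simp only: avg_add avg_cmult avg_sum avg_const[OF fin])
  also have "(\<Sum>t<n. avg ?\<Omega> (\<lambda>\<xi>. norm (b (\<xi> t)))) = (\<Sum>t<n. avg G (\<lambda>x. norm (b x)))"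
    using G by (intro sum.cong avg_PiE_marginal[where h = "\<lambda>x. norm (b x)"]) auto
  also have "(1 / n) * \<dots> = avg G (\<lambda>x. norm (b x))" using n by simp
  also have "avg ?\<Omega> (\<lambda>\<xi>. norm (?dev \<xi>)) + norm (mean G b) + \<dots> \<le> r + r + r"
    using dev b norm_mean_le[of G b] by linarith
  finally show ?thesis by (simp add: r_def)
qed

section \<open>Sampling algorithms and plain Monte Carlo\<close>

definition sampling_alg ::
  "nat \<Rightarrow> ('k list \<Rightarrow> nat \<times> nat) \<Rightarrow> ('k list \<Rightarrow> 'k) \<Rightarrow> (nat \<times> nat \<Rightarrow> 'k, 'k, 'k) det_alg" where
  "sampling_alg n x out = \<lparr>query = \<lambda>ys f. f (x ys), stop = \<lambda>ys. n \<le> length ys, result = out\<rparr>"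

lemma length_info [simp]: "length (info A f n) = n"
  by (induction n) auto

lemma alg_card_sampling_alg [simp]: "alg_card (sampling_alg n x out) f = enat n"
proof -
  have "(LEAST m. n \<le> m) = n" by (rule Least_equality) auto
  then show ?thesis by (auto simp: alg_card_def sampling_alg_def)
qed

lemma alg_out_sampling_alg:
  "alg_out (sampling_alg n x out) f = out (info (sampling_alg n x out) f n)"
  by (simp add: alg_out_def) (simp add: sampling_alg_def)

lemma info_sampling_alg_Suc:
  "info (sampling_alg n x out) f (Suc m)
    = info (sampling_alg n x out) f m @ [f (x (info (sampling_alg n x out) f m))]"
  by (simp add: sampling_alg_def)

lemma info_sampling_alg_fixed:
  "info (sampling_alg n (\<lambda>ys. x (length ys)) out) f m = map (\<lambda>t. f (x t)) [0..<m]"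
  by (induction m) (simp_all add: info_sampling_alg_Suc del: info.simps(2))

lemma sampling_alg_in_det_algs:
  assumes "\<And>ys. x ys \<in> {1..N1} \<times> {1..N2}"
  shows "sampling_alg n x out \<in> det_algs (std_info N1 N2)"
proof -
  have "\<exists>i j. (\<lambda>f. f (x ys)) = (\<lambda>f :: nat \<times> nat \<Rightarrow> 'a. f (i, j)) \<and> i \<in> {1..N1} \<and> j \<in> {1..N2}" for ys
    using assms[of ys] by (intro exI[of _ "fst (x ys)"] exI[of _ "snd (x ys)"]) auto
  then show ?thesis by (simp add: det_algs_def std_info_def sampling_alg_def)
qed

lemma nonadaptive_sampling_alg: "nonadaptive (sampling_alg n (\<lambda>ys. x (length ys)) out)"
  by (auto simp: nonadaptive_def sampling_alg_def)

lemma sum_prod_grid: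
  "(\<Sum>z\<in>{1..N1::nat} \<times> {1..N2::nat}. F z) = (\<Sum>i=1..N1. \<Sum>j=1..N2. F (i, j))"
  by (simp add: sum.cartesian_product)

lemma mean_op_eq_mean: "mean_op N1 N2 f = mean ({1..N1} \<times> {1..N2}) f"
  by (simp add: mean_op_def mean_def sum.cartesian_product scaleR_conv_of_real
      divide_inverse)

text \<open>
  On a finite uniform probability space every map is measurable and every integral is an
  average, so that only the worst-case cost and the average error have to be checked.
\<close>

lemma uniform_ran_alg:
  fixes A :: "'w \<Rightarrow> ('f, 'k, 'g::banach) det_alg"
  assumes \<Omega>: "finite \<Omega>" "\<Omega> \<noteq> {}" and A: "\<And>w. w \<in> \<Omega> \<Longrightarrow> A w \<in> det_algs \<Lambda>"
    and card: "\<And>w f. w \<in> \<Omega> \<Longrightarrow> f \<in> F \<Longrightarrow> alg_card (A w) f \<le> enat n"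
    and err: "\<And>f. f \<in> F \<Longrightarrow> avg \<Omega> (\<lambda>w. norm (S f - alg_out (A w) f)) \<le> C"
  defines "M \<equiv> uniform_count_measure \<Omega>"
  shows "ran_alg F \<Lambda> M A" "ran_card F M A \<le> of_nat n" "ran_error S F M A \<le> ennreal C"
proof -
  interpret prob_space M unfolding M_def using \<Omega> by (rule prob_space_uniform_count_measure)
  have sp: "space M = \<Omega>" "sets M = Pow \<Omega>"
    by (simp_all add: M_def space_uniform_count_measure sets_uniform_count_measure)
  show "ran_alg F \<Lambda> M A"
    unfolding ran_alg_def
  proof (intro conjI ballI)
    show "prob_space M" by (rule prob_space_axioms)
    show "A w \<in> det_algs \<Lambda>" if "w \<in> space M" for w using that A sp by simp
    show "(\<lambda>w. alg_card (A w) f) \<in> M \<rightarrow>\<^sub>M count_space UNIV" for f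
      by (auto simp: measurable_def sp)
    show "(\<lambda>w. alg_out (A w) f) \<in> borel_measurable M" for f
      by (auto simp: measurable_def sp)
    show "\<exists>D. countable D \<and> (AE w in M. alg_out (A w) f \<in> closure D)" for f
      using \<Omega> by (intro exI[of _ "(\<lambda>w. alg_out (A w) f) ` \<Omega>"])
        (auto intro!: AE_I2 countable_finite closure_subset[THEN subsetD] simp: sp)
  qed
  show "ran_card F M A \<le> of_nat n"
    unfolding ran_card_def
  proof (rule SUP_least)
    fix f assume f: "f \<in> F"
    have "(\<integral>\<^sup>+w. ennreal_of_enat (alg_card (A w) f) \<partial>M) \<le> (\<integral>\<^sup>+w. of_nat n \<partial>M)"
      using card f by (intro nn_integral_mono) (auto simp: sp simp flip: ennreal_of_enat_enat)
    then show "(\<integral>\<^sup>+w. ennreal_of_enat (alg_card (A w) f) \<partial>M) \<le> of_nat n"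
      by (simp add: emeasure_space_1)
  qed
  show "ran_error S F M A \<le> ennreal C"
    unfolding ran_error_def
  proof (rule SUP_least)
    fix f assume f: "f \<in> F"
    have "(\<integral>\<^sup>+w. ennreal (norm (S f - alg_out (A w) f)) \<partial>M)
      = ennreal (avg \<Omega> (\<lambda>w. norm (S f - alg_out (A w) f)))"
      unfolding M_def uniform_count_measure_def using \<Omega>
      by (simp add: nn_integral_point_measure_finite avg_def sum_divide_distrib sum_ennreal
          flip: ennreal_mult)
    then show "(\<integral>\<^sup>+w. ennreal (norm (S f - alg_out (A w) f)) \<partial>M) \<le> ennreal C"
      using err[OF f] by (simp add: ennreal_leI)
  qed
qed

text \<open>
  The comparison of norms, once along the rows and once across them.
\<close>

lemma mixed_ball_moment:
  fixes f :: "nat \<times> nat \<Rightarrow> 'k::real_normed_vector"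
  assumes "f \<in> mixed_ball p N1 u N2" and p: "1 \<le> p" "1 \<le> u" and q: "1 \<le> q" and N: "1 \<le> N1" "1 \<le> N2"
  shows "avg ({1..N1} \<times> {1..N2}) (\<lambda>z. norm (f z) powr q)
    \<le> (N1 powr max 0 (recip p - 1 / q) * N2 powr max 0 (recip u - 1 / q)) powr q"
proof -
  define a where "a i = Lp_norm u N2 (\<lambda>j. f (i, j))" for i
  have a0: "0 \<le> a i" for i using N by (simp add: a_def Lp_norm_nonneg)
  have a1: "Lp_norm p N1 a \<le> 1"
    using assms by (simp add: mixed_ball_def mixed_norm_def a_def[abs_def])
  let ?K1 = "N1 powr max 0 (recip p - 1 / q)" and ?K2 = "N2 powr max 0 (recip u - 1 / q)"
  have row: "(\<Sum>j=1..N2. norm (f (i, j)) powr q) \<le> N2 * (?K2 * a i) powr q" for i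
    using Lp_norm_embed[OF p(2) q N(2), of "\<lambda>j. f (i, j)"] q N a0
    by (subst Lp_norm_ereal_le_iff [symmetric]) (auto simp: a_def)
  have "Lp_norm (ereal q) N1 a \<le> ?K1 * Lp_norm p N1 a" by (rule Lp_norm_embed[OF p(1) q N(1)])
  also have "\<dots> \<le> ?K1 * 1" using a1 by (intro mult_left_mono) auto
  finally have col: "(\<Sum>i=1..N1. a i powr q) \<le> N1 * ?K1 powr q"
    using q N a0 by (subst (asm) Lp_norm_ereal_le_iff) auto
  have "(\<Sum>i=1..N1. \<Sum>j=1..N2. norm (f (i, j)) powr q) \<le> (\<Sum>i=1..N1. N2 * (?K2 * a i) powr q)"
    by (intro sum_mono row)
  also have "\<dots> = N2 * ?K2 powr q * (\<Sum>i=1..N1. a i powr q)"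
    using a0 by (simp add: powr_mult mult_ac sum_distrib_left sum_distrib_right)
  also have "\<dots> \<le> N2 * ?K2 powr q * (N1 * ?K1 powr q)"
    by (intro mult_left_mono col) auto
  also have "\<dots> = (N1 * N2) * (?K1 * ?K2) powr q" by (simp add: powr_mult)
  finally show ?thesis
    using N by (simp add: avg_def sum_prod_grid divide_simps mult.commute del: One_nat_def)
qed

lemma e_ran_non_monte_carlo:
  fixes p u :: ereal
  assumes p: "1 \<le> p" "1 \<le> u" and q: "1 \<le> q" "q \<le> 2" and N: "1 \<le> N1" "1 \<le> N2" and n: "1 \<le> n"
  shows "e_ran_non n (mean_op N1 N2 :: (nat \<times> nat \<Rightarrow> 'k::{real_normed_field, euclidean_space}) \<Rightarrow> 'k)
      (mixed_ball p N1 u N2) (std_info N1 N2)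
    \<le> ennreal (3 * (N1 powr max 0 (recip p - 1 / q) * N2 powr max 0 (recip u - 1 / q))
        * real n powr (-1 + 1 / q))"
proof -
  let ?G = "{1..N1} \<times> {1..N2}"
  let ?\<Omega> = "PiE {..<n} (\<lambda>_. ?G)"
  let ?C = "3 * (N1 powr max 0 (recip p - 1 / q) * N2 powr max 0 (recip u - 1 / q))
        * real n powr (-1 + 1 / q)"
  let ?S = "mean_op N1 N2 :: (nat \<times> nat \<Rightarrow> 'k) \<Rightarrow> 'k"
  let ?F = "mixed_ball p N1 u N2 :: (nat \<times> nat \<Rightarrow> 'k) set"
  have G: "finite ?G" "?G \<noteq> {}" using N by auto
  define pt :: "(nat \<Rightarrow> nat \<times> nat) \<Rightarrow> nat \<Rightarrow> nat \<times> nat"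
    where "pt \<xi> t = (if t < n then \<xi> t else (1, 1))" for \<xi> t
  define out :: "'k list \<Rightarrow> 'k" where "out ys = mean {..<n} (\<lambda>t. ys ! t)" for ys
  define A where "A \<xi> = sampling_alg n (\<lambda>ys. pt \<xi> (length ys)) out" for \<xi>
  have *: "finite ?\<Omega>" "?\<Omega> \<noteq> {}" using G by (auto simp: finite_PiE PiE_eq_empty_iff)
  have det: "A \<xi> \<in> det_algs (std_info N1 N2)" if "\<xi> \<in> ?\<Omega>" for \<xi>
    unfolding A_def
  proof (rule sampling_alg_in_det_algs)
    show "pt \<xi> (length ys) \<in> ?G" for ys :: "'k list"
      using that N by (auto simp: pt_def PiE_iff)
  qed
  have card: "alg_card (A \<xi>) f \<le> enat n" if "\<xi> \<in> ?\<Omega>" "f \<in> ?F" for \<xi> f by (simp add: A_def)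
  have "alg_out (A \<xi>) f = mean {..<n} (\<lambda>t. f (\<xi> t))" for \<xi> f
    by (simp add: A_def alg_out_sampling_alg info_sampling_alg_fixed[of n "pt \<xi>"] out_def mean_def)
      (simp add: pt_def)
  then have err: "avg ?\<Omega> (\<lambda>\<xi>. norm (?S f - alg_out (A \<xi>) f)) \<le> ?C" if "f \<in> ?F" for f
    using monte_carlo_error[OF G q n _ mixed_ball_moment[OF that p q(1) N]]
    by (simp add: mean_op_eq_mean)
  note U = uniform_ran_alg[where A = A and F = ?F and S = ?S and n = n and C = ?C, OF * det card err]
  have "ran_nonadaptive (uniform_count_measure ?\<Omega>) A"
    by (simp add: ran_nonadaptive_def A_def nonadaptive_sampling_alg)
  then have "e_ran_non n ?S ?F (std_info N1 N2) \<le> ran_error ?S ?F (uniform_count_measure ?\<Omega>) A"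
    using U by (intro e_ran_non_le)
  also have "\<dots> \<le> ennreal ?C" by (rule U)
  finally show ?thesis .
qed

lemma e_ran_le_e_ran_non: "e_ran n S F \<Lambda> \<le> e_ran_non n S F \<Lambda>"
  unfolding e_ran_def e_ran_non_def by (rule INF_superset_mono) auto

lemma e_det_le_e_det_non: "e_det n S F \<Lambda> \<le> e_det_non n S F \<Lambda>"
  unfolding e_det_def e_det_non_def by (rule INF_superset_mono) auto

text \<open>
  Without any sample, the output zero has this error, because the ball lies in the unit ball
  for exponent \<open>1\<close>.
\<close>

lemma e_det_non_le_one:
  assumes p: "1 \<le> p" "1 \<le> u" and N: "1 \<le> N1" "1 \<le> N2"
  shows "e_det_non n (mean_op N1 N2 :: (nat \<times> nat \<Rightarrow> 'k::{real_normed_field, euclidean_space}) \<Rightarrow> 'k)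
      (mixed_ball p N1 u N2) (std_info N1 N2) \<le> 1"
proof -
  let ?A = "sampling_alg 0 (\<lambda>ys. (1, 1)) (\<lambda>_. 0) :: (nat \<times> nat \<Rightarrow> 'k, 'k, 'k) det_alg"
  have "norm (mean_op N1 N2 f) \<le> 1" if f: "f \<in> mixed_ball p N1 u N2" for f :: "nat \<times> nat \<Rightarrow> 'k"
  proof -
    have "max 0 (recip p - 1) = 0" "max 0 (recip u - 1) = 0"
      using recip_bounds p by auto
    then have "avg ({1..N1} \<times> {1..N2}) (\<lambda>z. norm (f z)) \<le> 1"
      using mixed_ball_moment[OF f p order_refl N] N by simp
    then show ?thesis using norm_mean_le order_trans unfolding mean_op_eq_mean by blast
  qed
  then have "det_error (mean_op N1 N2) (mixed_ball p N1 u N2) ?A \<le> 1"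
    by (auto simp: det_error_def alg_out_sampling_alg intro!: SUP_least)
  moreover have "?A \<in> {A \<in> det_algs (std_info N1 N2).
      nonadaptive A \<and> (SUP f\<in>mixed_ball p N1 u N2. alg_card A f) \<le> enat n}"
    using N nonadaptive_sampling_alg[of 0 "\<lambda>_. (1, 1)"]
    by (auto intro!: sampling_alg_in_det_algs SUP_least)
  ultimately show ?thesis unfolding e_det_non_def by (rule INF_lower2[rotated])
qed

section \<open>Adaptive two-stage sampling\<close>

lemma avg_Times: "avg (A \<times> B) F = avg A (\<lambda>x. avg B (\<lambda>y. F (x, y)))"
proof -
  have "avg A (\<lambda>x. avg B (\<lambda>y. F (x, y))) = (\<Sum>x\<in>A. \<Sum>y\<in>B. F (x, y)) / (card A * card B)"
    unfolding avg_def sum_divide_distrib [symmetric] by simp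
  also have "(\<Sum>x\<in>A. \<Sum>y\<in>B. F (x, y)) = (\<Sum>z\<in>A \<times> B. F z)"
    by (simp add: sum.cartesian_product)
  finally show ?thesis by (simp add: avg_def card_cartesian_product)
qed

text \<open>
  Here \<open>v\<close> is the second moment of \<open>g\<close>, and the samples with index in \<open>I\<close> estimate it. If \<open>v \<le> 2 * B\<close>
  there is nothing to do. Otherwise the values above \<open>h\<close> carry less than half of \<open>v\<close>, and the
  rest has a variance small enough for Chebyshev's inequality: its squares are bounded by
  \<open>h\<^sup>2 = k * B\<close>. The bound is one-sided, since discarding large values can only lower the
  estimate; this is why no fourth moment of \<open>g\<close> enters.
\<close>

lemma underestimation_bound:
  fixes g :: "'e \<Rightarrow> 'a::real_normed_vector" and k :: nat and h B v :: real
  assumes E: "finite E" "E \<noteq> {}" and T: "finite T" "I \<subseteq> T" "card I = k" "1 \<le> k"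
    and h: "h\<^sup>2 = k * B" and tail: "avg E (\<lambda>y. if norm (g y) \<le> h then 0 else (norm (g y))\<^sup>2) \<le> B"
  defines "v \<equiv> avg E (\<lambda>y. (norm (g y))\<^sup>2)"
  shows "avg (PiE T (\<lambda>_. E)) (\<lambda>\<xi>. if (\<Sum>t\<in>I. (norm (g (\<xi> t)))\<^sup>2) / k < v / 4 then v else 0) \<le> 8 * B"
proof -
  let ?\<Omega> = "PiE T (\<lambda>_. E)"
  have fin: "finite ?\<Omega>" "?\<Omega> \<noteq> {}" using E T by (auto simp: finite_PiE PiE_eq_empty_iff)
  have v0: "0 \<le> v" by (auto simp: v_def intro: avg_nonneg)
  have "0 \<le> k * B" unfolding h [symmetric] by simp
  then have B0: "0 \<le> B" using T by (simp add: zero_le_mult_iff)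
  show ?thesis
  proof (cases "v \<le> 2 * B")
    case True
    have "avg ?\<Omega> (\<lambda>\<xi>. if (\<Sum>t\<in>I. (norm (g (\<xi> t)))\<^sup>2) / k < v / 4 then v else 0) \<le> avg ?\<Omega> (\<lambda>_. v)"
      using v0 by (intro avg_mono) auto
    then show ?thesis using True B0 fin by (simp add: avg_const)
  next
    case False
    define y where "y x = (if norm (g x) \<le> h then (norm (g x))\<^sup>2 else 0)" for x
    define m where "m = avg E y"
    have "v = avg E (\<lambda>x. y x + (if norm (g x) \<le> h then 0 else (norm (g x))\<^sup>2))"
      by (auto simp: v_def y_def intro: avg_cong)
    then have m: "v / 2 < m" "0 < m"
      using tail False B0 by (auto simp: avg_add m_def)
    define w where "w t = (if t \<in> I then 1 / real k else 0)" for t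
    define Y where "Y \<xi> = (\<Sum>t\<in>I. y (\<xi> t)) / k" for \<xi>
    have dev: "(\<Sum>t\<in>T. w t *\<^sub>R (y (\<xi> t) - mean E y)) = Y \<xi> - m" for \<xi>
    proof -
      have "(\<Sum>t\<in>T. w t *\<^sub>R (y (\<xi> t) - mean E y)) = (\<Sum>t\<in>I. w t *\<^sub>R (y (\<xi> t) - mean E y))"
        using T by (intro sum.mono_neutral_right) (auto simp: w_def)
      also have "\<dots> = (\<Sum>t\<in>I. (y (\<xi> t) - m) / k)"
        by (intro sum.cong) (auto simp: w_def m_def avg_eq_mean)
      also have "\<dots> = Y \<xi> - m"
        using T by (simp add: Y_def sum_subtractf diff_divide_distrib flip: sum_divide_distrib)
      finally show ?thesis .
    qed
    have "avg ?\<Omega> (\<lambda>\<xi>. (norm (\<Sum>t\<in>T. w t *\<^sub>R (y (\<xi> t) - mean E y)))\<^sup>2)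
        \<le> (\<Sum>t\<in>T. (w t)\<^sup>2 * avg E (\<lambda>x. (norm (y x))\<^sup>2))"
      using T E by (intro avg_weighted_deviation_le[where g = "\<lambda>_. y"]) auto
    also have "\<dots> = (\<Sum>t\<in>I. (w t)\<^sup>2 * avg E (\<lambda>x. (norm (y x))\<^sup>2))"
      using T by (intro sum.mono_neutral_right) (auto simp: w_def)
    also have "\<dots> = avg E (\<lambda>x. (y x)\<^sup>2) / k"
      using T by (simp add: w_def power2_eq_square)
    also have "\<dots> \<le> avg E (\<lambda>x. (k * B) * y x) / k"
    proof (intro divide_right_mono avg_mono)
      show "(y x)\<^sup>2 \<le> (k * B) * y x" for x
      proof (cases "norm (g x) \<le> h")
        case True
        then have "(norm (g x))\<^sup>2 \<le> k * B" unfolding h [symmetric] by (rule power_mono) auto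
        then have "(norm (g x))\<^sup>2 * (norm (g x))\<^sup>2 \<le> (k * B) * (norm (g x))\<^sup>2"
          by (rule mult_right_mono) simp
        then show ?thesis using True by (simp add: y_def power2_eq_square)
      qed (simp add: y_def)
    qed simp
    also have "\<dots> = B * m" using T by (simp add: avg_cmult m_def)
    finally have var: "avg ?\<Omega> (\<lambda>\<xi>. (Y \<xi> - m)\<^sup>2) \<le> B * m" by (simp only: dev) simp
    have "avg ?\<Omega> (\<lambda>\<xi>. if (\<Sum>t\<in>I. (norm (g (\<xi> t)))\<^sup>2) / k < v / 4 then v else 0)
      \<le> avg ?\<Omega> (\<lambda>\<xi>. (8 / m) * (Y \<xi> - m)\<^sup>2)"
    proof (rule avg_mono)
      fix \<xi>
      show "(if (\<Sum>t\<in>I. (norm (g (\<xi> t)))\<^sup>2) / k < v / 4 then v else 0) \<le> (8 / m) * (Y \<xi> - m)\<^sup>2"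
      proof (cases "(\<Sum>t\<in>I. (norm (g (\<xi> t)))\<^sup>2) / k < v / 4")
        case True
        have "Y \<xi> \<le> (\<Sum>t\<in>I. (norm (g (\<xi> t)))\<^sup>2) / k"
          by (auto simp: Y_def y_def intro!: divide_right_mono sum_mono)
        then have "m / 2 \<le> m - Y \<xi>" using True m by linarith
        then have "(m / 2)\<^sup>2 \<le> (m - Y \<xi>)\<^sup>2" using m by (intro power_mono) auto
        then have "(8 / m) * (m / 2)\<^sup>2 \<le> (8 / m) * (Y \<xi> - m)\<^sup>2"
          using m by (intro mult_left_mono) (auto simp: power2_commute)
        moreover have "(8 / m) * (m / 2)\<^sup>2 = 2 * m" using m by (simp add: power2_eq_square)
        ultimately show ?thesis using True m by simp
      next
        case False
        have "0 \<le> (8 / m) * (Y \<xi> - m)\<^sup>2" using m by (intro mult_nonneg_nonneg) auto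
        then show ?thesis by (simp only: False if_False)
      qed
    qed
    also have "\<dots> \<le> (8 / m) * (B * m)"
      unfolding avg_cmult using m by (intro mult_left_mono var) auto
    also have "\<dots> = 8 * B" using m by simp
    finally show ?thesis .
  qed
qed

text \<open>
  With \<open>a\<close> for the \<open>u\<close>-norm of \<open>g\<close>, the height \<open>a * k powr (1/u)\<close> balances the two conditions under
  which underestimation was bounded, so that both hold with the same \<open>B\<close>.
\<close>

lemma tail_second_moment:
  fixes g :: "nat \<Rightarrow> 'a::real_normed_vector" and k :: nat and a h B :: real
  assumes u: "2 < u" and N: "1 \<le> N" and k: "1 \<le> k"
  defines "a \<equiv> Lp_norm u N g"
  defines "h \<equiv> a * real k powr recip u" and "B \<equiv> a\<^sup>2 * real k powr (-1 + 2 * recip u)"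
  shows "h\<^sup>2 = k * B" "avg {1..N} (\<lambda>j. if norm (g j) \<le> h then 0 else (norm (g j))\<^sup>2) \<le> B"
proof -
  have "k * real k powr (-1 + 2 * recip u) = real k powr (1 + (-1 + 2 * recip u))"
    using k by (subst powr_add) simp
  also have "\<dots> = (real k powr recip u)\<^sup>2" using k by (simp add: power2_eq_square flip: powr_add)
  finally show "h\<^sup>2 = k * B" by (simp add: h_def B_def power_mult_distrib)
  have a0: "0 \<le> a" using N by (simp add: a_def Lp_norm_nonneg)
  have B0: "0 \<le> B" by (simp add: B_def)
  have "1 \<le> u" using u by (rule two_less_imp_ge_one)
  then show "avg {1..N} (\<lambda>j. if norm (g j) \<le> h then 0 else (norm (g j))\<^sup>2) \<le> B"
  proof (cases rule: exponent_cases)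
    case 1
    have "\<forall>j\<in>{1..N}. norm (g j) \<le> a"
      using Lp_norm_infty_le_iff[OF N, of g a] by (simp add: a_def 1)
    then have "avg {1..N} (\<lambda>j. if norm (g j) \<le> h then 0 else (norm (g j))\<^sup>2) = avg {1..N} (\<lambda>_. 0)"
      using k by (intro avg_cong) (auto simp: h_def 1)
    also have "\<dots> = 0" using N by (simp add: avg_def)
    finally show ?thesis using B0 by simp
  next
    case (2 q)
    then have q: "2 < q" using u by (simp add: less_ereal.simps(1)[symmetric] del: less_ereal.simps)
    have mom: "avg {1..N} (\<lambda>j. norm (g j) powr q) \<le> a powr q"
      using Lp_norm_ereal_power[of q N g] q N by (simp add: avg_def a_def 2 divide_simps mult.commute)
    have "avg {1..N} (\<lambda>j. if norm (g j) \<le> h then 0 else (norm (g j))\<^sup>2)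
      \<le> avg {1..N} (\<lambda>j. h powr (2 - q) * norm (g j) powr q)"
    proof (rule avg_mono)
      fix j assume j: "j \<in> {1..N}"
      show "(if norm (g j) \<le> h then 0 else (norm (g j))\<^sup>2) \<le> h powr (2 - q) * norm (g j) powr q"
      proof (cases "norm (g j) \<le> h")
        case False
        have "h \<noteq> 0"
        proof
          assume "h = 0"
          then have "a = 0" using k by (simp add: h_def)
          then have "(\<Sum>j=1..N. norm (g j) powr q) \<le> 0"
            using mom q N by (simp add: avg_def divide_simps mult_le_0_iff del: One_nat_def)
          then have "(\<Sum>j=1..N. norm (g j) powr q) = 0" by (intro antisym sum_nonneg) auto
          then have "norm (g j) = 0" using j by (simp add: sum_nonneg_eq_0_iff del: One_nat_def)
          then show False using False \<open>h = 0\<close> by simp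
        qed
        then have h: "0 < h" using a0 by (simp add: h_def)
        have "norm (g j) powr (2 - q) \<le> h powr (2 - q)"
          using False h q by (intro powr_mono2') auto
        then have "norm (g j) powr (2 - q) * norm (g j) powr q \<le> h powr (2 - q) * norm (g j) powr q"
          by (rule mult_right_mono) auto
        moreover have "norm (g j) powr (2 - q) * norm (g j) powr q = (norm (g j))\<^sup>2"
          using False h by (simp flip: powr_add)
        ultimately show ?thesis using False by simp
      qed auto
    qed
    also have "\<dots> \<le> h powr (2 - q) * a powr q"
      unfolding avg_cmult by (intro mult_left_mono mom) auto
    also have "\<dots> = (a powr (2 - q) * a powr q) * real k powr ((1 / q) * (2 - q))"
      using a0 by (simp add: h_def 2 recip_ereal powr_mult powr_powr)
    also have "a powr (2 - q) * a powr q = a\<^sup>2" using a0 by (cases "a = 0") (auto simp flip: powr_add)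
    also have "(1 / q) * (2 - q) = -1 + 2 * recip u" using q by (simp add: 2 recip_ereal field_simps)
    finally show ?thesis by (simp add: B_def)
  qed
qed

text \<open>
  The number of second-stage samples for each row: \<open>k\<close> in any case, so that the variance of no
  row is divided by less than \<open>k\<close>, and otherwise in proportion to the estimated sizes. If all
  estimates are zero, the quotient is zero by convention and \<open>k\<close> samples remain.
\<close>

definition allocation :: "nat \<Rightarrow> 'i set \<Rightarrow> ('i \<Rightarrow> real) \<Rightarrow> 'i \<Rightarrow> nat" where
  "allocation k R \<theta> i = k + nat \<lfloor>k * \<theta> i / avg R \<theta>\<rfloor>"

lemma sum_allocation_le:
  assumes "finite R" "\<And>i. i \<in> R \<Longrightarrow> 0 \<le> \<theta> i"
  shows "(\<Sum>i\<in>R. allocation k R \<theta> i) \<le> 2 * k * card R"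
proof -
  have 0: "0 \<le> avg R \<theta>" using assms by (auto intro: avg_nonneg)
  have "real (\<Sum>i\<in>R. allocation k R \<theta> i) \<le> (\<Sum>i\<in>R. k + k * \<theta> i / avg R \<theta>)"
    unfolding of_nat_sum allocation_def using assms 0 by (intro sum_mono) simp
  also have "\<dots> = k * card R + k / avg R \<theta> * (\<Sum>i\<in>R. \<theta> i)"
    by (simp add: sum.distrib sum_distrib_left sum_divide_distrib)
  also have "\<dots> \<le> k * card R + k * card R"
    by (cases "card R = 0") (auto simp: avg_def divide_simps)
  finally show ?thesis by linarith
qed

text \<open>
  The left-hand side is, up to a factor, the variance of stratified sampling with \<open>c i\<close> samples
  in row \<open>i\<close>. Where \<open>\<theta>\<close> is not too small, the count \<open>c i \<ge> k * \<theta> i / avg R \<theta>\<close> cancels one factor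
  \<open>\<sigma> i\<close>; where it is too small, the guaranteed count \<open>k\<close> remains.
\<close>

lemma allocation_bound:
  assumes k: "1 \<le> k" and R: "finite R" and \<theta>: "\<And>i. i \<in> R \<Longrightarrow> 0 \<le> \<theta> i"
    and \<sigma>: "\<And>i. i \<in> R \<Longrightarrow> 0 \<le> \<sigma> i" and c: "\<And>i. i \<in> R \<Longrightarrow> allocation k R \<theta> i \<le> c i"
  shows "(\<Sum>i\<in>R. (\<sigma> i)\<^sup>2 / c i)
    \<le> 2 / k * (\<Sum>i\<in>R. \<sigma> i) * avg R \<theta> + (\<Sum>i\<in>R. if (\<theta> i)\<^sup>2 < (\<sigma> i)\<^sup>2 / 4 then (\<sigma> i)\<^sup>2 else 0) / k"
proof -
  have "(\<sigma> i)\<^sup>2 / c i \<le> 2 / k * \<sigma> i * avg R \<theta> + (if (\<theta> i)\<^sup>2 < (\<sigma> i)\<^sup>2 / 4 then (\<sigma> i)\<^sup>2 else 0) / k"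
    if i: "i \<in> R" for i
  proof -
    have 0: "0 \<le> avg R \<theta>" using \<theta> by (rule avg_nonneg)
    have kc: "k \<le> c i" "k * \<theta> i / avg R \<theta> \<le> c i"
    proof -
      have "real (allocation k R \<theta> i) \<ge> k * \<theta> i / avg R \<theta>"
        using k unfolding allocation_def by linarith
      then show "k * \<theta> i / avg R \<theta> \<le> c i" using c[OF i] by linarith
    qed (use c[OF i] in \<open>auto simp: allocation_def\<close>)
    show ?thesis
    proof (cases "(\<theta> i)\<^sup>2 < (\<sigma> i)\<^sup>2 / 4")
      case True
      have "(\<sigma> i)\<^sup>2 / c i \<le> (\<sigma> i)\<^sup>2 / k" using kc k by (intro divide_left_mono) auto
      moreover have "0 \<le> 2 / k * \<sigma> i * avg R \<theta>" using 0 \<sigma>[OF i] by simp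
      ultimately show ?thesis using True by simp
    next
      case False
      then have "(\<sigma> i)\<^sup>2 \<le> (2 * \<theta> i)\<^sup>2" by (simp add: power_mult_distrib)
      then have s: "\<sigma> i \<le> 2 * \<theta> i" by (rule power2_le_imp_le) (use \<theta>[OF i] in auto)
      show ?thesis
      proof (cases "\<sigma> i = 0")
        case False
        with s \<sigma>[OF i] have pos: "0 < \<theta> i" "0 < \<sigma> i" by auto
        have "\<theta> i \<le> (\<Sum>i\<in>R. \<theta> i)" using \<theta> R i by (intro member_le_sum) auto
        with pos have "0 < (\<Sum>i\<in>R. \<theta> i)" by linarith
        then have "0 < avg R \<theta>"
          using R i unfolding avg_def by (intro divide_pos_pos) (auto simp: card_gt_0_iff)
        then have "k * \<theta> i \<le> c i * avg R \<theta>" using kc by (simp add: divide_simps)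
        then have "k * \<sigma> i \<le> 2 * (c i * avg R \<theta>)"
          using s mult_left_mono[OF s, of "real k"] by linarith
        then have "\<sigma> i * (k * \<sigma> i) \<le> \<sigma> i * (2 * (c i * avg R \<theta>))"
          using pos by (intro mult_left_mono) auto
        then have "(\<sigma> i)\<^sup>2 / c i \<le> 2 / k * \<sigma> i * avg R \<theta>"
          using kc k by (simp add: divide_simps power2_eq_square mult_ac)
        then show ?thesis using \<open>\<not> (\<theta> i)\<^sup>2 < _\<close> by simp
      qed (use 0 in simp)
    qed
  qed
  then have "(\<Sum>i\<in>R. (\<sigma> i)\<^sup>2 / c i)
    \<le> (\<Sum>i\<in>R. 2 / k * \<sigma> i * avg R \<theta> + (if (\<theta> i)\<^sup>2 < (\<sigma> i)\<^sup>2 / 4 then (\<sigma> i)\<^sup>2 else 0) / k)"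
    by (rule sum_mono)
  then show ?thesis
    by (simp add: sum.distrib sum_distrib_left sum_distrib_right sum_divide_distrib)
qed

text \<open>
  Lays out prescribed row counts on a time axis of length \<open>M\<close>; left-over times go to an
  arbitrary row.
\<close>

lemma schedule_exists:
  assumes R: "finite R" "R \<noteq> {}" and b: "(\<Sum>i\<in>R. b i) \<le> (M :: nat)"
  shows "\<exists>\<rho>. range \<rho> \<subseteq> R \<and> (\<forall>i\<in>R. b i \<le> card {t. t < M \<and> \<rho> t = i})"
proof -
  let ?Z = "SIGMA i:R. {..<b i}"
  have "card ?Z \<le> card {..<M}" using R b by (simp add: card_SigmaI)
  then obtain h where h: "h ` ?Z \<subseteq> {..<M}" "inj_on h ?Z"
    using card_le_inj[of ?Z "{..<M}"] R by auto
  obtain i0 where i0: "i0 \<in> R" using R by auto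
  define \<rho> where "\<rho> t = (if t \<in> h ` ?Z then fst (inv_into ?Z h t) else i0)" for t
  have "\<rho> t \<in> R" for t
    using inv_into_into[of t h ?Z] i0 by (auto simp: \<rho>_def mem_Times_iff)
  moreover have "b i \<le> card {t. t < M \<and> \<rho> t = i}" if i: "i \<in> R" for i
  proof -
    have "h ` ({i} \<times> {..<b i}) \<subseteq> {t. t < M \<and> \<rho> t = i}"
    proof (intro image_subsetI)
      fix z assume z: "z \<in> {i} \<times> {..<b i}"
      then have "z \<in> ?Z" using i by auto
      then show "h z \<in> {t. t < M \<and> \<rho> t = i}"
        using h z by (auto simp: \<rho>_def inv_into_f_f)
    qed
    then have "card (h ` ({i} \<times> {..<b i})) \<le> card {t. t < M \<and> \<rho> t = i}"
      by (intro card_mono) auto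
    also have "card (h ` ({i} \<times> {..<b i})) = card ({i} \<times> {..<b i})"
      using i by (intro card_image inj_on_subset[OF h(2)]) auto
    finally show ?thesis by (simp add: card_cartesian_product)
  qed
  ultimately show ?thesis by blast
qed

text \<open>
  The weights make the estimator unbiased, so that its mean square error is a sum of
  variances, one for each sample.
\<close>

lemma stratified_error:
  fixes f :: "nat \<times> nat \<Rightarrow> 'k::{real_normed_field, euclidean_space}" and M :: nat and \<rho> :: "nat \<Rightarrow> nat"
  assumes N: "1 \<le> N1" "1 \<le> N2" and \<rho>: "range \<rho> \<subseteq> {1..N1}"
  defines "c \<equiv> \<lambda>i. card {t. t < M \<and> \<rho> t = i}"
  assumes c: "\<And>i. i \<in> {1..N1} \<Longrightarrow> 0 < c i"
  shows "avg (PiE {..<M} (\<lambda>_. {1..N2}))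
      (\<lambda>\<eta>. (norm (mean_op N1 N2 f - (\<Sum>t<M. (1 / (N1 * c (\<rho> t))) *\<^sub>R f (\<rho> t, \<eta> t))))\<^sup>2)
    \<le> (\<Sum>i=1..N1. avg {1..N2} (\<lambda>j. (norm (f (i, j)))\<^sup>2) / c i) / (real N1)\<^sup>2"
proof -
  define w where "w t = 1 / (N1 * real (c (\<rho> t)))" for t
  let ?E = "{1..N2}"
  let ?g = "\<lambda>t j. f (\<rho> t, j)"
  have group: "(\<Sum>t<M. H t) = (\<Sum>i=1..N1. \<Sum>t | t \<in> {..<M} \<and> \<rho> t = i. H t)" for H :: "nat \<Rightarrow> 'x::comm_monoid_add"
    using \<rho> by (intro sum.group [symmetric]) auto
  have w: "(\<Sum>t | t \<in> {..<M} \<and> \<rho> t = i. H (w t)) = c i *\<^sub>R H (1 / (N1 * c i))" if "i \<in> {1..N1}"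
    for i and H :: "real \<Rightarrow> 'x::real_vector"
  proof -
    have "(\<Sum>t | t \<in> {..<M} \<and> \<rho> t = i. H (w t)) = (\<Sum>t | t \<in> {..<M} \<and> \<rho> t = i. H (1 / (N1 * c i)))"
      by (intro sum.cong) (auto simp: w_def)
    then show ?thesis by (simp add: c_def sum_constant_scaleR del: sum_constant)
  qed
  have "(\<Sum>t<M. w t *\<^sub>R mean ?E (?g t))
      = (\<Sum>i=1..N1. \<Sum>t | t \<in> {..<M} \<and> \<rho> t = i. w t *\<^sub>R mean ?E (\<lambda>j. f (i, j)))"
    unfolding group by (intro sum.cong) auto
  also have "\<dots> = (\<Sum>i=1..N1. (1 / N1) *\<^sub>R mean ?E (\<lambda>j. f (i, j)))"
  proof (rule sum.cong)
    fix i assume i: "i \<in> {1..N1}"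
    show "(\<Sum>t | t \<in> {..<M} \<and> \<rho> t = i. w t *\<^sub>R mean ?E (\<lambda>j. f (i, j))) = (1 / N1) *\<^sub>R mean ?E (\<lambda>j. f (i, j))"
      using w[OF i, of "\<lambda>z. z *\<^sub>R mean ?E (\<lambda>j. f (i, j))"] c[OF i] by simp
  qed simp
  also have "\<dots> = mean_op N1 N2 f"
    unfolding mean_op_eq_mean mean_def sum_prod_grid
    by (simp add: scaleR_sum_right [symmetric] divide_inverse card_cartesian_product)
  finally have "mean_op N1 N2 f = (\<Sum>t<M. w t *\<^sub>R mean ?E (?g t))" by simp
  then have "norm (mean_op N1 N2 f - (\<Sum>t<M. w t *\<^sub>R f (\<rho> t, \<eta> t)))
      = norm (\<Sum>t<M. w t *\<^sub>R (?g t (\<eta> t) - mean ?E (?g t)))" for \<eta>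
    by (simp add: scaleR_diff_right sum_subtractf norm_minus_commute)
  then have "avg (PiE {..<M} (\<lambda>_. ?E)) (\<lambda>\<eta>. (norm (mean_op N1 N2 f - (\<Sum>t<M. w t *\<^sub>R f (\<rho> t, \<eta> t))))\<^sup>2)
      \<le> (\<Sum>t<M. (w t)\<^sup>2 * avg ?E (\<lambda>j. (norm (f (\<rho> t, j)))\<^sup>2))"
    using N avg_weighted_deviation_le[of "{..<M}" ?E w ?g] by simp
  also have "\<dots> = (\<Sum>i=1..N1. \<Sum>t | t \<in> {..<M} \<and> \<rho> t = i. (w t)\<^sup>2 * avg ?E (\<lambda>j. (norm (f (i, j)))\<^sup>2))"
    unfolding group by (intro sum.cong) auto
  also have "\<dots> = (\<Sum>i=1..N1. avg ?E (\<lambda>j. (norm (f (i, j)))\<^sup>2) / c i / (real N1)\<^sup>2)"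
  proof (rule sum.cong)
    fix i assume i: "i \<in> {1..N1}"
    show "(\<Sum>t | t \<in> {..<M} \<and> \<rho> t = i. (w t)\<^sup>2 * avg ?E (\<lambda>j. (norm (f (i, j)))\<^sup>2))
        = avg ?E (\<lambda>j. (norm (f (i, j)))\<^sup>2) / c i / (real N1)\<^sup>2"
      using w[OF i, of "\<lambda>z. z\<^sup>2 * avg ?E (\<lambda>j. (norm (f (i, j)))\<^sup>2)"] c[OF i]
      by (simp add: power2_eq_square)
  qed simp
  finally show ?thesis by (simp add: w_def sum_divide_distrib)
qed

text \<open>
  The pilot stage visits row \<open>i\<close> during a time interval of length \<open>k\<close>; rows are counted from \<open>1\<close>,
  times from \<open>0\<close>.
\<close>

definition pilot_times :: "nat \<Rightarrow> nat \<Rightarrow> nat set" where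
  "pilot_times k i = {(i - 1) * k..<i * k}"

lemma pilot_times_facts:
  assumes "i \<in> {1..N1}" 
  shows "pilot_times k i \<subseteq> {..<N1 * k}" "card (pilot_times k i) = k"
    "t \<in> pilot_times k i \<Longrightarrow> Suc (t div k) = i"
proof -
  obtain l where i: "i = Suc l" using assms by (cases i) auto
  have "Suc l * k \<le> N1 * k" using assms i by (intro mult_right_mono) auto
  then show "pilot_times k i \<subseteq> {..<N1 * k}" by (auto simp: pilot_times_def i)
  show "card (pilot_times k i) = k" by (simp add: pilot_times_def i)
  show "Suc (t div k) = i" if "t \<in> pilot_times k i"
    using that by (auto simp: pilot_times_def i mult.commute intro!: div_nat_eqI)
qed

definition pilot_estimate :: "nat \<Rightarrow> 'k::real_normed_vector list \<Rightarrow> nat \<Rightarrow> real" where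
  "pilot_estimate k ys i = sqrt ((\<Sum>t\<in>pilot_times k i. (norm (ys ! t))\<^sup>2) / k)"

definition schedule :: "nat \<Rightarrow> nat \<Rightarrow> 'k::real_normed_vector list \<Rightarrow> nat \<Rightarrow> nat" where
  "schedule N1 k ys = (SOME \<rho>. range \<rho> \<subseteq> {1..N1} \<and>
     (\<forall>i\<in>{1..N1}. allocation k {1..N1} (pilot_estimate k ys) i
        \<le> card {t. t < 2 * k * N1 \<and> \<rho> t = i}))"

definition row_count :: "nat \<Rightarrow> nat \<Rightarrow> 'k::real_normed_vector list \<Rightarrow> nat \<Rightarrow> nat" where
  "row_count N1 k ys i = card {t. t < 2 * k * N1 \<and> schedule N1 k ys t = i}"

lemma schedule:
  assumes "1 \<le> N1"
  shows "range (schedule N1 k ys) \<subseteq> {1..N1}"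
    "i \<in> {1..N1} \<Longrightarrow> allocation k {1..N1} (pilot_estimate k ys) i \<le> row_count N1 k ys i"
proof -
  have "(\<Sum>i=1..N1. allocation k {1..N1} (pilot_estimate k ys) i) \<le> 2 * k * N1"
    using sum_allocation_le[of "{1..N1}" "pilot_estimate k ys" k]
    by (simp add: pilot_estimate_def sum_nonneg)
  then have "\<exists>\<rho>. range \<rho> \<subseteq> {1..N1} \<and> (\<forall>i\<in>{1..N1}.
      allocation k {1..N1} (pilot_estimate k ys) i \<le> card {t. t < 2 * k * N1 \<and> \<rho> t = i})"
    using assms by (intro schedule_exists) auto
  from someI_ex[OF this] show "range (schedule N1 k ys) \<subseteq> {1..N1}"
    "i \<in> {1..N1} \<Longrightarrow> allocation k {1..N1} (pilot_estimate k ys) i \<le> row_count N1 k ys i"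
    unfolding schedule_def row_count_def by auto
qed

text \<open>
  The point sampled after the values \<open>ys\<close> were seen. The pair \<open>w\<close> holds the random columns of the
  two stages; the row is prescribed by the time during the pilot stage and by the pilot
  values later on.
\<close>

definition two_stage_point ::
  "nat \<Rightarrow> nat \<Rightarrow> (nat \<Rightarrow> nat) \<times> (nat \<Rightarrow> nat) \<Rightarrow> 'k::real_normed_vector list \<Rightarrow> nat \<times> nat" where
  "two_stage_point N1 k w ys =
    (let t = length ys; P = N1 * k in
     if t < P then (Suc (t div k), fst w t)
     else if t - P < 2 * k * N1 then (schedule N1 k (take P ys) (t - P), snd w (t - P))
     else (1, 1))"

definition two_stage_output :: "nat \<Rightarrow> nat \<Rightarrow> 'k::real_normed_vector list \<Rightarrow> 'k" where
  "two_stage_output N1 k ys =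
    (let P = N1 * k; zs = take P ys in
     \<Sum>t<2 * k * N1. (1 / (N1 * row_count N1 k zs (schedule N1 k zs t))) *\<^sub>R (ys ! (P + t)))"

definition two_stage_alg ::
  "nat \<Rightarrow> nat \<Rightarrow> (nat \<Rightarrow> nat) \<times> (nat \<Rightarrow> nat) \<Rightarrow> (nat \<times> nat \<Rightarrow> 'k, 'k, 'k::real_normed_vector) det_alg"
  where
  "two_stage_alg N1 k w = sampling_alg (3 * k * N1) (two_stage_point N1 k w) (two_stage_output N1 k)"

abbreviation two_stage_columns :: "nat \<Rightarrow> nat \<Rightarrow> nat \<Rightarrow> ((nat \<Rightarrow> nat) \<times> (nat \<Rightarrow> nat)) set" where
  "two_stage_columns N1 N2 k \<equiv>
    PiE {..<N1 * k} (\<lambda>_. {1..N2}) \<times> PiE {..<2 * k * N1} (\<lambda>_. {1..N2})"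

lemma two_stage_alg_in_det_algs:
  assumes N: "1 \<le> N1" "1 \<le> N2" and w: "w \<in> two_stage_columns N1 N2 k"
  shows "(two_stage_alg N1 k w :: (_, 'k::real_normed_vector, _) det_alg) \<in> det_algs (std_info N1 N2)"
  unfolding two_stage_alg_def
proof (rule sampling_alg_in_det_algs)
  fix ys :: "'k list"
  have "Suc (length ys div k) \<le> N1" if "length ys < N1 * k"
    using that by (simp add: Suc_le_eq less_mult_imp_div_less)
  then show "two_stage_point N1 k w ys \<in> {1..N1} \<times> {1..N2}"
    using N w schedule(1)[OF N(1), of k "take (N1 * k) ys"]
    by (auto simp: two_stage_point_def Let_def PiE_iff mem_Times_iff image_subset_iff)
qed

definition pilot_values :: "nat \<Rightarrow> nat \<Rightarrow> (nat \<times> nat \<Rightarrow> 'k) \<Rightarrow> (nat \<Rightarrow> nat) \<Rightarrow> 'k list" where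
  "pilot_values N1 k f \<xi> = map (\<lambda>t. f (Suc (t div k), \<xi> t)) [0..<N1 * k]"

lemma info_two_stage_alg:
  "t \<le> N1 * k \<Longrightarrow> info (two_stage_alg N1 k w) f t = map (\<lambda>t. f (Suc (t div k), fst w t)) [0..<t]"
  "t \<le> 2 * k * N1 \<Longrightarrow> info (two_stage_alg N1 k w) f (N1 * k + t) = pilot_values N1 k f (fst w)
     @ map (\<lambda>t. f (schedule N1 k (pilot_values N1 k f (fst w)) t, snd w t)) [0..<t]"
proof -
  show 1: "info (two_stage_alg N1 k w) f t = map (\<lambda>t. f (Suc (t div k), fst w t)) [0..<t]"
    if "t \<le> N1 * k" for t
    using that
    by (induction t) (simp_all add: two_stage_alg_def info_sampling_alg_Suc two_stage_point_def del: info.simps(2))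
  show "info (two_stage_alg N1 k w) f (N1 * k + t) = pilot_values N1 k f (fst w)
     @ map (\<lambda>t. f (schedule N1 k (pilot_values N1 k f (fst w)) t, snd w t)) [0..<t]"
    if "t \<le> 2 * k * N1" for t
    using that
  proof (induction t)
    case 0
    then show ?case using 1[of "N1 * k"] by (simp add: pilot_values_def)
  next
    case (Suc t)
    have "length (pilot_values N1 k f (fst w)) = N1 * k" by (simp add: pilot_values_def)
    then show ?case
      using Suc by (simp add: two_stage_alg_def info_sampling_alg_Suc two_stage_point_def Let_def
          del: info.simps(2))
  qed
qed

lemma two_stage_alg_out:
  fixes f :: "nat \<times> nat \<Rightarrow> 'k::real_normed_vector" and N1 k :: nat
  defines "zs \<equiv> \<lambda>w. pilot_values N1 k f (fst w)"
  shows "alg_out (two_stage_alg N1 k w) f =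
    (\<Sum>t<2 * k * N1. (1 / (N1 * row_count N1 k (zs w) (schedule N1 k (zs w) t))) *\<^sub>R
      f (schedule N1 k (zs w) t, snd w t))"
proof -
  have len: "length (zs w) = N1 * k" by (simp add: pilot_values_def zs_def)
  have "alg_out (two_stage_alg N1 k w) f = two_stage_output N1 k (info (two_stage_alg N1 k w) f (N1 * k + 2 * k * N1))"
    by (simp add: two_stage_alg_def alg_out_sampling_alg algebra_simps)
  then show ?thesis
    using len unfolding info_two_stage_alg(2)[OF order_refl]
    by (simp add: two_stage_output_def Let_def nth_append zs_def)
qed

lemma sqrt_add_le: "0 \<le> x \<Longrightarrow> 0 \<le> y \<Longrightarrow> sqrt (x + y) \<le> sqrt x + sqrt (y::real)"
  by (rule real_le_lsqrt) (auto simp: power2_sum)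

text \<open>
  For a fixed outcome \<open>\<xi>\<close> of the pilot stage the second stage is stratified sampling with
  deterministic row counts. Averaging the resulting variance over \<open>\<xi>\<close> uses two facts about the
  pilot estimates: their mean is at most \<open>\<sigma>\<close>, and severe underestimation is rare.
\<close>

lemma two_stage_error:
  fixes f :: "nat \<times> nat \<Rightarrow> 'k::{real_normed_field, euclidean_space}"
  assumes f: "f \<in> mixed_ball p N1 u N2" and p: "1 \<le> p" "p \<le> 2" "2 < u"
    and N: "1 \<le> N1" "1 \<le> N2" and k: "1 \<le> k"
  shows "avg (two_stage_columns N1 N2 k)
      (\<lambda>w. norm (mean_op N1 N2 f - alg_out (two_stage_alg N1 k w) f))
    \<le> sqrt (2 / (real k * N1)) + sqrt 8 * N1 powr (recip p - 1) * k powr (recip u - 1)"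
proof -
  let ?r = "sqrt 8 * N1 powr (recip p - 1) * k powr (recip u - 1)"
  let ?err = "\<lambda>w. norm (mean_op N1 N2 f - alg_out (two_stage_alg N1 k w) f)"
  let ?R = "{1..N1}" and ?E = "{1..N2}" and ?P = "N1 * k" and ?M = "2 * k * N1"
  let ?X = "PiE {..<?P} (\<lambda>_. ?E)" and ?Y = "PiE {..<?M} (\<lambda>_. ?E)"
  have u: "1 \<le> u" using p(3) by (rule two_less_imp_ge_one)
  define a where "a i = Lp_norm u N2 (\<lambda>j. f (i, j))" for i
  define \<sigma> where "\<sigma> i = Lp_norm (ereal 2) N2 (\<lambda>j. f (i, j))" for i
  define v where "v i = avg ?E (\<lambda>j. (norm (f (i, j)))\<^sup>2)" for i
  define B where "B i = (a i)\<^sup>2 * real k powr (-1 + 2 * recip u)" for i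
  define zs where "zs \<xi> = pilot_values N1 k f \<xi>" for \<xi>
  define \<theta> where "\<theta> \<xi> = pilot_estimate k (zs \<xi>)" for \<xi>
  define c where "c \<xi> = row_count N1 k (zs \<xi>)" for \<xi>
  have fin: "finite ?X" "?X \<noteq> {}" using N by (auto simp: finite_PiE PiE_eq_empty_iff)
  have a0: "0 \<le> a i" and \<sigma>0: "0 \<le> \<sigma> i" for i using N by (simp_all add: a_def \<sigma>_def Lp_norm_nonneg)
  have \<sigma>2: "(\<sigma> i)\<^sup>2 = v i" for i
  proof -
    have "0 \<le> (\<Sum>j=1..N2. (norm (f (i, j)))\<^sup>2) / N2" by (intro divide_nonneg_nonneg sum_nonneg) auto
    then show ?thesis by (simp add: \<sigma>_def v_def avg_def Lp_norm_ereal powr_half_sqrt)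
  qed
  have \<sigma>a: "\<sigma> i \<le> a i" for i
  proof -
    have "max 0 (recip u - 1 / 2) = 0" using recip_antimono[of 2 u] p by (simp add: recip_ereal)
    then show ?thesis using Lp_norm_embed[OF u _ N(2), of 2] N by (simp add: \<sigma>_def a_def)
  qed
  have ap: "Lp_norm p N1 a \<le> 1"
    using f by (simp add: mixed_ball_def mixed_norm_def a_def[abs_def])
  have sum_a: "(\<Sum>i\<in>?R. a i) \<le> N1"
  proof -
    have "max 0 (recip p - 1 / 1) = 0" using recip_bounds p by simp
    then have "Lp_norm (ereal 1) N1 a \<le> 1"
      using Lp_norm_embed[OF p(1) order_refl N(1), of a] N ap by simp
    then show ?thesis using a0 N by (subst (asm) Lp_norm_ereal_le_iff) auto
  qed
  have sum_a2: "(\<Sum>i\<in>?R. (a i)\<^sup>2) \<le> (real N1 powr recip p)\<^sup>2"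
  proof -
    have "max 0 (recip p - 1 / 2) = recip p - 1 / 2" using recip_antimono[of p 2] p by (simp add: recip_ereal)
    then have "Lp_norm (ereal 2) N1 a \<le> N1 powr (recip p - 1 / 2) * Lp_norm p N1 a"
      using Lp_norm_embed[OF p(1) _ N(1), of 2 a] by simp
    also have "\<dots> \<le> N1 powr (recip p - 1 / 2) * 1" using ap by (intro mult_left_mono) auto
    finally have "(\<Sum>i\<in>?R. (a i)\<^sup>2) \<le> N1 * (real N1 powr (recip p - 1 / 2))\<^sup>2"
      using a0 N by (subst (asm) Lp_norm_ereal_le_iff) auto
    also have "\<dots> = (real N1 powr (1/2) * real N1 powr (recip p - 1 / 2))\<^sup>2"
      using N by (simp add: power_mult_distrib powr_half_sqrt)
    also have "real N1 powr (1/2) * real N1 powr (recip p - 1 / 2) = real N1 powr recip p"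
      by (simp flip: powr_add)
    finally show ?thesis .
  qed
  have \<theta>2: "(\<theta> \<xi> i)\<^sup>2 = (\<Sum>t\<in>pilot_times k i. (norm (f (i, \<xi> t)))\<^sup>2) / k" if i: "i \<in> ?R" for \<xi> i
  proof -
    have "(\<Sum>t\<in>pilot_times k i. (norm (zs \<xi> ! t))\<^sup>2) = (\<Sum>t\<in>pilot_times k i. (norm (f (i, \<xi> t)))\<^sup>2)"
    proof (rule sum.cong)
      fix t assume t: "t \<in> pilot_times k i"
      then have "t < ?P" "Suc (t div k) = i" using pilot_times_facts(1)[OF i, of k] pilot_times_facts(3)[OF i t] by auto
      then show "(norm (zs \<xi> ! t))\<^sup>2 = (norm (f (i, \<xi> t)))\<^sup>2" by (simp add: zs_def pilot_values_def)
    qed simp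
    then show ?thesis
      by (simp add: \<theta>_def pilot_estimate_def sum_nonneg)
  qed
  have \<theta>0: "0 \<le> \<theta> \<xi> i" for \<xi> i by (simp add: \<theta>_def pilot_estimate_def sum_nonneg)
  \<comment> \<open>the squared estimates are unbiased\<close>
  have avg\<theta>: "avg ?X (\<lambda>\<xi>. \<theta> \<xi> i) \<le> \<sigma> i" if i: "i \<in> ?R" for i
  proof -
    have "avg ?X (\<lambda>\<xi>. (\<theta> \<xi> i)\<^sup>2) = avg ?X (\<lambda>\<xi>. (1 / k) * (\<Sum>t\<in>pilot_times k i. (norm (f (i, \<xi> t)))\<^sup>2))"
      using i by (simp add: \<theta>2)
    also have "\<dots> = (1 / k) * (\<Sum>t\<in>pilot_times k i. v i)"
      unfolding avg_cmult avg_sum v_def using N pilot_times_facts(1,2)[OF i, of k]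
      by (intro arg_cong2[where f = "(*)"] sum.cong avg_PiE_marginal[where h = "\<lambda>j. (norm (f (i, j)))\<^sup>2"]) auto
    also have "\<dots> = (\<sigma> i)\<^sup>2" using pilot_times_facts(1,2)[OF i, of k] k by (simp add: \<sigma>2)
    finally show ?thesis using avg_le_sqrt[of ?X "\<lambda>\<xi>. \<theta> \<xi> i"] \<sigma>0 by simp
  qed
  have under: "avg ?X (\<lambda>\<xi>. if (\<theta> \<xi> i)\<^sup>2 < (\<sigma> i)\<^sup>2 / 4 then (\<sigma> i)\<^sup>2 else 0) \<le> 8 * B i"
    if i: "i \<in> ?R" for i
    unfolding \<theta>2[OF i] \<sigma>2 v_def B_def a_def
    using N pilot_times_facts(1,2)[OF i, of k] k tail_second_moment[OF p(3) N(2) k, of "\<lambda>j. f (i, j)"]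
    by (intro underestimation_bound[where g = "\<lambda>j. f (i, j)"]) auto
  have err2: "avg (?X \<times> ?Y) (\<lambda>w. (?err w)\<^sup>2)
    \<le> avg ?X (\<lambda>\<xi>. (\<Sum>i\<in>?R. (\<sigma> i)\<^sup>2 / c \<xi> i) / (real N1)\<^sup>2)"
    unfolding avg_Times
  proof (rule avg_mono)
    fix \<xi>
    have "0 < c \<xi> i" if "i \<in> ?R" for i
      using schedule(2)[OF N(1) that, of k "zs \<xi>"] k by (simp add: c_def allocation_def)
    then show "avg ?Y (\<lambda>\<eta>. (norm (mean_op N1 N2 f - alg_out (two_stage_alg N1 k (\<xi>, \<eta>)) f))\<^sup>2)
        \<le> (\<Sum>i\<in>?R. (\<sigma> i)\<^sup>2 / c \<xi> i) / (real N1)\<^sup>2"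
      unfolding two_stage_alg_out \<sigma>2 v_def
      using stratified_error[OF N schedule(1)[OF N(1)], of ?M k "zs \<xi>" f]
      by (simp add: c_def row_count_def zs_def)
  qed
  also have "\<dots> \<le> avg ?X (\<lambda>\<xi>. (1 / (real N1)\<^sup>2) * ((2 / k * (\<Sum>i\<in>?R. \<sigma> i)) * ((1 / N1) * (\<Sum>i\<in>?R. \<theta> \<xi> i))
      + (1 / k) * (\<Sum>i\<in>?R. if (\<theta> \<xi> i)\<^sup>2 < (\<sigma> i)\<^sup>2 / 4 then (\<sigma> i)\<^sup>2 else 0)))"
  proof (rule avg_mono)
    fix \<xi>
    have "(\<Sum>i\<in>?R. (\<sigma> i)\<^sup>2 / c \<xi> i) \<le> 2 / k * (\<Sum>i\<in>?R. \<sigma> i) * avg ?R (\<theta> \<xi>)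
        + (\<Sum>i\<in>?R. if (\<theta> \<xi> i)\<^sup>2 < (\<sigma> i)\<^sup>2 / 4 then (\<sigma> i)\<^sup>2 else 0) / k"
      using k \<theta>0 \<sigma>0 schedule(2)[OF N(1), of _ k "zs \<xi>"] by (intro allocation_bound) (auto simp: c_def \<theta>_def)
    from divide_right_mono[OF this, of "(real N1)\<^sup>2"]
    show "(\<Sum>i\<in>?R. (\<sigma> i)\<^sup>2 / c \<xi> i) / (real N1)\<^sup>2
      \<le> (1 / (real N1)\<^sup>2) * ((2 / k * (\<Sum>i\<in>?R. \<sigma> i)) * ((1 / N1) * (\<Sum>i\<in>?R. \<theta> \<xi> i))
      + (1 / k) * (\<Sum>i\<in>?R. if (\<theta> \<xi> i)\<^sup>2 < (\<sigma> i)\<^sup>2 / 4 then (\<sigma> i)\<^sup>2 else 0))"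
      by (simp add: avg_def)
  qed
  also have "\<dots> = (1 / (real N1)\<^sup>2) * ((2 / k * (\<Sum>i\<in>?R. \<sigma> i)) * ((1 / N1) * (\<Sum>i\<in>?R. avg ?X (\<lambda>\<xi>. \<theta> \<xi> i)))
      + (1 / k) * (\<Sum>i\<in>?R. avg ?X (\<lambda>\<xi>. if (\<theta> \<xi> i)\<^sup>2 < (\<sigma> i)\<^sup>2 / 4 then (\<sigma> i)\<^sup>2 else 0)))"
    unfolding avg_cmult avg_add avg_sum ..
  also have "\<dots> \<le> (1 / (real N1)\<^sup>2) * ((2 / k * N1) * ((1 / N1) * N1) + (1 / k) * (\<Sum>i\<in>?R. 8 * B i))"
  proof (intro mult_left_mono add_mono mult_mono sum_mono under)
    show "(\<Sum>i\<in>?R. \<sigma> i) \<le> N1" by (rule order_trans[OF sum_mono[OF \<sigma>a] sum_a])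
    then show "(\<Sum>i\<in>?R. avg ?X (\<lambda>\<xi>. \<theta> \<xi> i)) \<le> N1"
      using sum_mono[of ?R "\<lambda>i. avg ?X (\<lambda>\<xi>. \<theta> \<xi> i)" \<sigma>] avg\<theta> by fastforce
  qed (use \<theta>0 \<sigma>0 in \<open>auto intro!: mult_nonneg_nonneg divide_nonneg_nonneg sum_nonneg avg_nonneg\<close>)
  also have "\<dots> \<le> 2 / (real k * N1) + ?r\<^sup>2"
  proof -
    have "(\<Sum>i\<in>?R. 8 * B i) = 8 * real k powr (-1 + 2 * recip u) * (\<Sum>i\<in>?R. (a i)\<^sup>2)"
      by (simp add: B_def sum_distrib_left mult_ac)
    also have "\<dots> \<le> 8 * real k powr (-1 + 2 * recip u) * (real N1 powr recip p)\<^sup>2"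
      by (intro mult_left_mono sum_a2) auto
    finally have "(1 / (real N1)\<^sup>2) * ((1 / k) * (\<Sum>i\<in>?R. 8 * B i))
      \<le> (1 / (real N1)\<^sup>2) * ((1 / k) * (8 * real k powr (-1 + 2 * recip u) * (real N1 powr recip p)\<^sup>2))"
      by (intro mult_left_mono) auto
    also have "\<dots> = 8 * (real N1 powr recip p / N1)\<^sup>2 * (real k powr (-1 + 2 * recip u) / k)"
      by (simp add: power_divide)
    also have "real N1 powr recip p / N1 = real N1 powr (recip p - 1)"
      using N by (simp add: powr_diff)
    also have "real k powr (-1 + 2 * recip u) / k = (real k powr (recip u - 1))\<^sup>2"
    proof -
      have "(real k powr (recip u - 1))\<^sup>2 = real k powr ((recip u - 1) + (recip u - 1))"
        by (simp only: powr_add power2_eq_square)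
      also have "(recip u - 1) + (recip u - 1) = (-1 + 2 * recip u) - 1" by simp
      also have "real k powr \<dots> = real k powr (-1 + 2 * recip u) / k" using k by (subst powr_diff) simp
      finally show ?thesis by simp
    qed
    also have "8 * (real N1 powr (recip p - 1))\<^sup>2 * (real k powr (recip u - 1))\<^sup>2
        = ?r\<^sup>2"
      by (simp add: power_mult_distrib)
    finally have "(1 / (real N1)\<^sup>2) * ((1 / k) * (\<Sum>i\<in>?R. 8 * B i))
        \<le> ?r\<^sup>2" .
    moreover have "(1 / (real N1)\<^sup>2) * ((2 / k * N1) * ((1 / N1) * N1)) = 2 / (real k * N1)"
      using N k by (simp add: power2_eq_square)
    ultimately show ?thesis unfolding distrib_left by linarith
  qed
  finally have "avg (?X \<times> ?Y) (\<lambda>w. (?err w)\<^sup>2)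
    \<le> 2 / (real k * N1) + ?r\<^sup>2" .
  from order_trans[OF avg_le_sqrt real_sqrt_le_mono[OF this]]
  have "avg (?X \<times> ?Y) (\<lambda>w. ?err w)
    \<le> sqrt (2 / (real k * N1) + ?r\<^sup>2)" .
  also have "\<dots> \<le> sqrt (2 / (real k * N1)) + sqrt (?r\<^sup>2)"
    by (rule sqrt_add_le) auto
  finally show ?thesis by simp
qed

lemma powr_neg_half: "0 \<le> x \<Longrightarrow> x powr (-1 / 2) = 1 / sqrt x"
  using powr_minus_divide[of x "1 / 2"] powr_half_sqrt[of x] by simp

text \<open>
  If \<open>n < 3 * N1\<close>, plain Monte Carlo for exponent \<open>p\<close> is good enough. Otherwise the two-stage
  algorithm is affordable with \<open>k = n div (3 * N1)\<close>: the pilot stage takes \<open>k * N1\<close> samples and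
  the second stage \<open>2 * k * N1\<close>.
\<close>

lemma e_ran_adaptive:
  fixes p u :: ereal
  assumes p: "1 \<le> p" "p \<le> 2" "2 < u" and N: "1 \<le> N1" "1 \<le> N2" and n: "N1 \<le> n"
  shows "e_ran n (mean_op N1 N2 :: (nat \<times> nat \<Rightarrow> 'k::{real_normed_field, euclidean_space}) \<Rightarrow> 'k)
      (mixed_ball p N1 u N2) (std_info N1 N2)
    \<le> ennreal (18 * (N1 powr (recip p - recip u) * real n powr (-1 + recip u) + real n powr (-1 / 2)))"
    (is "e_ran n ?S ?F ?\<Lambda> \<le> ennreal ?C")
proof -
  have u: "1 \<le> u" using p(3) by (rule two_less_imp_ge_one)
  have "recip u \<le> 1 / 2" "1 / 2 \<le> recip p"
    using recip_antimono[of 2 u] recip_antimono[of p 2] p by (simp_all add: less_imp_le recip_ereal)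
  then have ru: "0 \<le> recip u" "recip u \<le> 1 / 2" "recip u \<le> recip p" "recip p \<le> 1" "1 / 2 \<le> recip p"
    using recip_bounds[OF u] recip_bounds[OF p(1)] by auto
  have n1: "1 \<le> n" using n N by simp
  show ?thesis
  proof (cases "n < 3 * N1")
    case True
    obtain q where q: "p = ereal q" "1 \<le> q" "q \<le> 2"
      using p by (cases p) (auto simp: one_ereal_def)
    have "e_ran n ?S ?F ?\<Lambda> \<le> e_ran_non n ?S ?F ?\<Lambda>" by (rule e_ran_le_e_ran_non)
    also have "\<dots> \<le> ennreal (3 * real n powr (-1 + recip p))"
      using e_ran_non_monte_carlo[OF p(1) u q(2,3) N n1, where 'k = 'k] ru N q by (simp add: recip_ereal)
    also have "\<dots> \<le> ennreal ?C"
    proof (rule ennreal_leI)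
      have "real n powr (-1 + recip p) = real n powr (recip p - recip u) * real n powr (-1 + recip u)"
        by (simp flip: powr_add)
      also have "real n powr (recip p - recip u) \<le> (3 * real N1) powr (recip p - recip u)"
        using True ru by (intro powr_mono2) auto
      also have "\<dots> = 3 powr (recip p - recip u) * real N1 powr (recip p - recip u)"
        by (simp add: powr_mult)
      also have "3 powr (recip p - recip u) \<le> (3::real) powr 1"
        using ru by (intro powr_mono) auto
      finally have "real n powr (-1 + recip p)
          \<le> 3 * (real N1 powr (recip p - recip u) * real n powr (-1 + recip u))"
        by (simp add: mult_right_mono)
      moreover have "0 \<le> real N1 powr (recip p - recip u) * real n powr (-1 + recip u)" by simp
      ultimately show "3 * real n powr (-1 + recip p) \<le> ?C"
        unfolding distrib_left using powr_ge_zero[of "real n" "-1/2"] by linarith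
    qed
    finally show ?thesis .
  next
    case False
    define k where "k = n div (3 * N1)"
    have k: "1 \<le> k" using False N by (simp add: k_def Suc_le_eq div_greater_zero_iff)
    have kn: "3 * k * N1 \<le> n" using div_times_less_eq_dividend[of n "3 * N1"] by (simp add: k_def mult_ac)
    have "n < (k + 1) * (3 * N1)" unfolding k_def using N dividend_less_div_times[of "3 * N1" n] by (simp add: algebra_simps)
    also have "\<dots> \<le> (2 * k) * (3 * N1)" using k by (intro mult_right_mono) auto
    finally have "n \<le> 6 * (k * N1)" by simp
    then have nk: "real n \<le> 6 * (real k * N1)" unfolding of_nat_mult [symmetric] by linarith
    let ?\<Omega> = "two_stage_columns N1 N2 k"
    let ?A = "two_stage_alg N1 k :: _ \<Rightarrow> (nat \<times> nat \<Rightarrow> 'k, 'k, 'k) det_alg"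
    have *: "finite ?\<Omega>" "?\<Omega> \<noteq> {}" using N by (auto simp: finite_PiE PiE_eq_empty_iff)
    have card: "alg_card (?A w) f \<le> enat n" if "w \<in> ?\<Omega>" "f \<in> ?F" for w f
      using kn by (simp add: two_stage_alg_def)
    have bound: "sqrt (2 / (real k * N1)) + sqrt 8 * N1 powr (recip p - 1) * k powr (recip u - 1) \<le> ?C"
    proof -
      have "sqrt (2 / (real k * N1)) \<le> sqrt (16 / n)"
        using nk N k n1 zero_le_mult_iff[of "real k" "real N1"]
        by (intro real_sqrt_le_mono) (auto simp: divide_simps mult.commute[of "real N1"])
      also have "\<dots> = 4 * real n powr (-1 / 2)"
        using powr_neg_half[of "real n"] by (simp add: real_sqrt_divide)
      finally have 1: "sqrt (2 / (real k * N1)) \<le> 4 * real n powr (-1 / 2)" .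
      have "real N1 powr (recip p - 1) * real k powr (recip u - 1)
          = real N1 powr (recip p - recip u) * (real k * N1) powr (recip u - 1)"
        using powr_add[of "real N1" "recip p - recip u" "recip u - 1"] by (simp add: powr_mult)
      also have "(real k * N1) powr (recip u - 1) \<le> (real n / 6) powr (recip u - 1)"
        using nk ru n1 by (intro powr_mono2') auto
      also have "\<dots> = real n powr (-1 + recip u) * 6 powr (1 - recip u)"
        using powr_minus_divide[of 6 "recip u - 1"] by (simp add: powr_divide)
      also have "6 powr (1 - recip u) \<le> (6::real) powr 1" using ru by (intro powr_mono) auto
      finally have "real N1 powr (recip p - 1) * real k powr (recip u - 1)
          \<le> 6 * (real N1 powr (recip p - recip u) * real n powr (-1 + recip u))"
        by (simp add: mult_left_mono)
      moreover have "sqrt 8 \<le> 3" by (rule real_le_lsqrt) auto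
      ultimately have "sqrt 8 * (real N1 powr (recip p - 1) * real k powr (recip u - 1))
          \<le> 3 * (6 * (real N1 powr (recip p - recip u) * real n powr (-1 + recip u)))"
        by - (rule mult_mono, auto)
      then show ?thesis
        using 1 powr_ge_zero[of "real n" "-1 / 2"] unfolding distrib_left mult.assoc by linarith
    qed
    have err: "avg ?\<Omega> (\<lambda>w. norm (?S f - alg_out (?A w) f)) \<le> ?C" if "f \<in> ?F" for f
      using two_stage_error[OF that p N k] bound by linarith
    note U = uniform_ran_alg[where A = ?A and F = ?F and S = ?S and n = n and C = ?C,
        OF * two_stage_alg_in_det_algs[OF N] card err]
    have "e_ran n ?S ?F ?\<Lambda> \<le> ran_error ?S ?F (uniform_count_measure ?\<Omega>) ?A"
      by (rule e_ran_le[OF U(1,2)])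
    also have "\<dots> \<le> ennreal ?C" by (rule U)
    finally show ?thesis .
  qed
qed

section \<open>Random signs\<close>

text \<open>
  Signs indexed by sets: \<open>U\<close> is the set of indices with sign \<open>-1\<close>.
\<close>

definition rademacher :: "'g set \<Rightarrow> 'g \<Rightarrow> real" where
  "rademacher U g = (if g \<in> U then -1 else 1)"

lemma rademacher_square [simp]: "(rademacher U g)\<^sup>2 = 1"
  by (simp add: rademacher_def)

lemma avg_Pow_insert:
  assumes "finite \<Gamma>" "g \<notin> \<Gamma>"
  shows "avg (Pow (insert g \<Gamma>)) F = avg (Pow \<Gamma>) (\<lambda>U. (F U + F (insert g U)) / 2)"
proof -
  have inj: "inj_on (insert g) (Pow \<Gamma>)" using assms by (auto simp: inj_on_def)
  have "(\<Sum>U\<in>Pow (insert g \<Gamma>). F U) = (\<Sum>U\<in>Pow \<Gamma>. F U) + (\<Sum>U\<in>insert g ` Pow \<Gamma>. F U)"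
    unfolding Pow_insert using assms by (intro sum.union_disjoint) auto
  also have "(\<Sum>U\<in>insert g ` Pow \<Gamma>. F U) = (\<Sum>U\<in>Pow \<Gamma>. F (insert g U))"
    using inj by (simp add: sum.reindex)
  finally show ?thesis
    using assms by (simp add: avg_def card_Pow sum.distrib flip: sum_divide_distrib)
qed

lemma avg_rademacher_insert:
  assumes "finite \<Gamma>" "g \<notin> \<Gamma>"
  shows "avg (Pow (insert g \<Gamma>)) (\<lambda>U. F (\<Sum>k\<in>insert g \<Gamma>. b k * rademacher U k))
    = avg (Pow \<Gamma>) (\<lambda>U. (F ((\<Sum>k\<in>\<Gamma>. b k * rademacher U k) + b g)
        + F ((\<Sum>k\<in>\<Gamma>. b k * rademacher U k) - b g)) / 2)"
proof -
  have *: "(\<Sum>k\<in>insert g \<Gamma>. b k * rademacher U k) = (\<Sum>k\<in>\<Gamma>. b k * rademacher U k) + b g"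
    "(\<Sum>k\<in>insert g \<Gamma>. b k * rademacher (insert g U) k) = (\<Sum>k\<in>\<Gamma>. b k * rademacher U k) - b g"
    if "U \<in> Pow \<Gamma>" for U
  proof -
    have "g \<notin> U" using that assms by auto
    then show "(\<Sum>k\<in>insert g \<Gamma>. b k * rademacher U k) = (\<Sum>k\<in>\<Gamma>. b k * rademacher U k) + b g"
      using assms by (simp add: rademacher_def)
    have "(\<Sum>k\<in>\<Gamma>. b k * rademacher (insert g U) k) = (\<Sum>k\<in>\<Gamma>. b k * rademacher U k)"
      using assms by (intro sum.cong) (auto simp: rademacher_def)
    then show "(\<Sum>k\<in>insert g \<Gamma>. b k * rademacher (insert g U) k) = (\<Sum>k\<in>\<Gamma>. b k * rademacher U k) - b g"
      using assms by (simp add: rademacher_def)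
  qed
  show ?thesis unfolding avg_Pow_insert[OF assms] by (intro avg_cong) (simp only: *)
qed

text \<open>
  Induction over the index set; adding a sign produces the even parts of \<open>(x + b)\<^sup>2\<close> and
  \<open>(x + b)^4\<close>.
\<close>

lemma rademacher_moments:
  assumes "finite \<Gamma>"
  shows "avg (Pow \<Gamma>) (\<lambda>U. (\<Sum>k\<in>\<Gamma>. b k * rademacher U k)\<^sup>2) = (\<Sum>k\<in>\<Gamma>. (b k)\<^sup>2)"
    and "avg (Pow \<Gamma>) (\<lambda>U. (\<Sum>k\<in>\<Gamma>. b k * rademacher U k)^4) \<le> 3 * (\<Sum>k\<in>\<Gamma>. (b k)\<^sup>2)\<^sup>2"
  using assms
proof (induction \<Gamma> rule: finite_induct)
  case empty
  { case 1 show ?case by (simp add: avg_def) next case 2 show ?case by (simp add: avg_def) }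
next
  case (insert g \<Gamma>)
  let ?X = "\<lambda>U. \<Sum>k\<in>\<Gamma>. b k * rademacher U k"
  have ne: "finite (Pow \<Gamma>)" "Pow \<Gamma> \<noteq> {}" using insert by auto
  { case 1
    have "((x + b g)\<^sup>2 + (x - b g)\<^sup>2) / 2 = x\<^sup>2 + (b g)\<^sup>2" for x
      by (simp add: power2_eq_square algebra_simps)
    then have "avg (Pow (insert g \<Gamma>)) (\<lambda>U. (\<Sum>k\<in>insert g \<Gamma>. b k * rademacher U k)\<^sup>2)
      = avg (Pow \<Gamma>) (\<lambda>U. (?X U)\<^sup>2) + (b g)\<^sup>2"
      by (simp only: avg_rademacher_insert[OF insert.hyps, of "\<lambda>x. x\<^sup>2" b] avg_add avg_const[OF ne])
    then show ?case using insert by simp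
  next
    case 2
    have "((x + b g)^4 + (x - b g)^4) / 2 = x^4 + (6 * (b g)\<^sup>2) * x\<^sup>2 + (b g)^4" for x
      by (simp add: eval_nat_numeral algebra_simps)
    then have "avg (Pow (insert g \<Gamma>)) (\<lambda>U. (\<Sum>k\<in>insert g \<Gamma>. b k * rademacher U k)^4)
      = avg (Pow \<Gamma>) (\<lambda>U. (?X U)^4) + (6 * (b g)\<^sup>2) * (\<Sum>k\<in>\<Gamma>. (b k)\<^sup>2) + (b g)^4"
      by (simp only: avg_rademacher_insert[OF insert.hyps, of "\<lambda>x. x^4" b] avg_add avg_cmult
          avg_const[OF ne] insert.IH(1))
    moreover have "0 \<le> (b g)^4" by simp
    ultimately have "avg (Pow (insert g \<Gamma>)) (\<lambda>U. (\<Sum>k\<in>insert g \<Gamma>. b k * rademacher U k)^4)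
        \<le> 3 * (\<Sum>k\<in>\<Gamma>. (b k)\<^sup>2)\<^sup>2 + (6 * (b g)\<^sup>2) * (\<Sum>k\<in>\<Gamma>. (b k)\<^sup>2) + 3 * (b g)^4"
      using insert.IH(2) by linarith
    also have "\<dots> = 3 * ((b g)\<^sup>2 + (\<Sum>k\<in>\<Gamma>. (b k)\<^sup>2))\<^sup>2"
      by (simp add: eval_nat_numeral algebra_simps)
    finally show ?case using insert by simp }
qed

text \<open>
  With \<open>t = \<bar>x\<bar> / s\<close>, the pointwise inequality \<open>t\<^sup>2 - 4/27 * t^4 \<le> t\<close> reduces the first
  moment to the second and fourth ones.
\<close>

lemma khinchine:
  assumes "finite \<Gamma>"
  shows "sqrt (\<Sum>k\<in>\<Gamma>. (b k)\<^sup>2) / 2 \<le> avg (Pow \<Gamma>) (\<lambda>U. \<bar>\<Sum>k\<in>\<Gamma>. b k * rademacher U k\<bar>)"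
proof (cases "(\<Sum>k\<in>\<Gamma>. (b k)\<^sup>2) = 0")
  case False
  define s where "s = sqrt (\<Sum>k\<in>\<Gamma>. (b k)\<^sup>2)"
  have s: "0 < s" using False sum_nonneg[of \<Gamma> "\<lambda>k. (b k)\<^sup>2"] by (simp add: s_def less_le)
  have s2: "(\<Sum>k\<in>\<Gamma>. (b k)\<^sup>2) = s\<^sup>2" by (simp add: s_def sum_nonneg)
  let ?X = "\<lambda>U. \<Sum>k\<in>\<Gamma>. b k * rademacher U k"
  have *: "(1 / s) * x\<^sup>2 + (- (4 / (27 * s^3))) * x^4 \<le> \<bar>x\<bar>" for x
  proof -
    define t where "t = \<bar>x\<bar> / s"
    have t: "0 \<le> t" "\<bar>x\<bar> = s * t" using s by (auto simp: t_def)
    \<comment> \<open>the cubic \<open>t^3 - 27/4 * t + 27/4\<close> has a double root at the maximum of \<open>t - 4/27 * t^3\<close>\<close>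
    have "0 \<le> t * ((t - 3/2)\<^sup>2 * (t + 3))" using t by auto
    also have "\<dots> = 27/4 * t - 27/4 * t\<^sup>2 + t^4"
      by (simp add: eval_nat_numeral algebra_simps)
    finally have "t\<^sup>2 - 4/27 * t^4 \<le> t" by simp
    then have "s * (t\<^sup>2 - 4/27 * t^4) \<le> s * t" using s by (intro mult_left_mono) auto
    moreover have "x\<^sup>2 = (s * t)\<^sup>2" "x^4 = (s * t)^4"
      using t(2) by (metis power2_abs, metis power_even_abs_numeral even_numeral)
    ultimately show ?thesis using s t(2)
      by (simp add: power_mult_distrib eval_nat_numeral field_simps)
  qed
  have "s / 2 \<le> (1 / s) * s\<^sup>2 + (- (4 / (27 * s^3))) * (3 * (s\<^sup>2)\<^sup>2)"
    using s by (simp add: eval_nat_numeral)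
  also have "\<dots> \<le> (1 / s) * avg (Pow \<Gamma>) (\<lambda>U. (?X U)\<^sup>2) + (- (4 / (27 * s^3))) * avg (Pow \<Gamma>) (\<lambda>U. (?X U)^4)"
    using rademacher_moments[OF assms, of b] s unfolding s2
    by (intro add_mono[OF _ mult_left_mono_neg]) auto
  also have "\<dots> = avg (Pow \<Gamma>) (\<lambda>U. (1 / s) * (?X U)\<^sup>2 + (- (4 / (27 * s^3))) * (?X U)^4)"
    by (simp only: avg_add avg_cmult)
  also have "\<dots> \<le> avg (Pow \<Gamma>) (\<lambda>U. \<bar>?X U\<bar>)" by (intro avg_mono *)
  finally show ?thesis by (simp add: s_def)
qed (auto intro: avg_nonneg)

lemma avg_reindex:
  assumes "bij_betw \<phi> A B"
  shows "avg B F = avg A (\<lambda>x. F (\<phi> x))"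
  using sum.reindex_bij_betw[OF assms, of F] bij_betw_same_card[OF assms] by (simp add: avg_def)

text \<open>
  A shift cannot help, because \<open>a + x\<close> and \<open>a - x\<close> occur equally often and differ by \<open>2 * x\<close>.
\<close>

lemma khinchine_shifted:
  fixes a :: "'a::real_normed_algebra_1"
  assumes "finite \<Gamma>"
  shows "sqrt (\<Sum>k\<in>\<Gamma>. (b k)\<^sup>2) / 2 \<le> avg (Pow \<Gamma>) (\<lambda>U. norm (a + of_real (\<Sum>k\<in>\<Gamma>. b k * rademacher U k)))"
proof -
  let ?X = "\<lambda>U. \<Sum>k\<in>\<Gamma>. b k * rademacher U k"
  let ?F = "\<lambda>U. norm (a + of_real (?X U))"
  \<comment> \<open>complementing \<open>U\<close> reverses all signs\<close>
  have "bij_betw (\<lambda>U. \<Gamma> - U) (Pow \<Gamma>) (Pow \<Gamma>)"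
    by (intro bij_betwI[where g = "\<lambda>U. \<Gamma> - U"]) auto
  then have "avg (Pow \<Gamma>) ?F = avg (Pow \<Gamma>) (\<lambda>U. ?F (\<Gamma> - U))" by (rule avg_reindex)
  also have "\<dots> = avg (Pow \<Gamma>) (\<lambda>U. norm (a - of_real (?X U)))"
  proof (intro avg_cong)
    fix U
    have "?X (\<Gamma> - U) = (\<Sum>k\<in>\<Gamma>. - (b k * rademacher U k))"
      by (intro sum.cong) (auto simp: rademacher_def)
    then show "?F (\<Gamma> - U) = norm (a - of_real (?X U))" by (simp add: sum_negf)
  qed
  finally have "2 * avg (Pow \<Gamma>) ?F = avg (Pow \<Gamma>) (\<lambda>U. ?F U + norm (a - of_real (?X U)))"
    by (simp add: avg_add)
  also have "\<dots> \<ge> avg (Pow \<Gamma>) (\<lambda>U. 2 * \<bar>?X U\<bar>)"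
  proof (rule avg_mono)
    fix U
    have "norm ((a + of_real (?X U)) - (a - of_real (?X U))) \<le> ?F U + norm (a - of_real (?X U))"
      by (rule norm_triangle_ineq4)
    moreover have "(a + of_real x) - (a - of_real x) = of_real (2 * x)" for x
      using mult_2[of "of_real x :: 'a"] by simp
    ultimately show "2 * \<bar>?X U\<bar> \<le> ?F U + norm (a - of_real (?X U))"
      by (simp only: norm_of_real)
  qed
  finally show ?thesis using khinchine[OF assms, of b] by (simp add: avg_cmult)
qed

section \<open>Runs of deterministic algorithms\<close>

text \<open>
  The maps in \<open>std_info\<close> are point evaluations; this recovers the point.
\<close>

definition query_point :: "nat \<Rightarrow> nat \<Rightarrow> (nat \<times> nat \<Rightarrow> 'k, 'k, 'g) det_alg \<Rightarrow> 'k list \<Rightarrow> nat \<times> nat" where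
  "query_point N1 N2 A ys = (SOME z. z \<in> {1..N1} \<times> {1..N2} \<and> query A ys = (\<lambda>f. f z))"

lemma query_point:
  assumes "A \<in> det_algs (std_info N1 N2)"
  shows "query_point N1 N2 A ys \<in> {1..N1} \<times> {1..N2}" "query A ys f = f (query_point N1 N2 A ys)"
proof -
  have "\<exists>z. z \<in> {1..N1} \<times> {1..N2} \<and> query A ys = (\<lambda>f. f z)"
    using assms unfolding det_algs_def std_info_def by blast
  from someI_ex[OF this] show "query_point N1 N2 A ys \<in> {1..N1} \<times> {1..N2}"
    "query A ys f = f (query_point N1 N2 A ys)" unfolding query_point_def by auto
qed

definition visited :: "nat \<Rightarrow> nat \<Rightarrow> (nat \<times> nat \<Rightarrow> 'k, 'k, 'g) det_alg \<Rightarrow> (nat \<times> nat \<Rightarrow> 'k) \<Rightarrow> (nat \<times> nat) set" where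
  "visited N1 N2 A f = {query_point N1 N2 A (info A f t) |t. enat t < alg_card A f}"

lemma visited_enat:
  "alg_card A f = enat c \<Longrightarrow> visited N1 N2 A f = (\<lambda>t. query_point N1 N2 A (info A f t)) ` {..<c}"
  by (auto simp: visited_def)

lemma finite_visited: "alg_card A f \<noteq> \<infinity> \<Longrightarrow> finite (visited N1 N2 A f)"
  by (auto simp: visited_enat)

lemma card_visited_le: "alg_card A f = enat c \<Longrightarrow> card (visited N1 N2 A f) \<le> c"
  using card_image_le[of "{..<c}"] by (simp add: visited_enat)

lemma info_agree:
  assumes A: "A \<in> det_algs (std_info N1 N2)"
    and "\<And>s. s < t \<Longrightarrow> f (query_point N1 N2 A (info A f s)) = f' (query_point N1 N2 A (info A f s))"
  shows "info A f' t = info A f t"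
  using assms(2)
proof (induction t)
  case (Suc t)
  then have "info A f' t = info A f t" by simp
  then show ?case using Suc.prems[of t] by (simp add: query_point(2)[OF A])
qed simp

lemma alg_card_enatD:
  assumes "alg_card A f = enat c"
  shows "stop A (info A f c)" "\<And>t. t < c \<Longrightarrow> \<not> stop A (info A f t)"
proof -
  from assms have ex: "\<exists>n. stop A (info A f n)" and c: "c = (LEAST n. stop A (info A f n))"
    by (auto simp: alg_card_def split: if_splits)
  show "stop A (info A f c)" unfolding c using ex by (rule LeastI_ex)
  show "\<not> stop A (info A f t)" if "t < c" for t using that unfolding c by (rule not_less_Least)
qed

lemma alg_card_enatI:
  assumes "stop A (info A f c)" "\<And>t. t < c \<Longrightarrow> \<not> stop A (info A f t)"
  shows "alg_card A f = enat c"
proof -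
  have "(LEAST n. stop A (info A f n)) = c"
    using assms by (intro Least_equality) (auto simp: not_less [symmetric])
  then show ?thesis using assms(1) by (auto simp: alg_card_def)
qed

text \<open>
  A run is determined by the values at the points that it visits.
\<close>

lemma run_agree:
  assumes A: "A \<in> det_algs (std_info N1 N2)" and fin: "alg_card A f \<noteq> \<infinity>"
    and agree: "\<And>z. z \<in> visited N1 N2 A f \<Longrightarrow> f z = f' z"
  shows "alg_card A f' = alg_card A f" "alg_out A f' = alg_out A f" "visited N1 N2 A f' = visited N1 N2 A f"
proof -
  obtain c where c: "alg_card A f = enat c" using fin by auto
  have info: "info A f' t = info A f t" if "t \<le> c" for t
    using that by (intro info_agree[OF A] agree) (auto simp: visited_enat[OF c])
  have c': "alg_card A f' = enat c"
    using alg_card_enatD[OF c] info by (intro alg_card_enatI) auto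
  then show "alg_card A f' = alg_card A f" using c by simp
  show "alg_out A f' = alg_out A f" using c c' info by (simp add: alg_out_def)
  show "visited N1 N2 A f' = visited N1 N2 A f" using c c' info by (auto simp: visited_enat)
qed

text \<open>
  Two functions that differ only on \<open>D\<close> and \<open>D'\<close> produce the same run until one of these sets is
  entered. If the run on \<open>f\<close> enters \<open>D\<close> and never \<open>D'\<close>, then up to its first visit to \<open>D\<close> the run on
  \<open>f'\<close> is the same, and it makes the same visit.
\<close>

lemma run_race:
  assumes A: "A \<in> det_algs (std_info N1 N2)" and fin: "alg_card A f \<noteq> \<infinity>" "alg_card A f' \<noteq> \<infinity>"
    and differ: "\<And>z. z \<in> {1..N1} \<times> {1..N2} \<Longrightarrow> z \<notin> D \<Longrightarrow> z \<notin> D' \<Longrightarrow> f z = f' z"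
    and hit: "visited N1 N2 A f \<inter> D \<noteq> {}" and "visited N1 N2 A f \<inter> D' = {}"
  shows "visited N1 N2 A f' \<inter> D \<noteq> {}"
proof -
  obtain c where c: "alg_card A f = enat c" using fin by auto
  obtain c' where c': "alg_card A f' = enat c'" using fin by auto
  let ?x = "\<lambda>t. query_point N1 N2 A (info A f t)"
  define t where "t = (LEAST t. ?x t \<in> D)"
  obtain t0 where t0: "t0 < c" "?x t0 \<in> D" using hit by (auto simp: visited_enat[OF c])
  have t: "?x t \<in> D" "t < c"
    using LeastI[of "\<lambda>t. ?x t \<in> D", OF t0(2)] Least_le[of "\<lambda>t. ?x t \<in> D", OF t0(2)] t0(1) by (auto simp: t_def)
  have before: "?x s \<notin> D" if "s < t" for s using that not_less_Least unfolding t_def by blast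
  have D': "?x s \<notin> D'" if "s < c" for s using that assms(6) by (auto simp: visited_enat[OF c])
  have info: "info A f' s = info A f s" if "s \<le> t" for s
    using that t before D' by (intro info_agree[OF A] differ query_point(1)[OF A]) auto
  have "t < c'"
  proof (rule ccontr)
    assume "\<not> t < c'"
    then have "c' \<le> t" by simp
    then have "stop A (info A f c')" using alg_card_enatD(1)[OF c'] info by simp
    then show False using alg_card_enatD(2)[OF c, of c'] \<open>c' \<le> t\<close> t(2) by simp
  qed
  then show ?thesis using t info[of t] by (auto simp: visited_enat[OF c'])
qed

section \<open>Lower bounds from priors with random signs\<close>

text \<open>
  The map \<open>lab\<close> assigns each grid point to its cell, and \<open>\<pi> g\<close> is the active cell of group \<open>g\<close>. The
  function has the value \<open>h\<close> or \<open>-h\<close> there, the latter for \<open>g \<in> T\<close>, and vanishes on all other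
  cells. Signs are attached to groups and not to cells so that a change of \<open>\<pi>\<close> keeps them.
\<close>

definition sign_prior :: "nat \<Rightarrow> nat \<Rightarrow> (nat \<times> nat \<Rightarrow> 'c) \<Rightarrow> real \<Rightarrow> ('g \<Rightarrow> 'c) \<Rightarrow> 'g set \<Rightarrow> 'g set
    \<Rightarrow> nat \<times> nat \<Rightarrow> 'k::real_normed_field" where
  "sign_prior N1 N2 lab h \<pi> \<Gamma> T = (\<lambda>z\<in>{1..N1} \<times> {1..N2}.
     of_real (\<Sum>g\<in>\<Gamma>. if \<pi> g = lab z then h * rademacher T g else 0))"

text \<open>
  The groups whose sign the algorithm learns.
\<close>

definition hits :: "nat \<Rightarrow> nat \<Rightarrow> (nat \<times> nat \<Rightarrow> 'c) \<Rightarrow> real \<Rightarrow> ('g \<Rightarrow> 'c) \<Rightarrow> 'g set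
    \<Rightarrow> (nat \<times> nat \<Rightarrow> 'k::real_normed_field, 'k, 'k) det_alg \<Rightarrow> 'g set \<Rightarrow> 'g set" where
  "hits N1 N2 lab h \<pi> \<Gamma> A T
    = {g \<in> \<Gamma>. \<pi> g \<in> lab ` visited N1 N2 A (sign_prior N1 N2 lab h \<pi> \<Gamma> T)}"

lemma visited_subset: "A \<in> det_algs (std_info N1 N2) \<Longrightarrow> visited N1 N2 A f \<subseteq> {1..N1} \<times> {1..N2}"
  using query_point(1) unfolding visited_def by blast

lemma mean_op_sign_prior:
  fixes \<pi> :: "'g \<Rightarrow> 'c"
  assumes cells: "\<And>g. g \<in> \<Gamma> \<Longrightarrow> card {z \<in> {1..N1} \<times> {1..N2}. \<pi> g = lab z} = d"
  shows "mean_op N1 N2 (sign_prior N1 N2 lab h \<pi> \<Gamma> T :: _ \<Rightarrow> 'k::real_normed_field)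
    = of_real (\<Sum>g\<in>\<Gamma>. h * d / (N1 * N2) * rademacher T g)"
proof -
  let ?G = "{1..N1} \<times> {1..N2}"
  have "(\<Sum>z\<in>?G. \<Sum>g\<in>\<Gamma>. if \<pi> g = lab z then h * rademacher T g else 0)
      = (\<Sum>g\<in>\<Gamma>. \<Sum>z\<in>?G. if \<pi> g = lab z then h * rademacher T g else 0)"
    by (rule sum.swap)
  also have "\<dots> = (\<Sum>g\<in>\<Gamma>. d * (h * rademacher T g))"
  proof (rule sum.cong)
    fix g assume g: "g \<in> \<Gamma>"
    have "(\<Sum>z\<in>?G. if \<pi> g = lab z then h * rademacher T g else 0)
        = (\<Sum>z\<in>{z \<in> ?G. \<pi> g = lab z}. h * rademacher T g)"
      by (rule sum.inter_filter [symmetric]) simp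
    then show "(\<Sum>z\<in>?G. if \<pi> g = lab z then h * rademacher T g else 0) = d * (h * rademacher T g)"
      using cells[OF g] by simp
  qed simp
  finally have "(\<Sum>z\<in>?G. \<Sum>g\<in>\<Gamma>. if \<pi> g = lab z then h * rademacher T g else 0) / (N1 * N2)
    = (\<Sum>g\<in>\<Gamma>. h * d / (N1 * N2) * rademacher T g)"
    by (simp add: sum_divide_distrib mult_ac)
  moreover have "mean_op N1 N2 (sign_prior N1 N2 lab h \<pi> \<Gamma> T :: _ \<Rightarrow> 'k)
    = of_real ((\<Sum>z\<in>?G. \<Sum>g\<in>\<Gamma>. if \<pi> g = lab z then h * rademacher T g else 0) / (N1 * N2))"
    by (simp add: mean_op_eq_mean mean_def sign_prior_def card_cartesian_product scaleR_conv_of_real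
        divide_inverse mult.commute)
  ultimately show ?thesis by simp
qed

text \<open>
  Flipping signs of groups that were not hit preserves the run, hence also the set of hit
  groups, so that each pattern \<open>U\<close> of flips is an involution on the set of all signs. Averaging
  over \<open>U\<close> turns the error at a fixed \<open>T\<close> into a shifted Rademacher sum over the groups that are
  not hit.
\<close>

lemma sign_error:
  fixes A :: "(nat \<times> nat \<Rightarrow> 'k::real_normed_field, 'k, 'k) det_alg" and \<pi> :: "'g \<Rightarrow> 'c"
  assumes A: "A \<in> det_algs (std_info N1 N2)" and \<Gamma>: "finite \<Gamma>" "\<Gamma> \<noteq> {}"
    and cells: "\<And>g. g \<in> \<Gamma> \<Longrightarrow> card {z \<in> {1..N1} \<times> {1..N2}. \<pi> g = lab z} = d" and h: "0 \<le> h"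
    and fin: "\<And>T. T \<subseteq> \<Gamma> \<Longrightarrow> alg_card A (sign_prior N1 N2 lab h \<pi> \<Gamma> T) \<noteq> \<infinity>"
  defines "s \<equiv> h * d / (N1 * N2)" and "f \<equiv> sign_prior N1 N2 lab h \<pi> \<Gamma>"
    and "H \<equiv> hits N1 N2 lab h \<pi> \<Gamma> A"
  shows "s / (2 * sqrt (card \<Gamma>)) * (card \<Gamma> - avg (Pow \<Gamma>) (\<lambda>T. card (H T)))
    \<le> avg (Pow \<Gamma>) (\<lambda>T. norm (mean_op N1 N2 (f T) - alg_out A (f T)))"
proof -
  let ?P = "Pow \<Gamma>" and ?r = "real (card \<Gamma>)"
  let ?err = "\<lambda>T T'. norm (mean_op N1 N2 (f T') - alg_out A (f T))"
  have ne: "finite ?P" "?P \<noteq> {}" using \<Gamma> by auto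
  have r: "0 < ?r" using \<Gamma> by (simp add: card_gt_0_iff)
  have s0: "0 \<le> s" using h by (simp add: s_def)
  have HG: "H T \<subseteq> \<Gamma>" for T by (auto simp: H_def hits_def)
  \<comment> \<open>only the groups in \<open>U\<close> that the run on \<open>f T\<close> does not hit change their sign\<close>
  define flip where "flip U T = (T - (U - H T)) \<union> ((U - H T) - T)" for U T
  have flip: "flip U T \<in> ?P" if "U \<in> ?P" "T \<in> ?P" for U T using that by (auto simp: flip_def)
  have agree: "f T z = f (flip U T) z" if "T \<in> ?P" "z \<in> visited N1 N2 A (f T)" for T U z
  proof -
    have z: "z \<in> {1..N1} \<times> {1..N2}" using visited_subset[OF A] that by blast
    have "(if \<pi> g = lab z then h * rademacher T g else 0)
        = (if \<pi> g = lab z then h * rademacher (flip U T) g else 0)" if g: "g \<in> \<Gamma>" for g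
    proof (cases "\<pi> g = lab z")
      case True
      then have "g \<in> H T" using g \<open>z \<in> visited _ _ _ _\<close> by (force simp: H_def hits_def f_def)
      then show ?thesis by (simp add: rademacher_def flip_def)
    qed simp
    then show ?thesis using z unfolding f_def sign_prior_def by (simp cong: sum.cong)
  qed
  have same: "alg_out A (f (flip U T)) = alg_out A (f T)" "H (flip U T) = H T" if "T \<in> ?P" for U T
    using run_agree[OF A _ agree[OF that]] fin that by (auto simp: f_def H_def hits_def)
  have inv: "flip U (flip U T) = T" if "T \<in> ?P" for U T
    using same(2)[OF that, of U] unfolding flip_def[of U "flip U T"] by (auto simp: flip_def)
  have "avg ?P (\<lambda>T. ?err T T)
      = avg ?P (\<lambda>U. avg ?P (\<lambda>T. ?err T T))"
    by (simp add: avg_const[OF ne])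
  also have "\<dots> = avg ?P (\<lambda>U. avg ?P (\<lambda>T. ?err T (flip U T)))"
  proof (rule avg_cong)
    fix U assume U: "U \<in> ?P"
    have "bij_betw (flip U) ?P ?P"
      using flip[OF U] inv by (intro bij_betwI[where g = "flip U"]) auto
    then have "avg ?P (\<lambda>T. ?err T T)
        = avg ?P (\<lambda>T. ?err (flip U T) (flip U T))"
      by (rule avg_reindex)
    also have "\<dots> = avg ?P (\<lambda>T. ?err T (flip U T))"
      by (intro avg_cong) (simp only: same(1))
    finally show "avg ?P (\<lambda>T. ?err T T)
        = avg ?P (\<lambda>T. ?err T (flip U T))" .
  qed
  also have "\<dots> = avg ?P (\<lambda>T. avg ?P (\<lambda>U. ?err T (flip U T)))"
    by (rule avg_swap)
  also have "\<dots> \<ge> avg ?P (\<lambda>T. s / (2 * sqrt ?r) * (?r + (-1) * real (card (H T))))"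
  proof (rule avg_mono)
    fix T assume T: "T \<in> ?P"
    define b where "b g = (if g \<in> H T then 0 else s * rademacher T g)" for g
    define a :: 'k where "a = of_real (\<Sum>g\<in>\<Gamma>. if g \<in> H T then s * rademacher T g else 0) - alg_out A (f T)"
    have "mean_op N1 N2 (f (flip U T)) - alg_out A (f T)
        = a + of_real (\<Sum>g\<in>\<Gamma>. b g * rademacher U g)" if "U \<in> ?P" for U
    proof -
      have "s * rademacher (flip U T) g
          = (if g \<in> H T then s * rademacher T g else 0) + b g * rademacher U g" for g
        by (auto simp: b_def flip_def rademacher_def)
      then have "(\<Sum>g\<in>\<Gamma>. s * rademacher (flip U T) g)
          = (\<Sum>g\<in>\<Gamma>. if g \<in> H T then s * rademacher T g else 0) + (\<Sum>g\<in>\<Gamma>. b g * rademacher U g)"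
        by (simp add: sum.distrib)
      moreover have "mean_op N1 N2 (f (flip U T)) = (of_real (\<Sum>g\<in>\<Gamma>. s * rademacher (flip U T) g) :: 'k)"
        unfolding f_def s_def by (rule mean_op_sign_prior[OF cells])
      ultimately show ?thesis by (simp add: a_def)
    qed
    then have "avg ?P (\<lambda>U. ?err T (flip U T))
        = avg ?P (\<lambda>U. norm (a + of_real (\<Sum>g\<in>\<Gamma>. b g * rademacher U g)))"
      by (intro avg_cong) (simp only:)
    with khinchine_shifted[OF \<Gamma>(1), of b a]
    have "sqrt (\<Sum>g\<in>\<Gamma>. (b g)\<^sup>2) / 2
        \<le> avg ?P (\<lambda>U. ?err T (flip U T))" by (simp only:)
    moreover have "s / (2 * sqrt ?r) * (?r + (-1) * real (card (H T))) \<le> sqrt (\<Sum>g\<in>\<Gamma>. (b g)\<^sup>2) / 2"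
    proof -
      let ?m = "?r - card (H T)"
      have cH: "card (H T) \<le> card \<Gamma>" using HG \<Gamma> by (intro card_mono)
      have "(\<Sum>g\<in>\<Gamma>. (b g)\<^sup>2) = (\<Sum>g\<in>\<Gamma> - H T. s\<^sup>2)"
        using \<Gamma> by (intro sum.mono_neutral_cong_right) (auto simp: b_def power_mult_distrib)
      also have "\<dots> = s\<^sup>2 * ?m"
        using \<Gamma> HG cH finite_subset[OF HG \<Gamma>(1)] by (simp add: card_Diff_subset of_nat_diff)
      finally have b: "sqrt (\<Sum>g\<in>\<Gamma>. (b g)\<^sup>2) = s * sqrt ?m" using s0 by (simp add: real_sqrt_mult)
      have "?m / sqrt ?r \<le> sqrt ?m"
      proof -
        have m: "0 \<le> ?m" "?m \<le> ?r" using cH by auto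
        have "?m = sqrt ?m * sqrt ?m" using m by simp
        also have "\<dots> \<le> sqrt ?m * sqrt ?r" using m by (intro mult_left_mono) auto
        finally show ?thesis using r by (simp add: divide_simps)
      qed
      then have "s * (?m / sqrt ?r) / 2 \<le> s * sqrt ?m / 2"
        using s0 by (intro divide_right_mono mult_left_mono) auto
      moreover have "s / (2 * sqrt ?r) * (?r + (-1) * real (card (H T))) = s * (?m / sqrt ?r) / 2" by simp
      ultimately show ?thesis by (simp only: b)
    qed
    ultimately show "s / (2 * sqrt ?r) * (?r + (-1) * real (card (H T)))
        \<le> avg ?P (\<lambda>U. ?err T (flip U T))" by linarith
  qed
  also have "avg ?P (\<lambda>T. s / (2 * sqrt ?r) * (?r + (-1) * real (card (H T))))
      = s / (2 * sqrt ?r) * (?r - avg ?P (\<lambda>T. card (H T)))"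
    unfolding avg_cmult avg_add avg_const[OF ne] by simp
  finally show ?thesis .
qed

text \<open>
  Yao's principle with random cost: the worst-case error and cost dominate their averages
  over the finite family \<open>f\<close>, and averaging over \<open>J\<close> and integrating over the algorithms commute.
  Because \<open>main\<close> charges \<open>\<delta>\<close> for each sample, a bound on the expected cost suffices. Runs that do
  not terminate have infinite cost, and the inequality is then trivial.
\<close>

lemma ran_error_lower_bound:
  fixes A :: "'w \<Rightarrow> ('f, 'k, 'g::{banach, second_countable_topology}) det_alg"
  assumes A: "ran_alg F \<Lambda> M A" and card: "ran_card F M A \<le> of_nat n"
    and J: "finite J" "J \<noteq> {}" "\<And>j. j \<in> J \<Longrightarrow> f j \<in> F" and \<delta>: "0 < \<delta>" and K: "0 \<le> K"
    and main: "\<And>w. w \<in> space M \<Longrightarrow> (\<And>j. j \<in> J \<Longrightarrow> alg_card (A w) (f j) \<noteq> \<infinity>)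
      \<Longrightarrow> K \<le> avg J (\<lambda>j. norm (S (f j) - alg_out (A w) (f j)))
             + \<delta> * avg J (\<lambda>j. real (the_enat (alg_card (A w) (f j))))"
  shows "ennreal (K - \<delta> * n) \<le> ran_error S F M A"
proof -
  interpret prob_space M using A by (simp add: ran_alg_def)
  let ?c = "\<lambda>j w. ennreal_of_enat (alg_card (A w) (f j))"
  let ?e = "\<lambda>j w. ennreal (norm (S (f j) - alg_out (A w) (f j)))"
  let ?m = "ennreal (1 / card J)"
  have cJ: "0 < real (card J)" using J by (simp add: card_gt_0_iff)
  have meas [measurable]: "?c j \<in> borel_measurable M" "?e j \<in> borel_measurable M" if "j \<in> J" for j
  proof -
    have c: "(\<lambda>w. alg_card (A w) (f j)) \<in> M \<rightarrow>\<^sub>M count_space UNIV"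
      and o: "(\<lambda>w. alg_out (A w) (f j)) \<in> borel_measurable M"
      using A J(3)[OF that] by (auto simp: ran_alg_def)
    show "?c j \<in> borel_measurable M" by (rule measurable_compose[OF c]) simp
    show "?e j \<in> borel_measurable M" using o by measurable
  qed
  have pointwise: "ennreal K \<le> (\<Sum>j\<in>J. ?m * ?e j w) + ennreal \<delta> * (\<Sum>j\<in>J. ?m * ?c j w)"
    if w: "w \<in> space M" for w
  proof (cases "\<forall>j\<in>J. alg_card (A w) (f j) \<noteq> \<infinity>")
    case True
    have "(\<Sum>j\<in>J. ?m * ?e j w) = ennreal (avg J (\<lambda>j. norm (S (f j) - alg_out (A w) (f j))))"
      by (simp add: avg_def sum_divide_distrib sum_ennreal flip: ennreal_mult)
    moreover have "(\<Sum>j\<in>J. ?m * ?c j w) = ennreal (avg J (\<lambda>j. real (the_enat (alg_card (A w) (f j)))))"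
    proof -
      have "?c j w = ennreal (real (the_enat (alg_card (A w) (f j))))" if "j \<in> J" for j
        using True that by (cases "alg_card (A w) (f j)") (auto simp: ennreal_of_nat_eq_real_of_nat)
      then show ?thesis
        by (simp add: avg_def sum_divide_distrib sum_ennreal flip: ennreal_mult cong: sum.cong)
    qed
    ultimately show ?thesis
      using ennreal_leI[OF main[OF w]] True \<delta>
      by (simp add: avg_nonneg flip: ennreal_mult ennreal_plus)
  next
    case False
    then obtain j where j: "j \<in> J" "alg_card (A w) (f j) = \<infinity>" by auto
    have "?m * ?c j w = \<top>" using j cJ by (simp add: ennreal_mult_top)
    then have "(\<Sum>j\<in>J. ?m * ?c j w) = \<top>"
      using member_le_sum[OF j(1) _ J(1), of "\<lambda>j. ?m * ?c j w"] by (simp add: top_unique)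
    then show ?thesis using \<delta> by (simp add: ennreal_mult_top)
  qed
  have E: "(\<Sum>j\<in>J. ?m * (\<integral>\<^sup>+w. g j w \<partial>M)) \<le> B"
    if "\<And>j. j \<in> J \<Longrightarrow> (\<integral>\<^sup>+w. g j w \<partial>M) \<le> B" for g B
  proof -
    have "(\<Sum>j\<in>J. ?m * (\<integral>\<^sup>+w. g j w \<partial>M)) \<le> (\<Sum>j\<in>J. ?m * B)"
      using that by (intro sum_mono mult_left_mono) auto
    also have "\<dots> = (of_nat (card J) * ?m) * B" by (simp add: mult.assoc)
    also have "of_nat (card J) * ?m = 1"
      using cJ by (simp add: ennreal_of_nat_eq_real_of_nat flip: ennreal_mult)
    finally show ?thesis by simp
  qed
  have "ennreal K = (\<integral>\<^sup>+w. ennreal K \<partial>M)" by (simp add: emeasure_space_1)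
  also have "\<dots> \<le> (\<integral>\<^sup>+w. (\<Sum>j\<in>J. ?m * ?e j w) + ennreal \<delta> * (\<Sum>j\<in>J. ?m * ?c j w) \<partial>M)"
    by (intro nn_integral_mono pointwise)
  also have "\<dots> = (\<Sum>j\<in>J. ?m * (\<integral>\<^sup>+w. ?e j w \<partial>M)) + ennreal \<delta> * (\<Sum>j\<in>J. ?m * (\<integral>\<^sup>+w. ?c j w \<partial>M))"
  proof -
    have swap: "(\<integral>\<^sup>+w. (\<Sum>j\<in>J. ?m * g j w) \<partial>M) = (\<Sum>j\<in>J. ?m * (\<integral>\<^sup>+w. g j w \<partial>M))"
      if "\<And>j. j \<in> J \<Longrightarrow> g j \<in> borel_measurable M" for g
    proof -
      have "(\<integral>\<^sup>+w. (\<Sum>j\<in>J. ?m * g j w) \<partial>M) = (\<Sum>j\<in>J. \<integral>\<^sup>+w. ?m * g j w \<partial>M)"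
        using that by (intro nn_integral_sum) simp
      also have "\<dots> = (\<Sum>j\<in>J. ?m * (\<integral>\<^sup>+w. g j w \<partial>M))"
        using that by (intro sum.cong nn_integral_cmult) auto
      finally show ?thesis .
    qed
    have sum_meas: "(\<lambda>w. \<Sum>j\<in>J. ?m * g j w) \<in> borel_measurable M"
      if "\<And>j. j \<in> J \<Longrightarrow> g j \<in> borel_measurable M" for g
      using that by (intro borel_measurable_sum) auto
    show ?thesis
      using sum_meas[of "?e", OF meas(2)] sum_meas[of "?c", OF meas(1)]
      by (simp add: nn_integral_add nn_integral_cmult swap[of "?e", OF meas(2)] swap[of "?c", OF meas(1)])
  qed
  also have "\<dots> \<le> ran_error S F M A + ennreal \<delta> * of_nat n"
  proof (intro add_mono mult_left_mono E)
    show "(\<integral>\<^sup>+w. ?e j w \<partial>M) \<le> ran_error S F M A" if "j \<in> J" for j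
      unfolding ran_error_def using J(3)[OF that] by (rule SUP_upper)
    show "(\<integral>\<^sup>+w. ?c j w \<partial>M) \<le> of_nat n" if "j \<in> J" for j
    proof -
      have "(\<integral>\<^sup>+w. ?c j w \<partial>M) \<le> ran_card F M A"
        unfolding ran_card_def using J(3)[OF that] by (rule SUP_upper)
      then show ?thesis using card by simp
    qed
  qed auto
  finally have "ennreal K \<le> ran_error S F M A + ennreal (\<delta> * n)"
    using \<delta> by (simp add: ennreal_of_nat_eq_real_of_nat ennreal_mult)
  then have "ennreal K - ennreal (\<delta> * n) \<le> ran_error S F M A"
    by (simp add: ennreal_minus_le_iff add.commute)
  then show ?thesis using \<delta> by (simp add: ennreal_minus)
qed

section \<open>Counting the hits of an algorithm\<close>

text \<open>
  Moving the active cell of group \<open>g\<close> to \<open>c\<close> changes the function only on the two cells involved,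
  so of the two runs at least one visits the active cell of the other.
\<close>

lemma hit_swap:
  fixes A :: "(nat \<times> nat \<Rightarrow> 'k::real_normed_field, 'k, 'k) det_alg" and \<pi> :: "'g \<Rightarrow> 'c"
    and lab :: "nat \<times> nat \<Rightarrow> 'c" and h :: real and T :: "'g set"
  assumes A: "A \<in> det_algs (std_info N1 N2)" and g: "g \<in> \<Gamma>"
  defines "f \<equiv> \<lambda>\<pi>. sign_prior N1 N2 lab h \<pi> \<Gamma> T"
  assumes fin: "alg_card A (f \<pi>) \<noteq> \<infinity>" "alg_card A (f (\<pi>(g := c))) \<noteq> \<infinity>"
    and hit: "\<pi> g \<in> lab ` visited N1 N2 A (f \<pi>)"
  shows "c \<in> lab ` visited N1 N2 A (f \<pi>) \<or> \<pi> g \<in> lab ` visited N1 N2 A (f (\<pi>(g := c)))"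
proof (cases "c \<in> lab ` visited N1 N2 A (f \<pi>)")
  case False
  have "visited N1 N2 A (f (\<pi>(g := c))) \<inter> lab -` {\<pi> g} \<noteq> {}"
  proof (rule run_race[OF A fin])
    fix z assume z: "z \<in> {1..N1} \<times> {1..N2}" "z \<notin> lab -` {\<pi> g}" "z \<notin> lab -` {c}"
    have "(\<Sum>k\<in>\<Gamma>. if \<pi> k = lab z then h * rademacher T k else 0)
        = (\<Sum>k\<in>\<Gamma>. if (\<pi>(g := c)) k = lab z then h * rademacher T k else 0)"
      using z by (intro sum.cong) auto
    then show "f \<pi> z = f (\<pi>(g := c)) z" using z(1) by (simp only: f_def sign_prior_def restrict_apply if_True)
  qed (use hit False in auto)
  then show ?thesis by force
qed simp

text \<open>
  Fix a group. The exchange \<open>(\<pi>, c) \<mapsto> (\<pi>(g := c), \<pi> g)\<close> is an involution on pairs of a choice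
  of active cells and a cell of the group. By \<open>hit_swap\<close>, whenever \<open>\<pi>\<close> is hit in this group, each
  of the \<open>q\<close> cells \<open>c\<close> is visited in the run for \<open>\<pi>\<close>, or else \<open>\<pi> g\<close> is visited in the run for
  \<open>\<pi>(g := c)\<close>. So \<open>q\<close> times the number of hits is at most twice the number of visited cells,
  summed over all choices.
\<close>

lemma transversal_hits:
  fixes A :: "(nat \<times> nat \<Rightarrow> 'k::real_normed_field, 'k, 'k) det_alg" and C :: "'g \<Rightarrow> 'c set"
    and lab :: "nat \<times> nat \<Rightarrow> 'c" and h :: real and T :: "'g set"
  assumes A: "A \<in> det_algs (std_info N1 N2)" and \<Gamma>: "finite \<Gamma>"
    and C: "\<And>g. g \<in> \<Gamma> \<Longrightarrow> finite (C g)" "\<And>g. g \<in> \<Gamma> \<Longrightarrow> card (C g) = q"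
    and disj: "\<And>g k. g \<in> \<Gamma> \<Longrightarrow> k \<in> \<Gamma> \<Longrightarrow> g \<noteq> k \<Longrightarrow> C g \<inter> C k = {}"
  defines "f \<equiv> \<lambda>\<pi>. sign_prior N1 N2 lab h \<pi> \<Gamma> T"
  assumes fin: "\<And>\<pi>. \<pi> \<in> PiE \<Gamma> C \<Longrightarrow> alg_card A (f \<pi>) \<noteq> \<infinity>"
  shows "q * (\<Sum>\<pi>\<in>PiE \<Gamma> C. card (hits N1 N2 lab h \<pi> \<Gamma> A T)) \<le> 2 * (\<Sum>\<pi>\<in>PiE \<Gamma> C. the_enat (alg_card A (f \<pi>)))"
proof -
  let ?\<Phi> = "PiE \<Gamma> C"
  define V where "V \<pi> = lab ` visited N1 N2 A (f \<pi>)" for \<pi>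
  have fV: "finite (V \<pi>)" "card (V \<pi>) \<le> the_enat (alg_card A (f \<pi>))" if \<pi>: "\<pi> \<in> ?\<Phi>" for \<pi>
  proof -
    show "finite (V \<pi>)" using finite_visited fin[OF \<pi>] unfolding V_def by blast
    obtain c where "alg_card A (f \<pi>) = enat c" using fin[OF \<pi>] by auto
    then show "card (V \<pi>) \<le> the_enat (alg_card A (f \<pi>))"
      using card_image_le[OF finite_visited[OF fin[OF \<pi>]], of lab N1 N2] card_visited_le[of A "f \<pi>" c N1 N2]
      by (simp add: V_def)
  qed
  have one: "q * (\<Sum>\<pi>\<in>?\<Phi>. of_bool (\<pi> g \<in> V \<pi>)) \<le> 2 * (\<Sum>\<pi>\<in>?\<Phi>. card (C g \<inter> V \<pi>))" if g: "g \<in> \<Gamma>" for g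
  proof -
    let ?X = "?\<Phi> \<times> C g"
    let ?\<phi> = "\<lambda>(\<pi>, c). (\<pi>(g := c), \<pi> g)"
    have \<phi>: "bij_betw ?\<phi> ?X ?X"
      using g by (intro bij_betwI[where g = ?\<phi>]) (auto simp: PiE_iff extensional_def)
    have "q * (\<Sum>\<pi>\<in>?\<Phi>. of_bool (\<pi> g \<in> V \<pi>)) = (\<Sum>\<pi>\<in>?\<Phi>. \<Sum>c\<in>C g. of_bool (\<pi> g \<in> V \<pi>))"
      using C(2)[OF g] by (simp add: sum_distrib_left)
    also have "\<dots> = (\<Sum>(\<pi>, c)\<in>?X. of_bool (\<pi> g \<in> V \<pi>))" by (rule sum.cartesian_product)
    also have "\<dots> \<le> (\<Sum>(\<pi>, c)\<in>?X. of_bool (c \<in> V \<pi>) + of_bool (\<pi> g \<in> V (\<pi>(g := c))))"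
    proof (rule sum_mono)
      fix x assume "x \<in> ?X"
      then obtain \<pi> c where x: "x = (\<pi>, c)" and \<pi>: "\<pi> \<in> ?\<Phi>" and c: "c \<in> C g" by auto
      have "\<pi>(g := c) \<in> ?\<Phi>" using \<pi> c g by (auto simp: PiE_iff extensional_def)
      then have "c \<in> V \<pi> \<or> \<pi> g \<in> V (\<pi>(g := c))" if "\<pi> g \<in> V \<pi>"
        using hit_swap[OF A g, of lab h \<pi> T c] fin[OF \<pi>] fin[of "\<pi>(g := c)"] that
        unfolding V_def f_def by blast
      then show "(case x of (\<pi>, c) \<Rightarrow> of_bool (\<pi> g \<in> V \<pi>))
          \<le> (case x of (\<pi>, c) \<Rightarrow> (of_bool (c \<in> V \<pi>) + of_bool (\<pi> g \<in> V (\<pi>(g := c))) :: nat))"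
        unfolding x by (cases "\<pi> g \<in> V \<pi>") auto
    qed
    also have "\<dots> = (\<Sum>(\<pi>, c)\<in>?X. of_bool (c \<in> V \<pi>)) + (\<Sum>(\<pi>, c)\<in>?X. of_bool (\<pi> g \<in> V (\<pi>(g := c))))"
      by (simp add: case_prod_unfold sum.distrib)
    also have "(\<Sum>(\<pi>, c)\<in>?X. of_bool (\<pi> g \<in> V (\<pi>(g := c)))) = (\<Sum>(\<pi>, c)\<in>?X. of_bool (c \<in> V \<pi>) :: nat)"
      using sum.reindex_bij_betw[OF \<phi>, of "\<lambda>(\<pi>, c). of_bool (c \<in> V \<pi>) :: nat"] by (simp add: case_prod_unfold)
    also have "(\<Sum>(\<pi>, c)\<in>?X. of_bool (c \<in> V \<pi>) :: nat) = (\<Sum>\<pi>\<in>?\<Phi>. card (C g \<inter> V \<pi>))"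
      using C(1)[OF g] by (simp add: sum.cartesian_product [symmetric] Int_def flip: sum.inter_filter)
    finally show ?thesis by simp
  qed
  have "q * (\<Sum>\<pi>\<in>?\<Phi>. card (hits N1 N2 lab h \<pi> \<Gamma> A T)) = q * (\<Sum>\<pi>\<in>?\<Phi>. \<Sum>g\<in>\<Gamma>. of_bool (\<pi> g \<in> V \<pi>))"
    using \<Gamma> by (simp add: hits_def V_def f_def Int_def)
  also have "\<dots> = (\<Sum>g\<in>\<Gamma>. q * (\<Sum>\<pi>\<in>?\<Phi>. of_bool (\<pi> g \<in> V \<pi>)))"
    by (subst sum.swap) (simp add: sum_distrib_left)
  also have "\<dots> \<le> (\<Sum>g\<in>\<Gamma>. 2 * (\<Sum>\<pi>\<in>?\<Phi>. card (C g \<inter> V \<pi>)))" by (intro sum_mono one)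
  also have "\<dots> = 2 * (\<Sum>\<pi>\<in>?\<Phi>. \<Sum>g\<in>\<Gamma>. card (C g \<inter> V \<pi>))"
    by (subst sum.swap[where A = ?\<Phi> and B = \<Gamma>]) (simp add: sum_distrib_left)
  also have "\<dots> \<le> 2 * (\<Sum>\<pi>\<in>?\<Phi>. the_enat (alg_card A (f \<pi>)))"
  proof (intro mult_left_mono sum_mono)
    fix \<pi> assume \<pi>: "\<pi> \<in> ?\<Phi>"
    have "(\<Sum>g\<in>\<Gamma>. card (C g \<inter> V \<pi>)) = card (\<Union>g\<in>\<Gamma>. C g \<inter> V \<pi>)"
      using \<Gamma> C(1) disj by (intro card_UN_disjoint [symmetric]) auto
    also have "\<dots> \<le> card (V \<pi>)" using fV(1)[OF \<pi>] by (intro card_mono) auto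
    also note fV(2)[OF \<pi>]
    finally show "(\<Sum>g\<in>\<Gamma>. card (C g \<inter> V \<pi>)) \<le> the_enat (alg_card A (f \<pi>))" .
  qed simp
  finally show ?thesis .
qed

lemma nonadaptive_run:
  assumes "nonadaptive A"
  shows "alg_card A f' = alg_card A f" "visited N1 N2 A f' = visited N1 N2 A f"
proof -
  have eq: "query A (info A f' t) = query A (info A f t)" "stop A (info A f' t) = stop A (info A f t)" for t
    using assms unfolding nonadaptive_def by (metis length_info)+
  show "alg_card A f' = alg_card A f" by (simp add: alg_card_def eq)
  then show "visited N1 N2 A f' = visited N1 N2 A f" by (simp add: visited_def query_point_def eq)
qed

text \<open>
  The visited points are the same for all functions, so the hits for different \<open>p\<close> are disjoint
  parts of one set of visited cells.
\<close>

lemma nonadaptive_hits: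
  fixes A :: "(nat \<times> nat \<Rightarrow> 'k::real_normed_field, 'k, 'k) det_alg" and \<pi> :: "'p \<Rightarrow> 'g \<Rightarrow> 'c"
    and lab :: "nat \<times> nat \<Rightarrow> 'c" and h :: real and T :: "'g set" and N1 N2 :: nat
  assumes A: "nonadaptive A" and \<Gamma>: "finite \<Gamma>" and \<Phi>: "finite \<Phi>"
    and inj: "inj_on (\<lambda>(p, g). \<pi> p g) (\<Phi> \<times> \<Gamma>)"
  defines "f \<equiv> \<lambda>p. sign_prior N1 N2 lab h (\<pi> p) \<Gamma> T"
  assumes fin: "\<And>p. p \<in> \<Phi> \<Longrightarrow> alg_card A (f p) \<noteq> \<infinity>"
  shows "card \<Phi> * (\<Sum>p\<in>\<Phi>. card (hits N1 N2 lab h (\<pi> p) \<Gamma> A T)) \<le> (\<Sum>p\<in>\<Phi>. the_enat (alg_card A (f p)))"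
proof (cases "\<Phi> = {}")
  case False
  then obtain p0 where p0: "p0 \<in> \<Phi>" by auto
  obtain c where c: "alg_card A (f p0) = enat c" using fin[OF p0] by auto
  define V where "V = lab ` visited N1 N2 A (f p0)"
  have V: "finite V" "card V \<le> c"
    using finite_visited[OF fin[OF p0], of N1 N2] card_image_le[of "visited N1 N2 A (f p0)" lab]
      card_visited_le[OF c, of N1 N2] by (auto simp: V_def)
  have vis: "visited N1 N2 A (sign_prior N1 N2 lab h (\<pi> p) \<Gamma> T) = visited N1 N2 A (f p0)" for p
    by (rule nonadaptive_run(2)[OF A])
  have "(\<Sum>p\<in>\<Phi>. card (hits N1 N2 lab h (\<pi> p) \<Gamma> A T)) = (\<Sum>p\<in>\<Phi>. card {g \<in> \<Gamma>. \<pi> p g \<in> V})"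
    by (simp add: hits_def V_def vis)
  also have "\<dots> = card (SIGMA p:\<Phi>. {g \<in> \<Gamma>. \<pi> p g \<in> V})" using \<Phi> \<Gamma> by (simp add: card_SigmaI)
  also have "\<dots> \<le> card V"
  proof (rule card_inj_on_le[of "\<lambda>(p, g). \<pi> p g"])
    show "inj_on (\<lambda>(p, g). \<pi> p g) (SIGMA p:\<Phi>. {g \<in> \<Gamma>. \<pi> p g \<in> V})"
      by (rule inj_on_subset[OF inj]) auto
  qed (use V in auto)
  finally have "card \<Phi> * (\<Sum>p\<in>\<Phi>. card (hits N1 N2 lab h (\<pi> p) \<Gamma> A T)) \<le> card \<Phi> * c"
    using V by (intro mult_left_mono) auto
  also have "card \<Phi> * c = (\<Sum>p\<in>\<Phi>. the_enat (alg_card A (f p)))"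
  proof -
    have "alg_card A (f p) = enat c" for p using nonadaptive_run(1)[OF A, of "f p" "f p0"] c by simp
    then show ?thesis by simp
  qed
  finally show ?thesis .
qed simp

text \<open>
  With \<open>s\<close> for the contribution of one cell to the mean and \<open>r\<close> for the number of groups, the
  error plus \<open>s / (q * sqrt r)\<close> times the cost is on average at least \<open>s * sqrt r / 2\<close>; a cost of
  at most \<open>r * q / 4\<close> uses up half of this.
\<close>

lemma random_sign_lower_bound:
  fixes A :: "'w \<Rightarrow> (nat \<times> nat \<Rightarrow> 'k::{real_normed_field, euclidean_space}, 'k, 'k) det_alg"
    and \<pi> :: "'p \<Rightarrow> 'g \<Rightarrow> 'c"
  assumes ran: "ran_alg F (std_info N1 N2) M A" "ran_card F M A \<le> of_nat n"
    and \<Phi>: "finite \<Phi>" "\<Phi> \<noteq> {}" and \<Gamma>: "finite \<Gamma>" "\<Gamma> \<noteq> {}" and N: "1 \<le> N1" "1 \<le> N2"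
    and cells: "\<And>p g. p \<in> \<Phi> \<Longrightarrow> g \<in> \<Gamma> \<Longrightarrow> card {z \<in> {1..N1} \<times> {1..N2}. \<pi> p g = lab z} = d"
    and h: "0 < h" and d: "1 \<le> d" and q: "1 \<le> q" and n: "4 * n \<le> card \<Gamma> * q"
  defines "f \<equiv> \<lambda>p. sign_prior N1 N2 lab h (\<pi> p) \<Gamma>"
  assumes F: "\<And>p T. p \<in> \<Phi> \<Longrightarrow> T \<subseteq> \<Gamma> \<Longrightarrow> f p T \<in> F"
    and hits: "\<And>w T. w \<in> space M \<Longrightarrow> T \<subseteq> \<Gamma> \<Longrightarrow> (\<And>p. p \<in> \<Phi> \<Longrightarrow> alg_card (A w) (f p T) \<noteq> \<infinity>) \<Longrightarrow>
      q * (\<Sum>p\<in>\<Phi>. card (hits N1 N2 lab h (\<pi> p) \<Gamma> (A w) T)) \<le> 2 * (\<Sum>p\<in>\<Phi>. the_enat (alg_card (A w) (f p T)))"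
  shows "ennreal (h * d / (N1 * N2) * sqrt (card \<Gamma>) / 4) \<le> ran_error (mean_op N1 N2) F M A"
proof -
  define s where "s = h * d / (N1 * N2)"
  let ?r = "real (card \<Gamma>)" and ?J = "\<Phi> \<times> Pow \<Gamma>"
  let ?\<delta> = "s / (q * sqrt ?r)"
  have s: "0 < s" using h d N by (simp add: s_def)
  have r: "0 < ?r" using \<Gamma> by (simp add: card_gt_0_iff)
  have ne: "finite (Pow \<Gamma>)" "Pow \<Gamma> \<noteq> {}" using \<Gamma> by auto
  have "ennreal (s * sqrt ?r / 2 - ?\<delta> * n) \<le> ran_error (mean_op N1 N2) F M A"
  proof (rule ran_error_lower_bound[OF ran, where J = ?J and f = "\<lambda>(p, T). f p T"])
    fix w assume w: "w \<in> space M"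
      and "\<And>j. j \<in> ?J \<Longrightarrow> alg_card (A w) (case j of (p, T) \<Rightarrow> f p T) \<noteq> \<infinity>"
    then have fin: "alg_card (A w) (f p T) \<noteq> \<infinity>" if "p \<in> \<Phi>" "T \<subseteq> \<Gamma>" for p T using that by auto
    have A: "A w \<in> det_algs (std_info N1 N2)" using ran w by (auto simp: ran_alg_def)
    let ?H = "\<lambda>p T. real (card (hits N1 N2 lab h (\<pi> p) \<Gamma> (A w) T))"
    let ?c = "\<lambda>p T. real (the_enat (alg_card (A w) (f p T)))"
    have "avg \<Phi> (\<lambda>p. ?H p T) \<le> 2 / q * avg \<Phi> (\<lambda>p. ?c p T)" if T: "T \<in> Pow \<Gamma>" for T
    proof -
      have "real (q * (\<Sum>p\<in>\<Phi>. card (hits N1 N2 lab h (\<pi> p) \<Gamma> (A w) T)))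
          \<le> real (2 * (\<Sum>p\<in>\<Phi>. the_enat (alg_card (A w) (f p T))))"
        using hits[OF w _ fin] T by (intro of_nat_mono) auto
      then have "(\<Sum>p\<in>\<Phi>. ?H p T) \<le> 2 / q * (\<Sum>p\<in>\<Phi>. ?c p T)"
        using q by (simp add: divide_simps mult.commute)
      from divide_right_mono[OF this, of "real (card \<Phi>)"] show ?thesis by (simp add: avg_def)
    qed
    then have "avg (Pow \<Gamma>) (\<lambda>T. avg \<Phi> (\<lambda>p. ?H p T)) \<le> avg (Pow \<Gamma>) (\<lambda>T. 2 / q * avg \<Phi> (\<lambda>p. ?c p T))"
      by (rule avg_mono)
    then have H: "avg \<Phi> (\<lambda>p. avg (Pow \<Gamma>) (?H p)) \<le> 2 / q * avg \<Phi> (\<lambda>p. avg (Pow \<Gamma>) (?c p))"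
      by (simp only: avg_cmult avg_swap[of "Pow \<Gamma>"])
    have "s / (2 * sqrt ?r) * (?r + (-1) * (2 / q * avg \<Phi> (\<lambda>p. avg (Pow \<Gamma>) (?c p))))
        \<le> s / (2 * sqrt ?r) * (?r + (-1) * avg \<Phi> (\<lambda>p. avg (Pow \<Gamma>) (?H p)))"
      using H s r by (intro mult_left_mono) auto
    also have "\<dots> = avg \<Phi> (\<lambda>p. s / (2 * sqrt ?r) * (?r + (-1) * avg (Pow \<Gamma>) (?H p)))"
      unfolding avg_cmult avg_add avg_const[OF \<Phi>] ..
    also have "\<dots> \<le> avg \<Phi> (\<lambda>p. avg (Pow \<Gamma>) (\<lambda>T. norm (mean_op N1 N2 (f p T) - alg_out (A w) (f p T))))"
    proof (rule avg_mono)
      fix p assume p: "p \<in> \<Phi>"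
      show "s / (2 * sqrt ?r) * (?r + (-1) * avg (Pow \<Gamma>) (?H p))
          \<le> avg (Pow \<Gamma>) (\<lambda>T. norm (mean_op N1 N2 (f p T) - alg_out (A w) (f p T)))"
        using sign_error[OF A \<Gamma> cells[OF p], where h = h] fin p h by (simp add: f_def s_def)
    qed
    finally have "s / (2 * sqrt ?r) * (?r + (-1) * (2 / q * avg ?J (\<lambda>(p, T). ?c p T)))
        \<le> avg ?J (\<lambda>(p, T). norm (mean_op N1 N2 (f p T) - alg_out (A w) (f p T)))"
      by (simp add: avg_Times)
    moreover have "s / (2 * sqrt ?r) * (?r + (-1) * (2 / q * x)) = s * sqrt ?r / 2 - ?\<delta> * x" for x
      using r by (simp add: field_simps)
    ultimately show "s * sqrt ?r / 2 \<le> avg ?J (\<lambda>j. norm (mean_op N1 N2 (case j of (p, T) \<Rightarrow> f p T)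
          - alg_out (A w) (case j of (p, T) \<Rightarrow> f p T)))
        + ?\<delta> * avg ?J (\<lambda>j. real (the_enat (alg_card (A w) (case j of (p, T) \<Rightarrow> f p T))))"
      by (simp add: case_prod_unfold)
  qed (use \<Phi> \<Gamma> F s q r in auto)
  moreover have "s * sqrt ?r / 4 \<le> s * sqrt ?r / 2 - ?\<delta> * n"
  proof -
    have "real (4 * n) \<le> real (card \<Gamma> * q)" using n by (rule of_nat_mono)
    then have "s * real (4 * n) \<le> s * (?r * q)" using s by (intro mult_left_mono) auto
    also have "?r * q = sqrt ?r * sqrt ?r * q" by simp
    finally have "?\<delta> * n \<le> s * sqrt ?r / 4" using r q by (simp add: divide_simps mult_ac)
    then show ?thesis by simp
  qed
  ultimately show ?thesis unfolding s_def by (meson ennreal_leI order_trans)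
qed

section \<open>Step functions on a partition into blocks\<close>

lemma card_block_le: "card {i \<in> {1..N}. (i - 1) div d = (a::nat)} \<le> d" if "1 \<le> d"
proof -
  have "{i \<in> {1..N}. (i - 1) div d = a} \<subseteq> {a * d + 1..a * d + d}"
  proof
    fix i assume i: "i \<in> {i \<in> {1..N}. (i - 1) div d = a}"
    then have "a * d \<le> i - 1" "1 \<le> i" using div_times_less_eq_dividend[of "i - 1" d] by auto
    moreover have "i - 1 < a * d + d" using i that dividend_less_div_times[of d "i - 1"] by simp
    ultimately have "a * d + 1 \<le> i" "i \<le> a * d + d" by linarith+
    then show "i \<in> {a * d + 1..a * d + d}" by simp
  qed
  from card_mono[OF _ this] show ?thesis by simp
qed

lemma card_block:
  assumes "1 \<le> r" "r \<le> N" "a < r"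
  shows "card {i \<in> {1..N}. (i - 1) div (N div r) = a} = N div r"
proof -
  let ?d = "N div r"
  have d: "1 \<le> ?d" using assms by (simp add: Suc_le_eq div_greater_zero_iff)
  have "{i \<in> {1..N}. (i - 1) div ?d = a} = {a * ?d + 1..a * ?d + ?d}"
  proof safe
    fix i assume i: "i \<in> {a * ?d + 1..a * ?d + ?d}"
    then show "(i - 1) div ?d = a" by (auto simp: mult.commute intro!: div_nat_eqI)
    have "a * ?d + ?d \<le> r * ?d" using assms by (metis Suc_leI add.commute mult_Suc mult_le_mono1)
    also have "\<dots> \<le> N" by (simp add: mult.commute)
    finally show "i \<in> {1..N}" using i by auto
  next
    fix i assume i: "i \<in> {1..N}" "a = (i - 1) div ?d"
    have "(i - 1) div ?d * ?d \<le> i - 1" "i - 1 < (i - 1) div ?d * ?d + ?d" "1 \<le> i"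
      using d i dividend_less_div_times[of ?d "i - 1"] by auto
    then have "(i - 1) div ?d * ?d + 1 \<le> i" "i \<le> (i - 1) div ?d * ?d + ?d" by linarith+
    then show "i \<in> {(i - 1) div ?d * ?d + 1..(i - 1) div ?d * ?d + ?d}" by simp
  qed
  then show ?thesis by simp
qed

text \<open>
  If \<open>r1\<close> does not divide \<open>N1\<close>, the last rows get an index \<open>\<ge> r1\<close>; test functions vanish there, and
  likewise for columns.
\<close>

definition cell :: "nat \<Rightarrow> nat \<Rightarrow> nat \<Rightarrow> nat \<Rightarrow> nat \<times> nat \<Rightarrow> nat \<times> nat" where
  "cell N1 N2 r1 r2 z = ((fst z - 1) div (N1 div r1), (snd z - 1) div (N2 div r2))"

lemma card_cell:
  assumes "1 \<le> r1" "r1 \<le> N1" "1 \<le> r2" "r2 \<le> N2" "c \<in> {..<r1} \<times> {..<r2}"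
  shows "card {z \<in> {1..N1} \<times> {1..N2}. c = cell N1 N2 r1 r2 z} = (N1 div r1) * (N2 div r2)"
proof -
  have "{z \<in> {1..N1} \<times> {1..N2}. c = cell N1 N2 r1 r2 z}
    = {i \<in> {1..N1}. (i - 1) div (N1 div r1) = fst c} \<times> {j \<in> {1..N2}. (j - 1) div (N2 div r2) = snd c}"
    by (auto simp: cell_def)
  moreover have "fst c < r1" "snd c < r2" using assms by auto
  ultimately show ?thesis
    using card_block[of r1 N1 "fst c"] card_block[of r2 N2 "snd c"] assms
    by (simp only: card_cartesian_product)
qed

lemma Lp_norm_supported:
  assumes P: "1 \<le> P" and N: "1 \<le> N" and c: "0 \<le> c" "\<And>i. i \<in> {1..N} \<Longrightarrow> norm (x i) \<le> c"
    and supp: "card {i \<in> {1..N}. x i \<noteq> 0} * r \<le> N" and r: "1 \<le> (r::nat)"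
  shows "Lp_norm P N x \<le> c * real r powr (- recip P)"
  using P
proof (cases rule: exponent_cases)
  case 1
  then show ?thesis using r c N by (simp add: Lp_norm_infty_le_iff del: One_nat_def)
next
  case (2 q)
  have "(\<Sum>i=1..N. norm (x i) powr q) = (\<Sum>i\<in>{i \<in> {1..N}. x i \<noteq> 0}. norm (x i) powr q)"
    using 2 by (intro sum.mono_neutral_right) auto
  also have "\<dots> \<le> (\<Sum>i\<in>{i \<in> {1..N}. x i \<noteq> 0}. c powr q)"
    using 2 c by (intro sum_mono powr_mono2) auto
  also have "\<dots> = card {i \<in> {1..N}. x i \<noteq> 0} * c powr q" by simp
  also have "\<dots> \<le> (N / r) * c powr q"
  proof (intro mult_right_mono)
    have "real (card {i \<in> {1..N}. x i \<noteq> 0} * r) \<le> real N" using supp by (rule of_nat_mono)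
    then show "real (card {i \<in> {1..N}. x i \<noteq> 0}) \<le> N / r" using r by (simp add: divide_simps)
  qed simp
  also have "\<dots> = N * (c * real r powr (- recip P)) powr q"
  proof -
    have "(c * real r powr (- recip P)) powr q = c powr q * real r powr (- (1 / q) * q)"
      using 2 c by (simp add: recip_ereal powr_mult powr_powr)
    also have "- (1 / q) * q = - 1" using 2 by simp
    finally show ?thesis using r by (simp add: powr_minus divide_inverse)
  qed
  finally show ?thesis using 2 N c by (simp add: Lp_norm_ereal_le_iff del: One_nat_def)
qed

lemma sign_prior_at:
  assumes "finite \<Gamma>" "inj_on \<pi> \<Gamma>" "z \<in> {1..N1} \<times> {1..N2}" "0 \<le> h"
  shows "norm (sign_prior N1 N2 lab h \<pi> \<Gamma> T z :: 'k::real_normed_field) \<le> h"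
    "(sign_prior N1 N2 lab h \<pi> \<Gamma> T z :: 'k) \<noteq> 0 \<Longrightarrow> lab z \<in> \<pi> ` \<Gamma>"
proof -
  let ?v = "\<Sum>g\<in>\<Gamma>. if \<pi> g = lab z then h * rademacher T g else 0"
  have v: "(sign_prior N1 N2 lab h \<pi> \<Gamma> T z :: 'k) = of_real ?v"
    using assms by (simp only: sign_prior_def restrict_apply if_True)
  have zero: "?v = 0" if "lab z \<notin> \<pi> ` \<Gamma>" using that by (intro sum.neutral ballI) (metis imageI)
  then show "(sign_prior N1 N2 lab h \<pi> \<Gamma> T z :: 'k) \<noteq> 0 \<Longrightarrow> lab z \<in> \<pi> ` \<Gamma>" unfolding v by fastforce
  have "\<bar>?v\<bar> \<le> h"
  proof (cases "lab z \<in> \<pi> ` \<Gamma>")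
    case True
    then obtain g where g: "g \<in> \<Gamma>" "lab z = \<pi> g" by auto
    have "?v = (\<Sum>k\<in>\<Gamma>. if k = g then h * rademacher T k else 0)"
      using g assms by (intro sum.cong) (auto dest: inj_onD)
    then show ?thesis using g assms by (simp add: rademacher_def)
  next
    case False
    then show ?thesis using zero assms by simp
  qed
  then show "norm (sign_prior N1 N2 lab h \<pi> \<Gamma> T z :: 'k) \<le> h" by (simp only: v norm_of_real)
qed

text \<open>
  A function of height \<open>h\<close> that occupies a fraction \<open>1 / \<rho>\<close> of the rows, and in each of them a
  fraction \<open>1 / \<tau>\<close> of the columns, has mixed norm at most \<open>h * \<rho> powr (-1/p) * \<tau> powr (-1/u)\<close>.
  The two disjunctions cover the shapes that occur: the support is spread over everything or
  is confined to one block.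
\<close>

lemma sign_prior_in_ball:
  fixes \<pi> :: "'g \<Rightarrow> nat \<times> nat"
  assumes p: "1 \<le> p" "1 \<le> u" and r: "1 \<le> r1" "r1 \<le> N1" "1 \<le> r2" "r2 \<le> N2"
    and \<Gamma>: "finite \<Gamma>" "inj_on \<pi> \<Gamma>"
    and h: "0 \<le> h" "h \<le> real \<rho> powr recip p * real \<tau> powr recip u"
    and rows: "\<rho> = 1 \<or> \<rho> = r1 \<and> (\<forall>g\<in>\<Gamma>. \<forall>k\<in>\<Gamma>. fst (\<pi> g) = fst (\<pi> k))"
    and cols: "\<tau> = 1 \<or> \<tau> = r2 \<and> (\<forall>g\<in>\<Gamma>. \<forall>k\<in>\<Gamma>. fst (\<pi> g) = fst (\<pi> k) \<longrightarrow> snd (\<pi> g) = snd (\<pi> k))"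
  shows "(sign_prior N1 N2 (cell N1 N2 r1 r2) h \<pi> \<Gamma> T :: _ \<Rightarrow> 'k::real_normed_field) \<in> mixed_ball p N1 u N2"
proof -
  let ?f = "sign_prior N1 N2 (cell N1 N2 r1 r2) h \<pi> \<Gamma> T :: _ \<Rightarrow> 'k"
  let ?d1 = "N1 div r1" and ?d2 = "N2 div r2"
  have d: "1 \<le> ?d1" "1 \<le> ?d2" using r by (simp_all add: Suc_le_eq div_greater_zero_iff)
  have N: "1 \<le> N1" "1 \<le> N2" using r by auto
  have \<rho>: "1 \<le> \<rho>" "1 \<le> \<tau>" using rows cols r by auto
  define x where "x i = Lp_norm u N2 (\<lambda>j. ?f (i, j))" for i
  have at: "norm (?f (i, j)) \<le> h"
    "?f (i, j) \<noteq> 0 \<Longrightarrow> ((i - 1) div ?d1, (j - 1) div ?d2) \<in> \<pi> ` \<Gamma>"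
    if "i \<in> {1..N1}" "j \<in> {1..N2}" for i j
    using sign_prior_at[OF \<Gamma> _ h(1), where lab = "cell N1 N2 r1 r2" and T = T and 'k = 'k, of "(i, j)"] that
    by (auto simp: cell_def)
  have small: "card A * \<rho> \<le> N"
    if A: "A \<subseteq> {1..N}" and r: "1 \<le> r" "r \<le> N"
      and *: "\<rho> = 1 \<or> \<rho> = r \<and> (\<forall>i\<in>A. \<forall>i'\<in>A. (i - 1) div (N div r) = (i' - 1) div (N div r))"
    for A and N r \<rho> :: nat
    using *
  proof
    assume "\<rho> = 1"
    then show ?thesis using card_mono[OF _ A] by simp
  next
    assume *: "\<rho> = r \<and> (\<forall>i\<in>A. \<forall>i'\<in>A. (i - 1) div (N div r) = (i' - 1) div (N div r))"
    show ?thesis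
    proof (cases "A = {}")
      case False
      then obtain i0 where i0: "i0 \<in> A" by auto
      have "A \<subseteq> {i \<in> {1..N}. (i - 1) div (N div r) = (i0 - 1) div (N div r)}" using A * i0 by blast
      then have "card A \<le> card {i \<in> {1..N}. (i - 1) div (N div r) = (i0 - 1) div (N div r)}"
        by (intro card_mono) auto
      also have "\<dots> \<le> N div r" using r by (intro card_block_le) (simp add: Suc_le_eq div_greater_zero_iff)
      finally have "card A * \<rho> \<le> N div r * r" using * by simp
      also have "\<dots> \<le> N" by simp
      finally show ?thesis .
    qed simp
  qed
  have row: "x i \<le> h * real \<tau> powr (- recip u)" if i: "i \<in> {1..N1}" for i
    unfolding x_def
  proof (rule Lp_norm_supported[OF p(2) N(2) h(1) _ _ \<rho>(2)])
    show "norm (?f (i, j)) \<le> h" if "j \<in> {1..N2}" for j using at(1)[OF i that] .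
    have "(j - 1) div ?d2 = (j' - 1) div ?d2"
      if ne: "\<tau> \<noteq> 1" and j: "j \<in> {1..N2}" "?f (i, j) \<noteq> 0"
        and j': "j' \<in> {1..N2}" "?f (i, j') \<noteq> 0" for j j'
    proof -
      obtain g k where "g \<in> \<Gamma>" "k \<in> \<Gamma>" "\<pi> g = ((i - 1) div ?d1, (j - 1) div ?d2)"
        "\<pi> k = ((i - 1) div ?d1, (j' - 1) div ?d2)"
        using at(2)[OF i j] at(2)[OF i j'] by force
      then show ?thesis using cols ne by (metis fst_conv snd_conv)
    qed
    then show "card {j \<in> {1..N2}. ?f (i, j) \<noteq> 0} * \<tau> \<le> N2" using cols r by (intro small[of _ N2 r2]) auto
  qed
  have "Lp_norm p N1 x \<le> (h * real \<tau> powr (- recip u)) * real \<rho> powr (- recip p)"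
  proof (rule Lp_norm_supported[OF p(1) N(1) _ _ _ \<rho>(1)])
    show "norm (x i) \<le> h * real \<tau> powr (- recip u)" if "i \<in> {1..N1}" for i
      using row[OF that] Lp_norm_nonneg[OF N(2), of u "\<lambda>j. ?f (i, j)"] by (simp add: x_def)
    have nz: "\<exists>g\<in>\<Gamma>. fst (\<pi> g) = (i - 1) div ?d1" if i: "i \<in> {1..N1}" "x i \<noteq> 0" for i
    proof -
      have "\<exists>j\<in>{1..N2}. ?f (i, j) \<noteq> 0"
      proof (rule ccontr)
        assume "\<not> ?thesis"
        then have zero: "\<forall>j\<in>{1..N2}. ?f (i, j) = 0" by blast
        then have "{j \<in> {1..N2}. ?f (i, j) \<noteq> 0} = {}" by blast
        then have "card {j \<in> {1..N2}. ?f (i, j) \<noteq> 0} * 1 \<le> N2" by (simp only:) simp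
        then have "x i \<le> 0 * real 1 powr (- recip u)"
          unfolding x_def using zero by (intro Lp_norm_supported[OF p(2) N(2)]) auto
        then show False using i Lp_norm_nonneg[OF N(2), of u "\<lambda>j. ?f (i, j)"] by (simp add: x_def)
      qed
      then obtain j where "((i - 1) div ?d1, (j - 1) div ?d2) \<in> \<pi> ` \<Gamma>" using at(2)[OF i(1)] by blast
      then obtain g where "g \<in> \<Gamma>" "((i - 1) div ?d1, (j - 1) div ?d2) = \<pi> g" by (rule imageE)
      then show ?thesis by (metis fst_conv)
    qed
    have "(i - 1) div ?d1 = (i' - 1) div ?d1"
      if "\<rho> \<noteq> 1" "i \<in> {1..N1}" "x i \<noteq> 0" "i' \<in> {1..N1}" "x i' \<noteq> 0" for i i'
      using nz[OF that(2,3)] nz[OF that(4,5)] rows that(1) by metis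
    then show "card {i \<in> {1..N1}. x i \<noteq> 0} * \<rho> \<le> N1" using rows r by (intro small[of _ N1 r1]) auto
  qed (use h in simp)
  also have "\<dots> = h / (real \<rho> powr recip p * real \<tau> powr recip u)"
    by (simp add: powr_minus divide_inverse mult_ac)
  also have "\<dots> \<le> 1" using h(2) \<rho> by (simp add: divide_le_eq)
  finally show ?thesis by (simp add: mixed_ball_def mixed_norm_def x_def[abs_def] sign_prior_def)
qed

lemma blocks_bound:
  fixes N r :: nat
  assumes "1 \<le> r" "r \<le> N"
  shows "N \<le> 2 * r * (N div r)"
proof -
  have "N < N div r * r + r" using assms dividend_less_div_times[of r N] by simp
  moreover have "r * 1 \<le> r * (N div r)"
    using assms by (intro mult_left_mono) (simp_all add: Suc_le_eq div_greater_zero_iff)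
  moreover have "N div r * r = r * (N div r)" "2 * r * (N div r) = 2 * (r * (N div r))" by simp_all
  ultimately show ?thesis by linarith
qed

text \<open>
  Rounding down the side lengths of the cells costs at most a factor \<open>2\<close> in each direction.
\<close>

lemma cell_weight:
  fixes N1 N2 r1 r2 :: nat and h s :: real
  assumes r: "1 \<le> r1" "r1 \<le> N1" "1 \<le> r2" "r2 \<le> N2" and h: "0 \<le> h" "0 \<le> s"
  shows "h * s / (16 * (r1 * r2)) \<le> h * ((N1 div r1) * (N2 div r2)) / (N1 * N2) * s / 4"
proof -
  have "N1 * N2 \<le> (2 * r1 * (N1 div r1)) * (2 * r2 * (N2 div r2))"
    using r by (intro mult_mono blocks_bound) auto
  then have "real (N1 * N2) \<le> real ((2 * r1 * (N1 div r1)) * (2 * r2 * (N2 div r2)))" by (rule of_nat_mono)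
  then have "1 / (4 * (real r1 * r2)) \<le> ((N1 div r1) * (N2 div r2)) / (real N1 * N2)"
    using r by (simp add: divide_simps mult_ac)
  then have "(h * s / 4) * (1 / (4 * (real r1 * r2))) \<le> (h * s / 4) * (((N1 div r1) * (N2 div r2)) / (real N1 * N2))"
    using h by (intro mult_left_mono) auto
  then show ?thesis by (simp add: mult_ac)
qed

text \<open>
  One active cell with a random sign in each group.
\<close>

lemma e_ran_transversal:
  fixes C :: "'g \<Rightarrow> (nat \<times> nat) set" and F :: "(nat \<times> nat \<Rightarrow> 'k::{real_normed_field, euclidean_space}) set"
  assumes r: "1 \<le> r1" "r1 \<le> N1" "1 \<le> r2" "r2 \<le> N2" and n: "4 * n \<le> r1 * r2"
    and \<Gamma>: "finite \<Gamma>" "\<Gamma> \<noteq> {}" and C: "\<And>g. g \<in> \<Gamma> \<Longrightarrow> C g \<subseteq> {..<r1} \<times> {..<r2}"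
    and q: "\<And>g. g \<in> \<Gamma> \<Longrightarrow> card (C g) = q" "card \<Gamma> * q = r1 * r2"
    and disj: "\<And>g k. g \<in> \<Gamma> \<Longrightarrow> k \<in> \<Gamma> \<Longrightarrow> g \<noteq> k \<Longrightarrow> C g \<inter> C k = {}" and h: "0 < h"
    and F: "\<And>\<pi> T. \<pi> \<in> PiE \<Gamma> C \<Longrightarrow> inj_on \<pi> \<Gamma> \<Longrightarrow> T \<subseteq> \<Gamma>
      \<Longrightarrow> sign_prior N1 N2 (cell N1 N2 r1 r2) h \<pi> \<Gamma> T \<in> F"
  shows "ennreal (h * sqrt (card \<Gamma>) / (16 * (r1 * r2))) \<le> e_ran n (mean_op N1 N2) F (std_info N1 N2)"
  unfolding e_ran_def
proof (rule INF_greatest, clarify)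
  fix M :: "(nat \<times> nat \<Rightarrow> 'k, 'k, 'k) det_alg measure" and A :: "_ \<Rightarrow> (nat \<times> nat \<Rightarrow> 'k, 'k, 'k) det_alg"
  assume ran: "ran_alg F (std_info N1 N2) M A" "ran_card F M A \<le> of_nat n"
  let ?d = "(N1 div r1) * (N2 div r2)" and ?\<Phi> = "PiE \<Gamma> C"
  have finC: "finite (C g)" if "g \<in> \<Gamma>" for g using finite_subset[OF C[OF that]] by simp
  have q1: "1 \<le> q" using q(2) r by (cases q) auto
  then have neC: "C g \<noteq> {}" if "g \<in> \<Gamma>" for g using q(1)[OF that] by auto
  have inj: "inj_on \<pi> \<Gamma>" if "\<pi> \<in> ?\<Phi>" for \<pi>
  proof (rule inj_onI)
    fix g k assume "g \<in> \<Gamma>" "k \<in> \<Gamma>" "\<pi> g = \<pi> k"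
    then show "g = k" using PiE_mem[OF that, of g] PiE_mem[OF that, of k] disj[of g k] by auto
  qed
  have "ennreal (h * ?d / (N1 * N2) * sqrt (card \<Gamma>) / 4) \<le> ran_error (mean_op N1 N2) F M A"
  proof (rule random_sign_lower_bound[OF ran _ _ \<Gamma>, where \<Phi> = ?\<Phi> and \<pi> = "\<lambda>\<pi>. \<pi>" and q = q
        and lab = "cell N1 N2 r1 r2"])
    show "finite ?\<Phi>" "?\<Phi> \<noteq> {}" using \<Gamma> finC neC by (auto simp: finite_PiE PiE_eq_empty_iff)
    show "card {z \<in> {1..N1} \<times> {1..N2}. \<pi> g = cell N1 N2 r1 r2 z} = ?d" if "\<pi> \<in> ?\<Phi>" "g \<in> \<Gamma>" for \<pi> g
      using PiE_mem[OF that] C[OF that(2)] r by (intro card_cell) auto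
    show "1 \<le> ?d" using r by (simp add: Suc_le_eq div_greater_zero_iff)
    show "4 * n \<le> card \<Gamma> * q" using n q by simp
    show "sign_prior N1 N2 (cell N1 N2 r1 r2) h \<pi> \<Gamma> T \<in> F" if "\<pi> \<in> ?\<Phi>" "T \<subseteq> \<Gamma>" for \<pi> T
      using F[OF that(1) inj[OF that(1)] that(2)] .
    show "q * (\<Sum>\<pi>\<in>?\<Phi>. card (hits N1 N2 (cell N1 N2 r1 r2) h \<pi> \<Gamma> (A w) T))
        \<le> 2 * (\<Sum>\<pi>\<in>?\<Phi>. the_enat (alg_card (A w) (sign_prior N1 N2 (cell N1 N2 r1 r2) h \<pi> \<Gamma> T)))"
      if "w \<in> space M"
        "\<And>\<pi>. \<pi> \<in> ?\<Phi> \<Longrightarrow> alg_card (A w) (sign_prior N1 N2 (cell N1 N2 r1 r2) h \<pi> \<Gamma> T) \<noteq> \<infinity>" for w T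
      using ran(1) that by (intro transversal_hits \<Gamma> finC q(1) disj) (auto simp: ran_alg_def)
  qed (use r q1 h in auto)
  moreover have "ennreal (h * sqrt (card \<Gamma>) / (16 * (r1 * r2))) \<le> ennreal (h * ?d / (N1 * N2) * sqrt (card \<Gamma>) / 4)"
    using cell_weight[OF r, of h "sqrt (card \<Gamma>)"] h by (intro ennreal_leI) simp
  ultimately show "ennreal (h * sqrt (card \<Gamma>) / (16 * (r1 * r2))) \<le> ran_error (mean_op N1 N2) F M A"
    by (rule order_trans[rotated])
qed

section \<open>Lower bounds for the mixed ball\<close>

text \<open>
  One group: a single active cell, as high as the ball permits.
\<close>

lemma e_ran_single_spike:
  fixes n N1 N2 r1 r2 :: nat
  assumes p: "1 \<le> p" "1 \<le> u" and r: "1 \<le> r1" "r1 \<le> N1" "1 \<le> r2" "r2 \<le> N2" and n: "4 * n \<le> r1 * r2"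
  shows "ennreal (real r1 powr recip p * real r2 powr recip u / (16 * (r1 * r2)))
    \<le> e_ran n (mean_op N1 N2 :: (nat \<times> nat \<Rightarrow> 'k::{real_normed_field, euclidean_space}) \<Rightarrow> 'k)
        (mixed_ball p N1 u N2) (std_info N1 N2)"
proof -
  let ?h = "real r1 powr recip p * real r2 powr recip u"
  have "ennreal (?h * sqrt (card {()}) / (16 * (r1 * r2)))
    \<le> e_ran n (mean_op N1 N2 :: (nat \<times> nat \<Rightarrow> 'k) \<Rightarrow> 'k) (mixed_ball p N1 u N2) (std_info N1 N2)"
  proof (rule e_ran_transversal[OF r n, where C = "\<lambda>_. {..<r1} \<times> {..<r2}" and q = "r1 * r2"])
    show "sign_prior N1 N2 (cell N1 N2 r1 r2) ?h \<pi> {()} T \<in> (mixed_ball p N1 u N2 :: (_ \<Rightarrow> 'k) set)"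
      if "inj_on \<pi> {()}" for \<pi> T
      using that by (intro sign_prior_in_ball[OF p r, where \<rho> = r1 and \<tau> = r2]) auto
  qed (use r in \<open>auto simp: card_cartesian_product\<close>)
  then show ?thesis by simp
qed

text \<open>
  Each cell is a group: a function of absolute value \<open>1\<close> on all cells.
\<close>

lemma e_ran_all_signs:
  fixes n N1 N2 r1 r2 :: nat
  assumes p: "1 \<le> p" "1 \<le> u" and r: "1 \<le> r1" "r1 \<le> N1" "1 \<le> r2" "r2 \<le> N2" and n: "4 * n \<le> r1 * r2"
  shows "ennreal (sqrt (r1 * r2) / (16 * (r1 * r2)))
    \<le> e_ran n (mean_op N1 N2 :: (nat \<times> nat \<Rightarrow> 'k::{real_normed_field, euclidean_space}) \<Rightarrow> 'k)
        (mixed_ball p N1 u N2) (std_info N1 N2)"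
proof -
  let ?\<Gamma> = "{..<r1} \<times> {..<r2}"
  have "ennreal (1 * sqrt (card ?\<Gamma>) / (16 * (r1 * r2)))
    \<le> e_ran n (mean_op N1 N2 :: (nat \<times> nat \<Rightarrow> 'k) \<Rightarrow> 'k) (mixed_ball p N1 u N2) (std_info N1 N2)"
  proof (rule e_ran_transversal[OF r n, where C = "\<lambda>g. {g}" and q = 1])
    show "sign_prior N1 N2 (cell N1 N2 r1 r2) 1 \<pi> ?\<Gamma> T \<in> (mixed_ball p N1 u N2 :: (_ \<Rightarrow> 'k) set)"
      if "inj_on \<pi> ?\<Gamma>" for \<pi> T
      using that by (intro sign_prior_in_ball[OF p r, where \<rho> = 1 and \<tau> = 1]) auto
  qed (use r in \<open>auto simp: card_cartesian_product lessThan_empty_iff\<close>)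
  then show ?thesis by (simp add: card_cartesian_product)
qed

text \<open>
  Each row block is a group: every row block carries one spike, so only the inner norm limits
  the height.
\<close>

lemma e_ran_spike_per_row_block:
  fixes n N1 N2 r1 r2 :: nat
  assumes p: "1 \<le> p" "1 \<le> u" and r: "1 \<le> r1" "r1 \<le> N1" "1 \<le> r2" "r2 \<le> N2" and n: "4 * n \<le> r1 * r2"
  shows "ennreal (real r2 powr recip u * sqrt r1 / (16 * (r1 * r2)))
    \<le> e_ran n (mean_op N1 N2 :: (nat \<times> nat \<Rightarrow> 'k::{real_normed_field, euclidean_space}) \<Rightarrow> 'k)
        (mixed_ball p N1 u N2) (std_info N1 N2)"
proof -
  let ?h = "real r2 powr recip u"
  have "ennreal (?h * sqrt (card {..<r1}) / (16 * (r1 * r2)))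
    \<le> e_ran n (mean_op N1 N2 :: (nat \<times> nat \<Rightarrow> 'k) \<Rightarrow> 'k) (mixed_ball p N1 u N2) (std_info N1 N2)"
  proof (rule e_ran_transversal[OF r n, where C = "\<lambda>a. {a} \<times> {..<r2}" and q = r2])
    show "sign_prior N1 N2 (cell N1 N2 r1 r2) ?h \<pi> {..<r1} T \<in> (mixed_ball p N1 u N2 :: (_ \<Rightarrow> 'k) set)"
      if \<pi>: "\<pi> \<in> PiE {..<r1} (\<lambda>a. {a} \<times> {..<r2})" "inj_on \<pi> {..<r1}" for \<pi> T
    proof (rule sign_prior_in_ball[OF p r, where \<rho> = 1 and \<tau> = r2])
      have "fst (\<pi> a) = a" if "a < r1" for a using PiE_mem[OF \<pi>(1), of a] that by auto
      then show "r2 = 1 \<or> r2 = r2 \<and> (\<forall>g\<in>{..<r1}. \<forall>k\<in>{..<r1}. fst (\<pi> g) = fst (\<pi> k) \<longrightarrow> snd (\<pi> g) = snd (\<pi> k))"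
        by auto
    qed (use \<pi> in auto)
  qed (use r in \<open>auto simp: card_cartesian_product lessThan_empty_iff\<close>)
  then show ?thesis by simp
qed

text \<open>
  Here the groups are the cells of one row block, and the position of this row block is
  random. The outer norm permits the height \<open>r1 powr (1/p)\<close>.
\<close>

lemma e_ran_non_signs_in_one_row:
  fixes n N1 N2 r1 r2 :: nat
  assumes p: "1 \<le> p" "1 \<le> u" and r: "1 \<le> r1" "r1 \<le> N1" "1 \<le> r2" "r2 \<le> N2" and n: "4 * n \<le> r1 * r2"
  shows "ennreal (real r1 powr recip p * sqrt r2 / (16 * (r1 * r2)))
    \<le> e_ran_non n (mean_op N1 N2 :: (nat \<times> nat \<Rightarrow> 'k::{real_normed_field, euclidean_space}) \<Rightarrow> 'k)
        (mixed_ball p N1 u N2) (std_info N1 N2)"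
  unfolding e_ran_non_def
proof (rule INF_greatest, clarify)
  let ?F = "mixed_ball p N1 u N2 :: (_ \<Rightarrow> 'k) set"
  fix M :: "(nat \<times> nat \<Rightarrow> 'k, 'k, 'k) det_alg measure" and A :: "_ \<Rightarrow> (nat \<times> nat \<Rightarrow> 'k, 'k, 'k) det_alg"
  assume ran: "ran_alg ?F (std_info N1 N2) M A" "ran_card ?F M A \<le> of_nat n" and non: "ran_nonadaptive M A"
  let ?d = "(N1 div r1) * (N2 div r2)" and ?h = "real r1 powr recip p"
  let ?f = "\<lambda>i. sign_prior N1 N2 (cell N1 N2 r1 r2) ?h (Pair i) {..<r2} :: _ \<Rightarrow> _ \<Rightarrow> 'k"
  have "ennreal (?h * ?d / (N1 * N2) * sqrt (card {..<r2}) / 4) \<le> ran_error (mean_op N1 N2) ?F M A"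
  proof (rule random_sign_lower_bound[OF ran, where \<Phi> = "{..<r1}" and \<pi> = Pair and q = r1
        and lab = "cell N1 N2 r1 r2"])
    show "card {z \<in> {1..N1} \<times> {1..N2}. (i, b) = cell N1 N2 r1 r2 z} = ?d" if "i \<in> {..<r1}" "b \<in> {..<r2}" for i b
      using that r by (intro card_cell) auto
    show "1 \<le> ?d" using r by (simp add: Suc_le_eq div_greater_zero_iff)
    show "?f i T \<in> ?F" for i T
      by (rule sign_prior_in_ball[OF p r, where \<rho> = r1 and \<tau> = 1]) (auto simp: inj_on_def)
    fix w T
    assume w: "w \<in> space M" and fin: "\<And>i. i \<in> {..<r1} \<Longrightarrow> alg_card (A w) (?f i T) \<noteq> \<infinity>"
    have "card {..<r1} * (\<Sum>i<r1. card (hits N1 N2 (cell N1 N2 r1 r2) ?h (Pair i) {..<r2} (A w) T))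
        \<le> (\<Sum>i<r1. the_enat (alg_card (A w) (?f i T)))"
      using non w by (intro nonadaptive_hits fin) (auto simp: ran_nonadaptive_def inj_on_def)
    then show "r1 * (\<Sum>i<r1. card (hits N1 N2 (cell N1 N2 r1 r2) ?h (Pair i) {..<r2} (A w) T))
        \<le> 2 * (\<Sum>i<r1. the_enat (alg_card (A w) (?f i T)))" by simp
  qed (use r n in \<open>auto simp: lessThan_empty_iff mult.commute\<close>)
  moreover have "ennreal (?h * sqrt r2 / (16 * (r1 * r2))) \<le> ennreal (?h * ?d / (N1 * N2) * sqrt (card {..<r2}) / 4)"
    using cell_weight[OF r, of ?h "sqrt r2"] by (intro ennreal_leI) simp
  ultimately show "ennreal (?h * sqrt r2 / (16 * (r1 * r2))) \<le> ran_error (mean_op N1 N2) ?F M A"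
    by (rule order_trans[rotated])
qed

text \<open>
  Refine the columns first, and the rows only when the columns are exhausted.
\<close>

lemma cell_counts:
  fixes n N1 N2 :: nat
  assumes "1 \<le> n" "1 \<le> N1" "1 \<le> N2" "4 * n < N1 * N2"
  obtains r1 r2 where "1 \<le> r1" "r1 \<le> N1" "1 \<le> r2" "r2 \<le> N2" "4 * n \<le> r1 * r2" "r1 * r2 \<le> 8 * n"
    "r1 = 1 \<or> r2 = N2"
proof (cases "4 * n \<le> N2")
  case True
  then show ?thesis using assms by (intro that[of 1 "4 * n"]) auto
next
  case False
  define r1 where "r1 = Suc ((4 * n - 1) div N2)"
  have "(4 * n - 1) div N2 * N2 \<le> 4 * n - 1" by simp
  moreover have "4 * n - 1 < (4 * n - 1) div N2 * N2 + N2" using assms dividend_less_div_times[of N2 "4 * n - 1"] by simp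
  moreover have "r1 * N2 = (4 * n - 1) div N2 * N2 + N2" by (simp add: r1_def)
  ultimately have b: "4 * n \<le> r1 * N2" "r1 * N2 \<le> 8 * n" using False assms by linarith+
  have "4 * n - 1 < N1 * N2" using assms by linarith
  then have "(4 * n - 1) div N2 < N1" by (rule less_mult_imp_div_less)
  then show ?thesis using b assms by (intro that[of r1 N2]) (auto simp: r1_def)
qed

text \<open>
  The functions \<open>f 1\<close> and \<open>f (-1)\<close> vanish where the run on zero samples and equal \<open>1\<close> or \<open>-1\<close>
  elsewhere. They yield the same output, although their means differ by \<open>2 * m\<close>.
\<close>

lemma e_det_lower:
  fixes n N1 N2 :: nat
  assumes p: "1 \<le> p" "1 \<le> u" and N: "1 \<le> N1" "1 \<le> N2"
  shows "ennreal (1 - n / (N1 * N2))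
    \<le> e_det n (mean_op N1 N2 :: (nat \<times> nat \<Rightarrow> 'k::{real_normed_field, euclidean_space}) \<Rightarrow> 'k)
        (mixed_ball p N1 u N2) (std_info N1 N2)"
  unfolding e_det_def
proof (rule INF_greatest)
  let ?F = "mixed_ball p N1 u N2 :: (_ \<Rightarrow> 'k) set" and ?G = "{1..N1} \<times> {1..N2}"
  fix A :: "(nat \<times> nat \<Rightarrow> 'k, 'k, 'k) det_alg"
  assume "A \<in> {A \<in> det_algs (std_info N1 N2). (SUP f\<in>?F. alg_card A f) \<le> enat n}"
  then have A: "A \<in> det_algs (std_info N1 N2)" and n: "(SUP f\<in>?F. alg_card A f) \<le> enat n" by blast+
  define f0 where "f0 = (\<lambda>z\<in>?G. 0 :: 'k)"
  define V where "V = visited N1 N2 A f0"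
  define f where "f \<epsilon> = (\<lambda>z\<in>?G. if z \<in> V then 0 else of_real \<epsilon> :: 'k)" for \<epsilon>
  have ball: "g \<in> ?F" if g: "g \<in> extensional ?G" "\<And>z. z \<in> ?G \<Longrightarrow> norm (g z) \<le> 1" for g
  proof -
    have one: "Lp_norm q N x \<le> 1" if "1 \<le> q" "1 \<le> N" "\<And>i. i \<in> {1..N} \<Longrightarrow> norm (x i) \<le> 1"
      for q N and x :: "nat \<Rightarrow> 'x::real_normed_vector"
    proof -
      have "card {i \<in> {1..N}. x i \<noteq> 0} * 1 \<le> N" using card_mono[of "{1..N}" "{i \<in> {1..N}. x i \<noteq> 0}"] by fastforce
      from Lp_norm_supported[OF that(1,2) _ that(3) this] show ?thesis by simp
    qed
    have "Lp_norm p N1 (\<lambda>i. Lp_norm u N2 (\<lambda>j. g (i, j))) \<le> 1"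
      using g(2) N p by (intro one) (auto simp: Lp_norm_nonneg intro!: one)
    then show ?thesis using g(1) by (simp add: mixed_ball_def mixed_norm_def)
  qed
  have F: "f0 \<in> ?F" "f \<epsilon> \<in> ?F" if "\<bar>\<epsilon>\<bar> = 1" for \<epsilon>
    using that by (auto intro!: ball simp: f0_def f_def)
  have "alg_card A f0 \<le> (SUP f\<in>?F. alg_card A f)" using F(1)[of 1] by (intro SUP_upper) auto
  also note n
  finally obtain c where c: "alg_card A f0 = enat c" "c \<le> n" by (cases "alg_card A f0") auto
  then have fin: "alg_card A f0 \<noteq> \<infinity>" by simp
  have V: "finite V" "card V \<le> n"
    using finite_visited[OF fin, of N1 N2] card_visited_le[OF c(1), of N1 N2] c(2) by (auto simp: V_def)
  have VG: "V \<subseteq> ?G" unfolding V_def by (rule visited_subset[OF A])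
  have "f0 z = f \<epsilon> z" if "z \<in> V" for z \<epsilon>
  proof -
    have "z \<in> ?G" using VG that by blast
    then show ?thesis using that by (simp only: f0_def f_def restrict_apply if_True)
  qed
  then have out: "alg_out A (f \<epsilon>) = alg_out A f0" for \<epsilon>
    using run_agree(2)[OF A fin] unfolding V_def by blast
  define m where "m = (real (N1 * N2) - card V) / (N1 * N2)"
  have mean: "mean_op N1 N2 (f \<epsilon>) = of_real (\<epsilon> * m)" for \<epsilon>
  proof -
    have "(\<Sum>z\<in>?G. f \<epsilon> z) = (\<Sum>z\<in>?G - V. of_real \<epsilon>)"
      by (intro sum.mono_neutral_cong_right) (auto simp: f_def)
    also have "\<dots> = of_real ((real (N1 * N2) - card V) * \<epsilon>)"
      using V VG card_mono[OF _ VG] by (simp add: card_Diff_subset card_cartesian_product of_nat_diff)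
    finally show ?thesis
      by (simp add: mean_op_eq_mean mean_def m_def card_cartesian_product scaleR_conv_of_real divide_inverse mult_ac)
  qed
  have m: "1 - n / (N1 * N2) \<le> m"
  proof -
    have "(real (N1 * N2) - n) / (N1 * N2) \<le> m" unfolding m_def using V by (intro divide_right_mono) auto
    moreover have "(real (N1 * N2) - n) / (N1 * N2) = 1 - n / (N1 * N2)" using N by (simp add: diff_divide_distrib)
    ultimately show ?thesis by simp
  qed
  let ?o = "alg_out A f0"
  have "norm ((of_real m - ?o) - (of_real (- m) - ?o)) \<le> norm (of_real m - ?o) + norm (of_real (- m) - ?o)"
    by (rule norm_triangle_ineq4)
  moreover have "(of_real m - ?o) - (of_real (- m) - ?o) = of_real (2 * m)"
    using mult_2[of "of_real m :: 'k"] by simp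
  ultimately have "2 * m \<le> norm (of_real m - ?o) + norm (of_real (- m) - ?o)"
    by (simp only: norm_of_real)
  then have "m \<le> norm (of_real (1 * m) - ?o) \<or> m \<le> norm (of_real (- 1 * m) - ?o)" by auto
  then obtain \<epsilon> :: real where \<epsilon>: "\<bar>\<epsilon>\<bar> = 1" "m \<le> norm (of_real (\<epsilon> * m) - ?o)"
    by (metis abs_1 abs_minus_cancel)
  then have "ennreal (1 - n / (N1 * N2)) \<le> ennreal (norm (mean_op N1 N2 (f \<epsilon>) - alg_out A (f \<epsilon>)))"
    using m by (intro ennreal_leI) (simp only: mean out)
  also have "\<dots> \<le> det_error (mean_op N1 N2) ?F A" unfolding det_error_def using F(2)[OF \<epsilon>(1)] by (rule SUP_upper)
  finally show "ennreal (1 - n / (N1 * N2)) \<le> det_error (mean_op N1 N2) ?F A" .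
qed

section \<open>Combining the bounds\<close>

text \<open>
  If \<open>r1 = 1\<close>, the left factor disappears and the second rate remains; if \<open>r2 = N\<close>, splitting off
  the power of \<open>N\<close> leaves a power of \<open>r1 * r2\<close>, which is comparable with \<open>n\<close>.
\<close>

lemma block_rate_ge:
  fixes n r1 r2 N :: nat
  assumes r: "1 \<le> r1" "1 \<le> r2" "r1 * r2 \<le> 8 * n" "r1 = 1 \<or> r2 = N"
    and ab: "0 \<le> a" "a \<le> 1" "0 \<le> b" "b \<le> (1::real)"
  shows "1 / 128 * min (real N powr (b - a) * real n powr (-1 + a)) (real n powr (-1 + b))
    \<le> real r1 powr a * real r2 powr b / (16 * (r1 * r2))"
proof -
  have key: "real n powr (-1 + c) / 8 \<le> real (r1 * r2) powr (-1 + c)" if c: "0 \<le> c" "c \<le> 1" for c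
  proof -
    have "(8 * real n) powr (-1 + c) \<le> real (r1 * r2) powr (-1 + c)"
      using r c of_nat_mono[OF r(3), where 'a = real] by (intro powr_mono2') auto
    moreover have "(8::real) powr -1 \<le> 8 powr (-1 + c)" using c by (intro powr_mono) auto
    then have "1 / 8 * real n powr (-1 + c) \<le> 8 powr (-1 + c) * real n powr (-1 + c)"
      by (intro mult_right_mono) auto
    ultimately show ?thesis by (simp add: powr_mult)
  qed
  have split: "real r1 powr a * real r2 powr b / (16 * (r1 * r2))
      = 1 / 16 * (real r1 powr (-1 + a) * real r2 powr (-1 + b))"
    using r by (simp add: powr_diff powr_minus_divide)
  show ?thesis
    using r(4)
  proof
    assume "r1 = 1"
    then show ?thesis unfolding split using key[OF ab(3,4)] by simp
  next
    assume "r2 = N"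
    have "real r1 powr (-1 + a) * real r2 powr (-1 + b)
        = real r2 powr (b - a) * real (r1 * r2) powr (-1 + a)"
      using powr_add[of "real r2" "b - a" "-1 + a"] by (simp add: powr_mult)
    also have "\<dots> \<ge> real r2 powr (b - a) * (real n powr (-1 + a) / 8)"
      by (intro mult_left_mono key ab) auto
    finally show ?thesis unfolding split using \<open>r2 = N\<close> by simp
  qed
qed

lemma e_ran_non_monte_carlo_recip:
  fixes p u :: ereal
  assumes p: "1 \<le> p" "1 \<le> u" and q: "1 \<le> q" "q \<le> 2" and N: "1 \<le> N1" "1 \<le> N2" and n: "1 \<le> n"
    and e: "max 0 (recip p - recip q) = a" "max 0 (recip u - recip q) = b"
  shows "e_ran_non n (mean_op N1 N2 :: (nat \<times> nat \<Rightarrow> 'k::{real_normed_field, euclidean_space}) \<Rightarrow> 'k)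
      (mixed_ball p N1 u N2) (std_info N1 N2)
    \<le> ennreal (3 * (N1 powr a * N2 powr b * real n powr (-1 + recip q)))"
proof -
  obtain x where x: "q = ereal x" "1 \<le> x" "x \<le> 2" using q by (cases q) (auto simp: one_ereal_def)
  show ?thesis
    using e_ran_non_monte_carlo[OF p x(2,3) N n, where 'k = 'k] e by (simp add: x recip_ereal mult.assoc)
qed

lemma recip_min_two: "recip (min p 2) = (if p \<le> 2 then recip p else 1 / 2)"
  by (simp add: min_def)

theorem theorem4p4:
  fixes p u :: ereal
  assumes "1 \<le> p" and "1 \<le> u"
  shows "\<exists>c0 c1 c2 c3 c4 c5 c6 c7 c8 c9 c10 c11 c12 c13 :: real.
    0 < c0 \<and> c0 < 1 \<and> (\<forall>c\<in>{c1, c2, c3, c4, c5, c6, c7, c8, c9, c10, c11, c12, c13}. 0 < c) \<and>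
    (\<forall>n N1 N2 :: nat. 1 \<le> n \<and> 1 \<le> N1 \<and> 1 \<le> N2 \<and> real n < c0 * real N1 * real N2 \<longrightarrow>
      (let pb = min p 2;
           ub = min u 2;
           I = (mean_op N1 N2 :: (nat \<times> nat \<Rightarrow> 'k::{real_normed_field, euclidean_space}) \<Rightarrow> 'k);
           B = mixed_ball p N1 u N2;
           \<Lambda> = std_info N1 N2;
           eran = e_ran n I B \<Lambda>;
           eran_non = e_ran_non n I B \<Lambda>;
           edet = e_det n I B \<Lambda>;
           edet_non = e_det_non n I B \<Lambda>
       in
        (p \<ge> u \<longrightarrow>
          ennreal (c1 * min (real N2 powr (recip ub - recip pb) * real n powr (-1 + recip pb))
                            (real n powr (-1 + recip ub))) \<le> eran \<and>
          eran \<le> eran_non \<and>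
          eran_non \<le> ennreal (c2 * min (real N2 powr (recip ub - recip pb) * real n powr (-1 + recip pb))
                                        (real n powr (-1 + recip ub)))) \<and>
        (p < u \<and> u \<le> 2 \<longrightarrow>
          ennreal (c3 * min (real N1 powr (recip p - recip u) * real n powr (-1 + recip u))
                            (real n powr (-1 + recip p))) \<le> eran \<and>
          eran \<le> eran_non \<and>
          eran_non \<le> ennreal (c4 * min (real N1 powr (recip p - recip u) * real n powr (-1 + recip u))
                                        (real n powr (-1 + recip p)))) \<and>
        (2 \<le> p \<and> p < u \<longrightarrow>
          ennreal (c5 * real n powr (-1/2)) \<le> eran \<and>
          eran \<le> eran_non \<and>
          eran_non \<le> ennreal (c6 * real n powr (-1/2))) \<and>
        (p < 2 \<and> 2 < u \<and> n \<ge> N1 \<longrightarrow>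
          ennreal (c7 * real N1 powr (recip p - recip u) * real n powr (-1 + recip u)
                   + c7 * real n powr (-1/2)) \<le> eran \<and>
          eran \<le> ennreal (c8 * real N1 powr (recip p - recip u) * real n powr (-1 + recip u)
                              * log 2 (real N1 + 1) powr (1 - recip u)
                          + c8 * real n powr (-1/2) * log 2 (real N1 + 1) powr (1/2)) \<and>
          ennreal (c9 * real N1 powr (recip p - 1/2) * real n powr (-1/2)) \<le> eran_non \<and>
          eran_non \<le> ennreal (c10 * real N1 powr (recip p - 1/2) * real n powr (-1/2))) \<and>
        (p < 2 \<and> 2 < u \<and> n < N1 \<longrightarrow>
          ennreal (c11 * real n powr (-1 + recip p)) \<le> eran \<and>
          eran \<le> eran_non \<and>
          eran_non \<le> ennreal (c12 * real n powr (-1 + recip p))) \<and>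
        (ennreal c13 \<le> edet \<and> edet \<le> edet_non \<and> edet_non \<le> 1)))"
proof (rule exI[of _ "1 / 4"], rule exI[of _ "1 / 128"], rule exI[of _ 3], rule exI[of _ "1 / 128"],
    rule exI[of _ 3], rule exI[of _ "1 / 128"], rule exI[of _ 3], rule exI[of _ "1 / 128 / 2"],
    rule exI[of _ 18], rule exI[of _ "1 / 128"], rule exI[of _ 3], rule exI[of _ "1 / 128"],
    rule exI[of _ 3], rule exI[of _ "3 / 4"], intro conjI allI impI, goal_cases)
  case (4 n N1 N2)
  let ?c = "1 / 128 :: real"
  note asm = 4
  from asm have n: "1 \<le> n" and N: "1 \<le> N1" "1 \<le> N2" by auto
  have "real (4 * n) < real (N1 * N2)" using asm by simp
  then have nN: "4 * n < N1 * N2" by (simp only: of_nat_less_iff)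
  define I where "I = (mean_op N1 N2 :: (nat \<times> nat \<Rightarrow> 'k) \<Rightarrow> 'k)"
  define B where "B = (mixed_ball p N1 u N2 :: (nat \<times> nat \<Rightarrow> 'k) set)"
  define \<Lambda> where "\<Lambda> = (std_info N1 N2 :: ((nat \<times> nat \<Rightarrow> 'k) \<Rightarrow> 'k) set)"
  define P where "P = recip p"
  define U where "U = recip u"
  have PU: "0 \<le> P" "P \<le> 1" "0 \<le> U" "U \<le> 1"
    unfolding P_def U_def using recip_bounds assms by auto
  have anti: "u \<le> p \<Longrightarrow> P \<le> U" "p \<le> u \<Longrightarrow> U \<le> P" "p \<le> 2 \<Longrightarrow> 1 / 2 \<le> P" "2 \<le> p \<Longrightarrow> P \<le> 1 / 2"
    "u \<le> 2 \<Longrightarrow> 1 / 2 \<le> U" "2 \<le> u \<Longrightarrow> U \<le> 1 / 2"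
    unfolding P_def U_def using recip_antimono[of u p] recip_antimono[of p u] recip_antimono[of p 2]
      recip_antimono[of 2 p] recip_antimono[of u 2] recip_antimono[of 2 u] assms by simp_all
  note fold = I_def [symmetric] B_def [symmetric] \<Lambda>_def [symmetric] P_def [symmetric] U_def [symmetric]
  have non: "e_ran n I B \<Lambda> \<le> e_ran_non n I B \<Lambda>" by (rule e_ran_le_e_ran_non)
  have mc: "e_ran_non n I B \<Lambda> \<le> ennreal (3 * (N1 powr a * N2 powr b * real n powr (-1 + recip q)))"
    if "1 \<le> q" "q \<le> 2" "max 0 (P - recip q) = a" "max 0 (U - recip q) = b" for q a b
    using e_ran_non_monte_carlo_recip[OF assms that(1,2) N n, where 'k = 'k] that unfolding fold by blast
  obtain r1 r2 where r: "1 \<le> r1" "r1 \<le> N1" "1 \<le> r2" "r2 \<le> N2" "4 * n \<le> r1 * r2" "r1 * r2 \<le> 8 * n"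
    "r1 = 1 \<or> r2 = N2" by (rule cell_counts[OF n N nN])
  \<comment> \<open>for \<open>p < u\<close> the rows are refined first, so the roles of rows and columns are exchanged\<close>
  have "4 * n < N2 * N1" using nN by (simp add: mult.commute)
  from cell_counts[OF n N(2,1) this] obtain s1 s2 where s: "1 \<le> s1" "s1 \<le> N1" "1 \<le> s2" "s2 \<le> N2"
    "4 * n \<le> s1 * s2" "s2 * s1 \<le> 8 * n" "s2 = 1 \<or> s1 = N1" by (metis mult.commute)
  note spike = e_ran_single_spike[OF assms, where ?N1.0 = N1 and ?N2.0 = N2 and 'k = 'k, unfolded fold]
  note signs = e_ran_all_signs[OF assms, where ?N1.0 = N1 and ?N2.0 = N2 and 'k = 'k, unfolded fold]
  note mixed = e_ran_spike_per_row_block[OF assms, where ?N1.0 = N1 and ?N2.0 = N2 and 'k = 'k, unfolded fold]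
  note row = e_ran_non_signs_in_one_row[OF assms, where ?N1.0 = N1 and ?N2.0 = N2 and 'k = 'k, unfolded fold]
  have half: "ennreal (?c * real n powr (-1 / 2)) \<le> e_ran n I B \<Lambda>"
  proof -
    have "?c * min (real N2 powr (1/2 - 1/2) * real n powr (-1 + 1/2)) (real n powr (-1 + 1/2))
        \<le> sqrt (r1 * r2) / (16 * (r1 * r2))"
      using block_rate_ge[of r1 r2 n N2 "1/2" "1/2"] r by (simp add: powr_half_sqrt real_sqrt_mult)
    then have "?c * real n powr (-1 / 2) \<le> sqrt (r1 * r2) / (16 * (r1 * r2))" using N by simp
    from order_trans[OF ennreal_leI[OF this] signs[OF r(1-5)]] show ?thesis .
  qed
  have col: "ennreal (?c * min (real N1 powr (P - U) * real n powr (-1 + U)) (real n powr (-1 + P))) \<le> e_ran n I B \<Lambda>"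
  proof -
    have "?c * min (real N1 powr (P - U) * real n powr (-1 + U)) (real n powr (-1 + P))
        \<le> real s1 powr P * real s2 powr U / (16 * (s1 * s2))"
      using block_rate_ge[of s2 s1 n N1 U P] s PU by (simp add: mult.commute)
    from order_trans[OF ennreal_leI[OF this] spike[OF s(1-5)]] show ?thesis .
  qed
  \<comment> \<open>decides which term is the smaller one in the minimum of two rates\<close>
  have gap: "n \<ge> N1 \<Longrightarrow> real N1 powr (P - b) * real n powr (-1 + b) \<le> real n powr (-1 + P)"
    "n < N1 \<Longrightarrow> real n powr (-1 + P) \<le> real N1 powr (P - b) * real n powr (-1 + b)" if "b \<le> P" for b
  proof -
    have eq: "real n powr (-1 + P) = real n powr (P - b) * real n powr (-1 + b)" by (simp flip: powr_add)
    show "real N1 powr (P - b) * real n powr (-1 + b) \<le> real n powr (-1 + P)" if "n \<ge> N1"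
      unfolding eq using that \<open>b \<le> P\<close> by (intro mult_right_mono powr_mono2) auto
    show "real n powr (-1 + P) \<le> real N1 powr (P - b) * real n powr (-1 + b)" if "n < N1"
      unfolding eq using that \<open>b \<le> P\<close> by (intro mult_right_mono powr_mono2) auto
  qed
  have caseA: "ennreal (?c * min (real N2 powr (recip (min u 2) - recip (min p 2)) * real n powr (-1 + recip (min p 2)))
        (real n powr (-1 + recip (min u 2)))) \<le> e_ran n I B \<Lambda>"
    "e_ran_non n I B \<Lambda> \<le> ennreal (3 * min (real N2 powr (recip (min u 2) - recip (min p 2))
        * real n powr (-1 + recip (min p 2))) (real n powr (-1 + recip (min u 2))))" if up: "p \<ge> u"
  proof -
    define a where "a = recip (min p 2)"
    define b where "b = recip (min u 2)"
    have ab: "0 \<le> a" "a \<le> 1" "0 \<le> b" "b \<le> 1" "a \<le> b" "P \<le> a" "P \<le> b" "U \<le> b"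
      using PU anti up unfolding a_def b_def recip_min_two fold by auto
    have "ennreal (real r1 powr a * real r2 powr b / (16 * (r1 * r2))) \<le> e_ran n I B \<Lambda>"
    proof -
      \<comment> \<open>in each case one of the three priors attains the rate with exponents \<open>a\<close> and \<open>b\<close>\<close>
      consider "2 < u" | "u \<le> 2" "2 < p" | "p \<le> 2" by force
      then show ?thesis
      proof cases
        case 1
        then have e: "a = 1 / 2" "b = 1 / 2" using up by (auto simp: a_def b_def recip_min_two)
        then show ?thesis using signs[OF r(1-5)] unfolding e by (simp add: powr_half_sqrt real_sqrt_mult)
      next
        case 2
        then have e: "a = 1 / 2" "b = U" by (auto simp: a_def b_def recip_min_two fold)
        then show ?thesis using mixed[OF r(1-5)] unfolding e by (simp add: powr_half_sqrt mult.commute)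
      next
        case 3
        then have e: "a = P" "b = U" using up by (auto simp: a_def b_def recip_min_two fold)
        then show ?thesis using spike[OF r(1-5)] unfolding e by simp
      qed
    qed
    from order_trans[OF ennreal_leI[OF block_rate_ge[OF r(1,3,6,7) ab(1-4)]] this]
    show "ennreal (?c * min (real N2 powr (b - a) * real n powr (-1 + a)) (real n powr (-1 + b))) \<le> e_ran n I B \<Lambda>" .
    have "max 0 (U - a) = b - a" using ab anti PU up unfolding a_def b_def recip_min_two fold by auto
    then have "e_ran_non n I B \<Lambda> \<le> ennreal (3 * (N1 powr 0 * N2 powr (b - a) * real n powr (-1 + a)))"
      using assms ab by (intro mc[of "min p 2", folded a_def]) auto
    moreover have "e_ran_non n I B \<Lambda> \<le> ennreal (3 * (N1 powr 0 * N2 powr 0 * real n powr (-1 + b)))"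
      using assms ab by (intro mc[of "min u 2", folded b_def]) auto
    ultimately show "e_ran_non n I B \<Lambda> \<le> ennreal (3 * min (real N2 powr (b - a) * real n powr (-1 + a)) (real n powr (-1 + b)))"
      using N by (simp add: min_def)
  qed
  have caseB: "e_ran_non n I B \<Lambda> \<le> ennreal (3 * min (real N1 powr (P - U) * real n powr (-1 + U)) (real n powr (-1 + P)))"
    if "p < u" "u \<le> 2"
  proof -
    have "e_ran_non n I B \<Lambda> \<le> ennreal (3 * (N1 powr (P - U) * N2 powr 0 * real n powr (-1 + U)))"
      using assms that anti by (intro mc[of u, folded U_def]) auto
    moreover have "e_ran_non n I B \<Lambda> \<le> ennreal (3 * (N1 powr 0 * N2 powr 0 * real n powr (-1 + P)))"
      using assms that anti by (intro mc[of p, folded P_def]) auto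
    ultimately show ?thesis using N by (simp add: min_def)
  qed
  have caseC: "e_ran_non n I B \<Lambda> \<le> ennreal (3 * real n powr (-1 / 2))" if "2 \<le> p" "p < u"
  proof -
    have "e_ran_non n I B \<Lambda> \<le> ennreal (3 * (N1 powr 0 * N2 powr 0 * real n powr (-1 + recip 2)))"
      using that anti by (intro mc) auto
    then show ?thesis using N by simp
  qed
  have caseD: "ennreal (?c / 2 * real N1 powr (P - U) * real n powr (-1 + U) + ?c / 2 * real n powr (-1 / 2)) \<le> e_ran n I B \<Lambda>"
    "e_ran n I B \<Lambda> \<le> ennreal (18 * real N1 powr (P - U) * real n powr (-1 + U) * log 2 (real N1 + 1) powr (1 - U)
        + 18 * real n powr (-1 / 2) * log 2 (real N1 + 1) powr (1 / 2))"
    "ennreal (?c * real N1 powr (P - 1 / 2) * real n powr (-1 / 2)) \<le> e_ran_non n I B \<Lambda>"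
    "e_ran_non n I B \<Lambda> \<le> ennreal (3 * real N1 powr (P - 1 / 2) * real n powr (-1 / 2))"
    if pu: "p < 2" "2 < u" and nN1: "n \<ge> N1"
  proof -
    have ord: "U \<le> 1 / 2" "1 / 2 \<le> P" "U \<le> P" using anti pu by auto
    let ?X = "real N1 powr (P - U) * real n powr (-1 + U)" and ?Y = "real n powr (-1 / 2)"
    have X: "ennreal (?c * ?X) \<le> e_ran n I B \<Lambda>" using col gap(1)[OF ord(3) nN1] by (simp add: min_def)
    have "?c / 2 * real N1 powr (P - U) * real n powr (-1 + U) + ?c / 2 * ?Y \<le> max (?c * ?X) (?c * ?Y)" by simp
    from order_trans[OF ennreal_leI[OF this]]
    show "ennreal (?c / 2 * real N1 powr (P - U) * real n powr (-1 + U) + ?c / 2 * ?Y) \<le> e_ran n I B \<Lambda>"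
      using X half by (simp add: max_def)
    let ?L = "log 2 (real N1 + 1)"
    have L: "1 \<le> ?L" using N by (simp add: le_log_iff)
    \<comment> \<open>both powers of the logarithm are at least \<open>1\<close>\<close>
    have "?X \<le> ?X * ?L powr (1 - U)" "?Y \<le> ?Y * ?L powr (1 / 2)"
      using L PU ge_one_powr_ge_zero[of ?L] by (auto intro!: mult_le_cancel_left1[THEN iffD2])
    then have "18 * (?X + ?Y) \<le> 18 * real N1 powr (P - U) * real n powr (-1 + U) * ?L powr (1 - U)
        + 18 * ?Y * ?L powr (1 / 2)" by (simp add: mult.assoc)
    moreover have "e_ran n I B \<Lambda> \<le> ennreal (18 * (?X + ?Y))"
      using e_ran_adaptive[OF assms(1) less_imp_le[OF pu(1)] pu(2) N nN1, where 'k = 'k] unfolding fold .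
    ultimately show "e_ran n I B \<Lambda> \<le> ennreal (18 * real N1 powr (P - U) * real n powr (-1 + U) * ?L powr (1 - U)
        + 18 * ?Y * ?L powr (1 / 2))" by (blast intro: order_trans ennreal_leI)
    have "?c * min (real N1 powr (P - 1 / 2) * real n powr (-1 + 1 / 2)) (real n powr (-1 + P))
        \<le> real s1 powr P * sqrt s2 / (16 * (s1 * s2))"
      using block_rate_ge[of s2 s1 n N1 "1 / 2" P] s PU by (simp add: mult.commute powr_half_sqrt)
    then have "?c * real N1 powr (P - 1 / 2) * ?Y \<le> real s1 powr P * sqrt s2 / (16 * (s1 * s2))"
      using gap(1)[OF ord(2) nN1] by (simp add: min_def)
    from order_trans[OF ennreal_leI[OF this] row[OF s(1-5)]]
    show "ennreal (?c * real N1 powr (P - 1 / 2) * ?Y) \<le> e_ran_non n I B \<Lambda>" .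
    have "e_ran_non n I B \<Lambda> \<le> ennreal (3 * (N1 powr (P - 1 / 2) * N2 powr 0 * real n powr (-1 + recip 2)))"
      using ord by (intro mc) auto
    then show "e_ran_non n I B \<Lambda> \<le> ennreal (3 * real N1 powr (P - 1 / 2) * ?Y)" using N by (simp add: mult.assoc)
  qed
  have caseE: "ennreal (?c * real n powr (-1 + P)) \<le> e_ran n I B \<Lambda>"
    "e_ran_non n I B \<Lambda> \<le> ennreal (3 * real n powr (-1 + P))" if pu: "p < 2" "2 < u" and nN1: "n < N1"
  proof -
    have ord: "U \<le> P" using anti pu by auto
    show "ennreal (?c * real n powr (-1 + P)) \<le> e_ran n I B \<Lambda>" using col gap(2)[OF ord nN1] by (simp add: min_def split: if_splits)
    have "e_ran_non n I B \<Lambda> \<le> ennreal (3 * (N1 powr 0 * N2 powr 0 * real n powr (-1 + P)))"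
      using assms pu ord by (intro mc[of p, folded P_def]) auto
    then show "e_ran_non n I B \<Lambda> \<le> ennreal (3 * real n powr (-1 + P))" using N by simp
  qed
  have det: "ennreal (3 / 4) \<le> e_det n I B \<Lambda>"
  proof -
    have "3 / 4 \<le> 1 - real n / (real N1 * real N2)" using asm N by (simp add: divide_simps)
    from order_trans[OF ennreal_leI[OF this]] show ?thesis
      using e_det_lower[OF assms N, of n, where 'k = 'k] unfolding fold by simp
  qed
  have det_one: "e_det_non n I B \<Lambda> \<le> 1"
    using e_det_non_le_one[OF assms N, of n, where 'k = 'k] unfolding fold .
  show ?case
    unfolding Let_def fold
    by (intro conjI impI; (elim conjE)?;
        (rule caseA caseB caseC caseD caseE col half non det det_one e_det_le_e_det_non; assumption?))
qed simp_all

end
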